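(* Let $\phi:\mathbb{Z}^d\to\mathbb{C}$ be finitely supported and normalized so that $\phi\in\mathcal{H}_d^*$ (i.e. $\sup_{\xi\in\mathbb{T}^d}|\widehat\phi(\xi)|=1$). Suppose every point of $\Omega(\phi)=\{\xi_1,\dots,\xi_K\}$ is of positive-homogeneous type for $\widehat\phi$ and, for $k=1,\dots,K$, let $\alpha_k\in\mathbb{R}^d$, $P_k$, $R_k=\operatorname{Re}P_k$ and $\mu_k$ be the drift, positive-homogeneous polynomial, its real part, and its homogeneous order associated to $\xi_k$. Then there are positive constants $M_1,\dots,M_K,C_1,\dots,C_K$ for which $$|\phi^{(n)}(x)|\leq\sum_{k=1}^K\frac{C_k}{n^{\mu_k}}\exp\left(-nM_kR_k^{\#}\left(\frac{x-n\alpha_k}{n}\right)\right)$$ for all $n\in\mathbb{N}_+$ and $x\in\mathbb{Z}^d$.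
   Context: $\mathbb{N}_+$ denotes the positive integers, $\mathbb{T}^d=(-\pi,\pi]^d$. Convolution powers. For $\phi\in\ell^1(\mathbb{Z}^d)$ (complex-valued, absolutely summable), $(\phi*\lambda)(x)=\sum_{y\in\mathbb{Z}^d}\phi(x-y)\lambda(y)$, $\phi^{(1)}=\phi$ and $\phi^{(n)}=\phi^{(n-1)}*\phi$ for $n\ge 2$. The Fourier transform is $\widehat{\phi}(\xi)=\sum_{x\in\mathbb{Z}^d}\phi(x)e^{ix\cdot\xi}$. $\mathcal{H}_d$ is the set of $\phi\in\ell^1(\mathbb{Z}^d)$ for which $\widehat\phi$ is holomorphic on (i.e. extends holomorphically to) a neighborhood of $\mathbb{T}^d$ in $\mathbb{C}^d$ (finitely supported functions belong to it). $\mathcal{H}_d^*$ is the set of $\phi\in\mathcal{H}_d$ with $\sup_{\xi\in\mathbb{T}^d}|\widehat\phi(\xi)|=1$. For $\phi\in\mathcal{H}_d^*$, $\Omega(\phi)=\{\xi\in\mathbb{T}^d:|\widehat\phi(\xi)|=1\}$. Positive-homogeneous polynomials. For a real $d\times d$ matrix $E$ and $t>0$, $t^E=\exp((\ln t)E)$. For $P:\mathbb{R}^d\to\mathbb{C}$, $\operatorname{Exp}(P)$ is the set of real $d\times d$ matrices $E$ with $tP(\xi)=P(t^E\xi)$ for all $t>0$, $\xi\in\mathbb{R}^d$. A complex polynomial $P$ in $d$ variables is a positive-homogeneous polynomial if $\operatorname{Exp}(P)\neq\varnothing$ and $R=\operatorname{Re}P$ (on $\mathbb{R}^d$) is positive-definite: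 $R(\xi)\geq 0$ and $R(\xi)=0$ only when $\xi=0$. Its homogeneous order is $\mu_P=\operatorname{tr}E$ for any $E\in\operatorname{Exp}(P)$ (a positive number independent of $E$). The Legendre-Fenchel transform of $R$ is $R^{\#}(x)=\sup_{\xi\in\mathbb{R}^d}\{x\cdot\xi-R(\xi)\}$, $x\in\mathbb{R}^d$. Type of points. For $\xi_0\in\Omega(\phi)$ set $\Gamma_{\xi_0}(\xi)=\operatorname{Log}\big(\widehat\phi(\xi+\xi_0)/\widehat\phi(\xi_0)\big)$ (principal branch), which is holomorphic on a neighborhood of $0$ in $\mathbb{C}^d$. The point $\xi_0$ is of positive-homogeneous type for $\widehat\phi$ if $\Gamma_{\xi_0}(\xi)=i\alpha_{\xi_0}\cdot\xi-P_{\xi_0}(\xi)+\Upsilon_{\xi_0}(\xi)$ where $\alpha_{\xi_0}\in\mathbb{R}^d$ (the drift), $P_{\xi_0}$ is a positive-homogeneous polynomial with $R_{\xi_0}=\operatorname{Re}P_{\xi_0}$, and $\Upsilon_{\xi_0}(\xi)=o(R_{\xi_0}(\xi))$ as $\xi\to0$ in $\mathbb{R}^d$. If every point of $\Omega(\phi)$ is of this type then $\Omega(\phi)$ is finite; one writes $\alpha_k=\alpha_{\xi_k}$, $P_k=P_{\xi_k}$, $R_k=R_{\xi_k}$, $\mu_k=\mu_{P_{\xi_k}}$. *)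

theory Defs
  imports "HOL-Analysis.Analysis" "HOL-Library.Landau_Symbols"
begin

text \<open>
  The dimension \<open>d\<close> is the cardinality of the finite index type \<open>'d\<close>: lattice points have type
  \<open>int ^ 'd\<close>, points of Euclidean and of complex \<open>d\<close>-space have types \<open>real ^ 'd\<close> and
  \<open>complex ^ 'd\<close>.
\<close>

definition real_vec :: "int ^ 'd \<Rightarrow> real ^ 'd" where
  "real_vec x = (\<chi> i. real_of_int (x $ i))"

definition complex_vec :: "real ^ 'd \<Rightarrow> complex ^ 'd" where
  "complex_vec \<xi> = (\<chi> i. complex_of_real (\<xi> $ i))"

definition torus :: "(real ^ 'd) set" where
  "torus = {\<xi>. \<forall>i. - pi < \<xi> $ i \<and> \<xi> $ i \<le> pi}"

section \<open>Convolution powers and the Fourier transform\<close>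

definition conv :: "(int ^ 'd \<Rightarrow> complex) \<Rightarrow> (int ^ 'd \<Rightarrow> complex) \<Rightarrow> int ^ 'd \<Rightarrow> complex" where
  "conv \<phi> \<psi> x = (\<Sum>\<^sub>\<infinity>y. \<phi> (x - y) * \<psi> y)"

text \<open>Exponent 0 is not part of the usual convention (\<open>n \<ge> 1\<close>); it is set to the unit of
  convolution.\<close>

fun conv_power :: "(int ^ 'd \<Rightarrow> complex) \<Rightarrow> nat \<Rightarrow> int ^ 'd \<Rightarrow> complex" where
  "conv_power \<phi> 0 = (\<lambda>x. if x = 0 then 1 else 0)"
| "conv_power \<phi> (Suc 0) = \<phi>"
| "conv_power \<phi> (Suc (Suc n)) = conv (conv_power \<phi> (Suc n)) \<phi>"

definition fourier :: "(int ^ 'd \<Rightarrow> complex) \<Rightarrow> real ^ 'd \<Rightarrow> complex" where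
  "fourier \<phi> \<xi> = (\<Sum>\<^sub>\<infinity>x. \<phi> x * exp (\<i> * complex_of_real (real_vec x \<bullet> \<xi>)))"

text \<open>Complex differentiability on an open subset of \<open>complex ^ 'd\<close>; \<open>g\<close> is the complex gradient.\<close>

definition holomorphic_vec :: "(complex ^ 'd \<Rightarrow> complex) \<Rightarrow> (complex ^ 'd) set \<Rightarrow> bool" where
  "holomorphic_vec F U \<longleftrightarrow>
     (\<forall>z\<in>U. \<exists>g. (F has_derivative (\<lambda>v. \<Sum>i\<in>UNIV. g $ i * v $ i)) (at z))"

definition H_class :: "(int ^ 'd \<Rightarrow> complex) set" where
  "H_class = {\<phi>. (\<lambda>x. norm (\<phi> x)) summable_on UNIV \<and>
     (\<exists>U F. open U \<and> complex_vec ` torus \<subseteq> U \<and> holomorphic_vec F U \<and>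
        (\<forall>\<xi>. complex_vec \<xi> \<in> U \<longrightarrow> F (complex_vec \<xi>) = fourier \<phi> \<xi>))}"

definition H_class_normalized :: "(int ^ 'd \<Rightarrow> complex) set" where
  "H_class_normalized = {\<phi> \<in> H_class. (SUP \<xi>\<in>torus. cmod (fourier \<phi> \<xi>)) = 1}"

definition Omega :: "(int ^ 'd \<Rightarrow> complex) \<Rightarrow> (real ^ 'd) set" where
  "Omega \<phi> = {\<xi> \<in> torus. cmod (fourier \<phi> \<xi>) = 1}"

section \<open>Positive-homogeneous polynomials\<close>

text \<open>The instances \<open>*\<close> and \<open>^\<close> on \<open>real ^ 'd ^ 'd\<close> act entrywise, so powers are formed with
  the matrix product \<open>**\<close>.\<close>

definition matrix_exp :: "real ^ 'd ^ 'd \<Rightarrow> real ^ 'd ^ 'd" where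
  "matrix_exp A = (\<Sum>k. (1 / fact k) *\<^sub>R (((**) A ^^ k) (mat 1)))"

definition matrix_dilation :: "real \<Rightarrow> real ^ 'd ^ 'd \<Rightarrow> real ^ 'd ^ 'd" where
  "matrix_dilation t E = matrix_exp (ln t *\<^sub>R E)"

definition Exp_set :: "(real ^ 'd \<Rightarrow> complex) \<Rightarrow> (real ^ 'd ^ 'd) set" where
  "Exp_set P =
     {E. \<forall>t>0. \<forall>\<xi>. complex_of_real t * P \<xi> = P (matrix_dilation t E *v \<xi>)}"

text \<open>\<open>polynomial_function\<close> at type \<open>real ^ 'd \<Rightarrow> complex\<close> means that the real and imaginary parts
  are real polynomials in the coordinates, i.e. that \<open>P\<close> is a polynomial in \<open>d\<close> variables with
  complex coefficients.\<close>

definition pos_hom_polynomial :: "(real ^ 'd \<Rightarrow> complex) \<Rightarrow> bool" where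
  "pos_hom_polynomial P \<longleftrightarrow>
     polynomial_function P \<and> Exp_set P \<noteq> {} \<and>
     (\<forall>\<xi>. 0 \<le> Re (P \<xi>)) \<and> (\<forall>\<xi>. Re (P \<xi>) = 0 \<longrightarrow> \<xi> = 0)"

text \<open>For a positive-homogeneous polynomial the trace does not depend on the chosen exponent.\<close>

definition hom_order :: "(real ^ 'd \<Rightarrow> complex) \<Rightarrow> real" where
  "hom_order P = trace (SOME E. E \<in> Exp_set P)"

text \<open>A real supremum, hence meaningful only where it is finite; this is everywhere if \<open>R\<close> is the
  real part of a positive-homogeneous polynomial, since such \<open>R\<close> grows superlinearly.\<close>

definition legendre_fenchel :: "(real ^ 'd \<Rightarrow> real) \<Rightarrow> real ^ 'd \<Rightarrow> real" where
  "legendre_fenchel R x = (SUP \<xi>. x \<bullet> \<xi> - R \<xi>)"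

section \<open>Points of positive-homogeneous type\<close>

definition Gamma_log :: "(real ^ 'd \<Rightarrow> complex) \<Rightarrow> real ^ 'd \<Rightarrow> real ^ 'd \<Rightarrow> complex" where
  "Gamma_log f \<xi>\<^sub>0 \<xi> = Ln (f (\<xi> + \<xi>\<^sub>0) / f \<xi>\<^sub>0)"

text \<open>\<open>\<xi>\<^sub>0\<close> is of positive-homogeneous type for \<open>f\<close>, with drift \<open>\<alpha>\<close> and polynomial \<open>P\<close>.\<close>

definition pos_hom_type_with ::
  "(real ^ 'd \<Rightarrow> complex) \<Rightarrow> real ^ 'd \<Rightarrow> real ^ 'd \<Rightarrow> (real ^ 'd \<Rightarrow> complex) \<Rightarrow> bool" where
  "pos_hom_type_with f \<xi>\<^sub>0 \<alpha> P \<longleftrightarrow>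
     pos_hom_polynomial P \<and>
     (\<exists>\<Upsilon>. (\<forall>\<^sub>F \<xi> in nhds 0.
             Gamma_log f \<xi>\<^sub>0 \<xi> = \<i> * complex_of_real (\<alpha> \<bullet> \<xi>) - P \<xi> + \<Upsilon> \<xi>) \<and>
          \<Upsilon> \<in> o[at 0](\<lambda>\<xi>. complex_of_real (Re (P \<xi>))))"

end

theory Submission
  imports Defs "HOL-Real_Asymp.Real_Asymp"
begin

text \<open>
  Let \<open>F \<xi> \<nu> = (\<Sum>x. \<phi> x * exp (x \<bullet> \<nu> + \<i> * (x \<bullet> \<xi>)))\<close>, the Fourier transform of \<open>\<phi>\<close> at the complex
  frequency \<open>\<xi> - \<i>\<nu>\<close>. The power \<open>F ^ n\<close> is the same extension for the \<open>n\<close>-th convolution power, so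
  Fourier inversion of the tilted function \<open>exp (x \<bullet> \<nu>) * \<phi>\<^sup>(\<^sup>n\<^sup>) x\<close> shows that, up to the factor
  \<open>(2 * pi) ^ d\<close>, \<open>|\<phi>\<^sup>(\<^sup>n\<^sup>) x|\<close> is at most \<open>exp (- x \<bullet> \<nu>)\<close> times the integral of \<open>|F \<xi> \<nu>| ^ n\<close> over a
  period, for every real vector \<open>\<nu>\<close>
  (\<open>torus_coefficient_bound\<close>). This is the effect of a shift of the contour of integration.

  Near a maximum point \<open>\<omega>\<close> the key estimate is
  \<open>|F (\<omega> + \<xi>) \<nu>| \<le> exp (\<alpha> \<bullet> \<nu> - \<epsilon> * R \<xi> + M * R \<nu>)\<close> (\<open>exp_poly_pos_hom_type_shift_bound\<close>). The
  hypothesis on \<open>\<omega>\<close> concerns real frequencies only. It is carried over to complex ones by Lagrange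
  interpolation along the real line \<open>j \<mapsto> \<xi> + j\<nu>\<close>, whose error \<open>O(|\<nu>| ^ (N + 1))\<close> is negligible because
  \<open>R\<close> dominates a power of the norm; the leading terms are homogeneous under the dilations of \<open>P\<close>, and
  for them the estimate is a matter of compactness (\<open>complex_shift_bound\<close>). Integrating
  \<open>exp (- n * \<epsilon> * R \<xi>)\<close> gives the factor \<open>n powr - \<mu>\<close>, because the dilation by \<open>n\<close> scales volumes by
  \<open>det (n\<^sup>E) = n powr trace E\<close> (\<open>integral_exp_neg_R\<close>, \<open>measure_matrix_dilation_image\<close>). The exponents
  that remain are \<open>- n * (y \<bullet> \<nu> - M * R \<nu>)\<close> with \<open>y = (x - n \<alpha>) / n\<close>, and taking for \<open>\<nu>\<close> a small multiple
  of a maximizer of \<open>y \<bullet> \<xi> - R \<xi>\<close> turns them into a multiple of the Legendre-Fenchel transform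
  (\<open>legendre_shift\<close>).

  Several maximum points with different drifts call for different shifts \<open>\<nu>\<close>. Therefore \<open>F ^ n\<close> is first
  multiplied by cutoffs, one for each maximum point, that are exponentially close to 1 near their own
  point and exponentially small near the others. They are binomial tails of trigonometric polynomials
  (\<open>upper_binomial_tail\<close>, \<open>localizing_trig_poly\<close>), so each product is again a trigonometric polynomial
  and admits its own shift. All errors are of size \<open>exp (- \<delta> * n)\<close>. The convolution power vanishes unless
  \<open>|x| \<le> n * B\<close>, by finite support, and in this range the Legendre-Fenchel transforms are bounded; hence
  the errors are absorbed into the main terms once the constants \<open>M\<close> are small enough.
\<close>

section \<open>Determinants of matrix exponentials\<close>

lemma matrix_power_entry_bound:
  fixes A :: "real ^ 'd ^ 'd"
  shows "\<bar>(((**) A ^^ k) (mat 1)) $ i $ j\<bar> \<le> (\<Sum>i\<in>UNIV. \<Sum>l\<in>UNIV. \<bar>A $ i $ l\<bar>) ^ k"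
proof (induction k arbitrary: i j)
  case 0
  show ?case by (simp add: mat_def)
next
  case (Suc k)
  define a where "a = (\<Sum>i\<in>UNIV. \<Sum>l\<in>UNIV. \<bar>A $ i $ l\<bar>)"
  have row: "(\<Sum>l\<in>UNIV. \<bar>A $ i $ l\<bar>) \<le> a"
    unfolding a_def
    by (rule member_le_sum[where f="\<lambda>i. \<Sum>l\<in>UNIV. \<bar>A $ i $ l\<bar>"]) (auto intro: sum_nonneg)
  have "\<bar>(((**) A ^^ Suc k) (mat 1)) $ i $ j\<bar>
      = \<bar>\<Sum>l\<in>UNIV. A $ i $ l * (((**) A ^^ k) (mat 1)) $ l $ j\<bar>"
    by (simp add: matrix_matrix_mult_def)
  also have "\<dots> \<le> (\<Sum>l\<in>UNIV. \<bar>A $ i $ l\<bar> * a ^ k)"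
    unfolding abs_mult a_def
    by (rule order_trans[OF sum_abs]) (auto intro!: sum_mono mult_left_mono Suc simp: abs_mult)
  also have "\<dots> = (\<Sum>l\<in>UNIV. \<bar>A $ i $ l\<bar>) * a ^ k" by (simp add: sum_distrib_right)
  also have "\<dots> \<le> a * a ^ k"
    by (rule mult_right_mono[OF row]) (auto simp: a_def intro!: zero_le_power sum_nonneg)
  finally show ?case by (simp add: a_def)
qed

lemma matrix_power_scaleR:
  fixes A :: "real ^ 'd ^ 'd"
  shows "((**) (s *\<^sub>R A) ^^ k) (mat 1) = s ^ k *\<^sub>R ((**) A ^^ k) (mat 1)"
  by (induction k) (simp_all add: scalar_matrix_assoc[symmetric] matrix_scalar_ac
      scaleR_scaleR)

lemma summable_matrix_exp_entry:
  fixes A :: "real ^ 'd ^ 'd"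
  shows "summable (\<lambda>k. (((**) A ^^ k) (mat 1)) $ i $ j / fact k * s ^ k)"
proof (rule summable_comparison_test')
  define a where "a = (\<Sum>i\<in>UNIV. \<Sum>l\<in>UNIV. \<bar>A $ i $ l\<bar>)"
  show "summable (\<lambda>k. (a * \<bar>s\<bar>) ^ k / fact k)"
    using summable_exp[of "a * \<bar>s\<bar>"] by (simp add: divide_inverse mult.commute)
  show "norm ((((**) A ^^ k) (mat 1)) $ i $ j / fact k * s ^ k) \<le> (a * \<bar>s\<bar>) ^ k / fact k" for k
    using matrix_power_entry_bound[of k A i j]
    by (auto simp: abs_mult power_mult_distrib power_abs a_def intro!: divide_right_mono mult_right_mono)
qed

lemma matrix_exp_entry:
  fixes A :: "real ^ 'd ^ 'd"
  shows "matrix_exp (s *\<^sub>R A) $ i $ j = (\<Sum>k. (((**) A ^^ k) (mat 1)) $ i $ j / fact k * s ^ k)"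
proof -
  define X :: "real ^ 'd ^ 'd"
    where "X = (\<chi> i j. \<Sum>k. (((**) A ^^ k) (mat 1)) $ i $ j / fact k * s ^ k)"
  have "(\<lambda>k. (1 / fact k) *\<^sub>R (((**) (s *\<^sub>R A) ^^ k) (mat 1))) sums X"
    unfolding sums_def
  proof (rule vec_tendstoI, rule vec_tendstoI)
    fix i j
    have "(\<lambda>n. \<Sum>k<n. (((**) A ^^ k) (mat 1)) $ i $ j / fact k * s ^ k) \<longlonglongrightarrow> X $ i $ j"
      using summable_LIMSEQ[OF summable_matrix_exp_entry[of A i j s]] by (simp add: X_def)
    then show "(\<lambda>n. (\<Sum>k<n. (1 / fact k) *\<^sub>R (((**) (s *\<^sub>R A) ^^ k) (mat 1))) $ i $ j)
        \<longlonglongrightarrow> X $ i $ j"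
      by (simp add: matrix_power_scaleR mult.commute)
  qed
  then show ?thesis unfolding matrix_exp_def by (simp add: sums_iff X_def)
qed

lemma matrix_exp_entry_has_derivative:
  fixes A :: "real ^ 'd ^ 'd"
  shows "((\<lambda>s. matrix_exp (s *\<^sub>R A) $ i $ j) has_field_derivative
     (\<Sum>l\<in>UNIV. A $ i $ l * matrix_exp (s *\<^sub>R A) $ l $ j)) (at s)"
proof -
  let ?p = "\<lambda>i j k. (((**) A ^^ k) (mat 1)) $ i $ j / fact k"
  have d: "diffs (?p i j) k = (\<Sum>l\<in>UNIV. A $ i $ l * ?p l j k)" for k
    by (simp add: diffs_def matrix_matrix_mult_def sum_divide_distrib field_simps sum_distrib_left
        del: of_nat_Suc)
  have "((\<lambda>s. \<Sum>k. ?p i j k * s ^ k) has_field_derivative (\<Sum>k. diffs (?p i j) k * s ^ k)) (at s)"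
    by (rule termdiffs_strong_converges_everywhere) (rule summable_matrix_exp_entry)
  moreover have "(\<Sum>k. diffs (?p i j) k * s ^ k) = (\<Sum>l\<in>UNIV. A $ i $ l * (\<Sum>k. ?p l j k * s ^ k))"
  proof -
    have "(\<Sum>k. diffs (?p i j) k * s ^ k) = (\<Sum>k. \<Sum>l\<in>UNIV. A $ i $ l * (?p l j k * s ^ k))"
      by (simp add: d sum_distrib_right mult.assoc)
    also have "\<dots> = (\<Sum>l\<in>UNIV. \<Sum>k. A $ i $ l * (?p l j k * s ^ k))"
      by (rule suminf_sum) (intro summable_mult summable_matrix_exp_entry)
    also have "\<dots> = (\<Sum>l\<in>UNIV. A $ i $ l * (\<Sum>k. ?p l j k * s ^ k))"
      by (intro sum.cong refl suminf_mult summable_matrix_exp_entry)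
    finally show ?thesis .
  qed
  ultimately show ?thesis by (simp add: matrix_exp_entry)
qed

text \<open>
  The derivative of \<open>exp (s A)\<close> is \<open>A exp (s A)\<close>, and the determinant is linear in each row, so its
  derivative is the sum over \<open>i\<close> of the determinants of \<open>exp (s A)\<close> with row \<open>i\<close> replaced by the
  corresponding row of \<open>A exp (s A)\<close>. That row is a combination of the rows of \<open>exp (s A)\<close>, of which
  only the multiple \<open>A\<^sub>i\<^sub>i\<close> of row \<open>i\<close> itself contributes.
\<close>
lemma det_matrix_exp_has_derivative:
  fixes A :: "real ^ 'd ^ 'd"
  shows "((\<lambda>s. det (matrix_exp (s *\<^sub>R A))) has_field_derivative
     trace A * det (matrix_exp (s *\<^sub>R A))) (at s)"
proof -
  define M where "M = matrix_exp (s *\<^sub>R A)"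
  define D where "D i j = (\<Sum>l\<in>UNIV. A $ i $ l * M $ l $ j)" for i j
  let ?perms = "{p. p permutes (UNIV :: 'd set)}"
  have "((\<lambda>s. det (matrix_exp (s *\<^sub>R A))) has_field_derivative
     (\<Sum>p\<in>?perms. of_int (sign p) * (\<Sum>i\<in>UNIV. D i (p i) * (\<Prod>j\<in>UNIV - {i}. M $ j $ p j)))) (at s)"
    unfolding det_def
    by (intro DERIV_sum DERIV_cmult, unfold D_def M_def,
        intro has_field_derivative_prod matrix_exp_entry_has_derivative)
  moreover have "(\<Sum>p\<in>?perms. of_int (sign p) * (\<Sum>i\<in>UNIV. D i (p i) * (\<Prod>j\<in>UNIV - {i}. M $ j $ p j)))
    = trace A * det M"
  proof -
    have "(\<Sum>p\<in>?perms. of_int (sign p) * (\<Sum>i\<in>UNIV. D i (p i) * (\<Prod>j\<in>UNIV - {i}. M $ j $ p j)))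
       = (\<Sum>i\<in>UNIV. \<Sum>p\<in>?perms. of_int (sign p) * (D i (p i) * (\<Prod>j\<in>UNIV - {i}. M $ j $ p j)))"
      unfolding sum_distrib_left by (rule sum.swap)
    also have "\<dots> = (\<Sum>i\<in>UNIV. det (\<chi> k. if k = i then \<Sum>l\<in>UNIV. A $ i $ l *s row l M else row k M))"
    proof (rule sum.cong[OF refl])
      fix i
      have "(\<Prod>k\<in>UNIV. (\<chi> k. if k = i then \<Sum>l\<in>UNIV. A $ i $ l *s row l M else row k M) $ k $ p k)
          = D i (p i) * (\<Prod>j\<in>UNIV - {i}. M $ j $ p j)" for p
        by (subst prod.remove[of _ i]) (auto simp: D_def row_def intro!: prod.cong)
      then show "(\<Sum>p\<in>?perms. of_int (sign p) * (D i (p i) * (\<Prod>j\<in>UNIV - {i}. M $ j $ p j)))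
        = det (\<chi> k. if k = i then \<Sum>l\<in>UNIV. A $ i $ l *s row l M else row k M)"
        by (simp add: det_def)
    qed
    also have "\<dots> = (\<Sum>i\<in>UNIV. A $ i $ i * det M)"
    proof (rule sum.cong[OF refl])
      fix i
      have "det (\<chi> k. if k = i then \<Sum>l\<in>UNIV. A $ i $ l *s row l M else row k M)
          = (\<Sum>l\<in>UNIV. A $ i $ l * det (\<chi> k. if k = i then row l M else row k M))"
        by (subst det_linear_row_sum[where a="\<lambda>k l. A $ i $ l *s row l M"])
           (simp_all add: det_row_mul)
      also have "\<dots> = (\<Sum>l\<in>UNIV. if l = i then A $ i $ i * det M else 0)"
      proof (rule sum.cong[OF refl])
        fix l
        show "A $ i $ l * det (\<chi> k. if k = i then row l M else row k M)
          = (if l = i then A $ i $ i * det M else 0)"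
        proof (cases "l = i")
          case True
          then have "(\<chi> k. if k = i then row l M else row k M) = M"
            by (auto simp: vec_eq_iff row_def)
          then show ?thesis using True by simp
        next
          case False
          then have "det (\<chi> k. if k = i then row l M else row k M) = 0"
            by (intro det_identical_rows[of l i]) (auto simp: row_def vec_eq_iff)
          then show ?thesis using False by simp
        qed
      qed
      finally show "det (\<chi> k. if k = i then \<Sum>l\<in>UNIV. A $ i $ l *s row l M else row k M)
          = A $ i $ i * det M" by simp
    qed
    finally show ?thesis by (simp add: trace_def sum_distrib_right)
  qed
  ultimately show ?thesis by (simp add: M_def)
qed

lemma matrix_exp_0: "matrix_exp (0 :: real ^ 'd ^ 'd) = mat 1"
proof -
  have "(\<Sum>k. (((**) (0 :: real ^ 'd ^ 'd) ^^ k) (mat 1)) $ i $ j / fact k * 0 ^ k) = mat 1 $ i $ j" for i j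
    by (subst powser_zero) simp
  then show ?thesis
    using matrix_exp_entry[of 0 "0 :: real ^ 'd ^ 'd"] by (simp add: vec_eq_iff)
qed

lemma det_matrix_exp:
  fixes A :: "real ^ 'd ^ 'd"
  shows "det (matrix_exp (s *\<^sub>R A)) = exp (s * trace A)"
proof -
  \<comment> \<open>Uniqueness for the equation \<open>f' = trace A * f\<close>: the quotient by its exponential solution is constant.\<close>
  have "((\<lambda>s. det (matrix_exp (s *\<^sub>R A)) * exp (- s * trace A)) has_field_derivative 0) (at s)" for s
    by (auto intro!: derivative_eq_intros det_matrix_exp_has_derivative simp: algebra_simps)
  then have "(\<lambda>s. det (matrix_exp (s *\<^sub>R A)) * exp (- s * trace A)) s
    = (\<lambda>s. det (matrix_exp (s *\<^sub>R A)) * exp (- s * trace A)) 0"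
    by (intro DERIV_isconst_all) auto
  then show ?thesis by (simp add: matrix_exp_0 exp_minus field_simps)
qed

lemma det_matrix_dilation:
  fixes E :: "real ^ 'd ^ 'd"
  shows "t > 0 \<Longrightarrow> det (matrix_dilation t E) = t powr trace E"
  by (simp add: matrix_dilation_def det_matrix_exp powr_def mult.commute)


section \<open>Volumes of dilated sets\<close>

text \<open>
  The formula \<open>measure (f ` S) = |det f| * measure S\<close> for a linear map \<open>f\<close> goes through elementary row
  operations, which process the coordinates in a fixed order. An arbitrary finite index type has no
  such order, so it is copied to a type ordered by an arbitrary injective ranking; all data
  (vectors, matrices, the exponent of a dilation, its trace, volumes) are carried over.
\<close>
typedef 'd ordered_index = "UNIV :: 'd set" by auto

instance ordered_index :: (finite) finite
proof
  have "(UNIV :: 'a ordered_index set) = range Abs_ordered_index"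
    by (metis Rep_ordered_index_inverse surj_def)
  then show "finite (UNIV :: 'a ordered_index set)" by (metis finite finite_imageI)
qed

instantiation ordered_index :: (finite) wellorder
begin

definition index_rank :: "'a ordered_index \<Rightarrow> nat" where
  "index_rank = (SOME f. inj f)"

definition "x \<le> y \<longleftrightarrow> index_rank x \<le> index_rank y" for x y :: "'a ordered_index"

definition "x < y \<longleftrightarrow> index_rank x < index_rank y" for x y :: "'a ordered_index"

instance
proof
  have "\<exists>f :: 'a ordered_index \<Rightarrow> nat. inj f"
    using finite_imp_inj_to_nat_seg[OF finite_class.finite_UNIV] by blast
  then have inj: "inj (index_rank :: 'a ordered_index \<Rightarrow> nat)"
    unfolding index_rank_def by (rule someI_ex)
  show "x = y" if "x \<le> y" "y \<le> x" for x y :: "'a ordered_index"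
    using that inj by (auto simp: less_eq_ordered_index_def dest: injD)
  show "P a" if "\<And>x. (\<And>y. y < x \<Longrightarrow> P y) \<Longrightarrow> P x" for P and a :: "'a ordered_index"
    by (induction a rule: measure_induct_rule[of index_rank])
       (use that in \<open>auto simp: less_ordered_index_def\<close>)
qed (auto simp: less_eq_ordered_index_def less_ordered_index_def)

end

definition reindex :: "real ^ 'd \<Rightarrow> real ^ 'd ordered_index" where
  "reindex v = (\<chi> i. v $ Rep_ordered_index i)"

definition reindex_matrix :: "real ^ 'd ^ 'd \<Rightarrow> real ^ 'd ordered_index ^ 'd ordered_index" where
  "reindex_matrix A = (\<chi> i j. A $ Rep_ordered_index i $ Rep_ordered_index j)"

lemma bij_Rep_ordered_index: "bij Rep_ordered_index"
  by (metis UNIV_I Abs_ordered_index_inverse Rep_ordered_index_inverse bijI')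

lemma sum_Rep_ordered_index:
  "(\<Sum>i\<in>UNIV. f (Rep_ordered_index i)) = (\<Sum>i\<in>UNIV. f i)"
  using sum.reindex_bij_betw[OF bij_Rep_ordered_index] by simp

lemma reindex_matrix_mult:
  "reindex_matrix A ** reindex_matrix B = reindex_matrix (A ** B)"
  by (simp add: reindex_matrix_def matrix_matrix_mult_def vec_eq_iff
      sum_Rep_ordered_index[where f="\<lambda>k. A $ Rep_ordered_index i $ k * B $ k $ Rep_ordered_index j" for i j])

lemma reindex_matrix_vector:
  "reindex_matrix A *v reindex v = reindex (A *v v)"
  by (simp add: reindex_matrix_def reindex_def matrix_vector_mult_def vec_eq_iff
      sum_Rep_ordered_index[where f="\<lambda>k. A $ Rep_ordered_index i $ k * v $ k" for i])

lemma reindex_matrix_exp: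
  fixes A :: "real ^ 'd ^ 'd"
  shows "matrix_exp (reindex_matrix A) = reindex_matrix (matrix_exp A)"
proof -
  have "reindex_matrix (mat 1 :: real ^ 'd ^ 'd) = mat 1"
    by (simp add: reindex_matrix_def mat_def vec_eq_iff Rep_ordered_index_inject)
  then have "((**) (reindex_matrix A) ^^ k) (mat 1) = reindex_matrix (((**) A ^^ k) (mat 1))" for k
    by (induction k) (simp_all add: reindex_matrix_mult)
  then show ?thesis
    using matrix_exp_entry[of 1 "reindex_matrix A"] matrix_exp_entry[of 1 A]
    by (simp add: vec_eq_iff) (simp add: reindex_matrix_def)
qed

lemma reindex_matrix_dilation:
  "matrix_dilation t (reindex_matrix E) = reindex_matrix (matrix_dilation t E)"
proof -
  have "ln t *\<^sub>R reindex_matrix E = reindex_matrix (ln t *\<^sub>R E)"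
    by (simp add: reindex_matrix_def vec_eq_iff)
  then show ?thesis by (simp add: matrix_dilation_def reindex_matrix_exp)
qed

lemma trace_reindex_matrix: "trace (reindex_matrix E) = trace E"
  by (simp add: trace_def reindex_matrix_def sum_Rep_ordered_index[where f="\<lambda>i. E $ i $ i"])

lemma linear_reindex: "linear reindex"
  by (rule linearI) (simp_all add: reindex_def vec_eq_iff)

lemma inj_reindex: "inj reindex"
proof (rule injI)
  fix v w :: "real ^ 'd" assume "reindex v = reindex w"
  then have "v $ Rep_ordered_index i = w $ Rep_ordered_index i" for i
    by (simp add: reindex_def vec_eq_iff)
  then show "v = w" using bij_Rep_ordered_index by (metis bij_pointE vec_eq_iff)
qed

lemma continuous_on_reindex: "continuous_on A reindex"
  using linear_reindex linear_continuous_on linear_linear by blast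

lemma prod_Basis_vec:
  "(\<Prod>b\<in>Basis. f b) = (\<Prod>i\<in>UNIV. f (axis i 1 :: real ^ 'd))"
proof -
  have B: "(Basis :: (real ^ 'd) set) = range (\<lambda>i. axis i 1)" by (auto simp: Basis_vec_def)
  show ?thesis unfolding B by (subst prod.reindex) (auto simp: inj_on_def axis_eq_axis)
qed

lemma lborel_distr_reindex:
  "distr lborel lborel (reindex :: real ^ 'd \<Rightarrow> _) = lborel"
proof (rule lborel_eqI[symmetric])
  fix l u :: "real ^ 'd ordered_index"
  assume lu: "\<And>b. b \<in> Basis \<Longrightarrow> l \<bullet> b \<le> u \<bullet> b"
  have lu': "l $ i \<le> u $ i" for i using lu[of "axis i 1"] by (simp add: inner_axis axis_in_Basis_iff)
  define l' :: "real ^ 'd" where "l' = (\<chi> j. l $ Abs_ordered_index j)"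
  define u' :: "real ^ 'd" where "u' = (\<chi> j. u $ Abs_ordered_index j)"
  have "reindex -` box l u = box l' u'"
    unfolding l'_def u'_def mem_box_cart set_eq_iff vimage_def
    by (auto simp: mem_box_cart reindex_def)
       (metis Rep_ordered_index_inverse Abs_ordered_index_inverse UNIV_I)+
  moreover have m: "reindex \<in> measurable lborel lborel"
    using borel_measurable_continuous_onI[OF continuous_on_reindex[of UNIV]] by simp
  ultimately have "emeasure (distr lborel lborel (reindex :: real ^ 'd \<Rightarrow> _)) (box l u) = emeasure lborel (box l' u')"
    by (subst emeasure_distr[OF m]) auto
  also have "\<dots> = (\<Prod>b\<in>Basis. (u' - l') \<bullet> b)"
    by (rule emeasure_lborel_box) (auto simp: Basis_vec_def inner_axis l'_def u'_def lu')
  also have "(\<Prod>b\<in>Basis. (u' - l') \<bullet> b) = (\<Prod>j\<in>UNIV. u' $ j - l' $ j)"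
    by (simp add: prod_Basis_vec inner_axis)
  also have "\<dots> = (\<Prod>i\<in>UNIV. u' $ Rep_ordered_index i - l' $ Rep_ordered_index i)"
    using prod.reindex_bij_betw[OF bij_Rep_ordered_index, of "\<lambda>j. u' $ j - l' $ j"] by simp
  also have "\<dots> = (\<Prod>b\<in>Basis. (u - l) \<bullet> b)"
    by (simp add: prod_Basis_vec inner_axis u'_def l'_def Rep_ordered_index_inverse)
  finally show "emeasure (distr lborel lborel (reindex :: real ^ 'd \<Rightarrow> _)) (box l u)
    = (\<Prod>b\<in>Basis. (u - l) \<bullet> b)" .
qed simp

lemma measure_reindex_image:
  assumes "compact S"
  shows "measure lborel (reindex ` S) = measure lborel S"
proof -
  have "compact (reindex ` S)"
    by (intro compact_continuous_image continuous_on_reindex assms)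
  then have "measure (distr lborel lborel reindex) (reindex ` S) = measure lborel (reindex -` (reindex ` S))"
    using borel_measurable_continuous_onI[OF continuous_on_reindex[of UNIV]]
    by (subst measure_distr) (auto intro: borel_compact)
  then show ?thesis by (simp add: lborel_distr_reindex inj_vimage_image_eq[OF inj_reindex])
qed

text \<open>
  This is where the homogeneous order enters: \<open>t\<^sup>E\<close> scales volumes by \<open>det (t\<^sup>E) = t powr trace E\<close>.
\<close>
lemma measure_matrix_dilation_image:
  fixes E :: "real ^ 'd ^ 'd"
  assumes "t > 0" "compact S"
  shows "measure lborel ((*v) (matrix_dilation t E) ` S) = t powr trace E * measure lborel S"
proof -
  let ?T = "(*v) (matrix_dilation t E)" and ?T' = "(*v) (matrix_dilation t (reindex_matrix E))"
  have cont: "continuous_on A ((*v) M)" for A and M :: "real ^ 'n ^ 'n"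
    by (intro linear_continuous_on matrix_vector_mul_bounded_linear)
  have cS: "compact (reindex ` S)" "compact (?T ` S)"
    by (intro compact_continuous_image continuous_on_reindex cont assms)+
  have "measure lborel (?T ` S) = measure lborel (reindex ` ?T ` S)"
    using measure_reindex_image[OF cS(2)] by simp
  also have "reindex ` ?T ` S = ?T' ` reindex ` S"
    by (simp add: image_image reindex_matrix_dilation reindex_matrix_vector)
  also have "measure lborel (?T' ` reindex ` S) = measure lebesgue (?T' ` reindex ` S)"
    using compact_continuous_image[OF cont cS(1)]
    by (intro measure_completion[symmetric]) (auto intro: borel_compact)
  also have "\<dots> = \<bar>det (matrix ?T')\<bar> * measure lebesgue (reindex ` S)"
    by (rule measure_linear_image) (auto simp: lmeasurable_compact cS)
  also have "measure lebesgue (reindex ` S) = measure lborel S"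
    using measure_completion[of "reindex ` S" lborel] cS(1) measure_reindex_image[OF assms(2)]
    by (auto dest: borel_compact)
  finally show ?thesis using assms(1)
    by (simp add: det_matrix_dilation trace_reindex_matrix)
qed

section \<open>Continuous functions homogeneous under linear dilations\<close>

text \<open>
  The dilations \<open>t\<^sup>E\<close> of a positive-homogeneous polynomial are abstracted to a family of linear maps
  \<open>T t\<close> that multiply \<open>P\<close> by \<open>t\<close>. Continuity, positivity and this scaling already make everything that
  is homogeneous of degree one comparable with \<open>R = Re P\<close>, by compactness of a level set of \<open>R\<close>.
\<close>
locale homogeneous_symbol =
  fixes P :: "'a::euclidean_space \<Rightarrow> complex" and T :: "real \<Rightarrow> 'a \<Rightarrow> 'a"
  assumes cont: "continuous_on UNIV P"
    and lin: "t > 0 \<Longrightarrow> linear (T t)"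
    and hom: "t > 0 \<Longrightarrow> P (T t \<xi>) = of_real t * P \<xi>"
    and nonneg: "0 \<le> Re (P \<xi>)"
    and definite: "Re (P \<xi>) = 0 \<Longrightarrow> \<xi> = 0"
begin

abbreviation R :: "'a \<Rightarrow> real" where "R \<xi> \<equiv> Re (P \<xi>)"

lemma R_continuous: "continuous_on A R"
  by (intro continuous_intros continuous_on_subset[OF cont]) auto

lemma R_hom: "t > 0 \<Longrightarrow> R (T t \<xi>) = t * R \<xi>"
  by (simp add: hom)

lemma T_zero [simp]: "t > 0 \<Longrightarrow> T t 0 = 0"
  using lin linear_0 by blast

lemma P_zero [simp]: "P 0 = 0"
  using hom[of 2 0] by simp

lemma R_pos: "\<xi> \<noteq> 0 \<Longrightarrow> R \<xi> > 0"
  using nonneg[of \<xi>] definite[of \<xi>] by force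

lemma T_inj: "t > 0 \<Longrightarrow> inj (T t)"
proof (subst linear_injective_0[OF lin], assumption, intro allI impI)
  fix \<xi> assume "t > 0" "T t \<xi> = 0"
  then have "t * R \<xi> = 0" using R_hom[of t \<xi>] by simp
  then show "\<xi> = 0" using \<open>t > 0\<close> definite by simp
qed

lemma T_surj: "t > 0 \<Longrightarrow> surj (T t)"
  using linear_injective_imp_surjective[OF lin T_inj] by simp

lemma T_continuous: "t > 0 \<Longrightarrow> continuous_on A (T t)"
  using lin linear_continuous_on linear_linear by blast

text \<open>
  On the unit sphere \<open>R (T t \<xi>) = t * R \<xi>\<close> tends uniformly to infinity with \<open>t\<close>, whereas \<open>R\<close> is
  bounded on the ball of radius 2; hence \<open>T t\<close> carries the sphere out of that ball for large \<open>t\<close>, and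
  linearity does the rest.
\<close>
lemma expanding_dilation: "\<exists>t\<ge>1. \<forall>\<xi>. norm (T t \<xi>) \<ge> 2 * norm \<xi>"
proof -
  have "\<exists>\<xi>\<in>sphere (0::'a) 1. \<forall>\<eta>\<in>sphere 0 1. R \<xi> \<le> R \<eta>"
    using R_continuous by (intro continuous_attains_inf) auto
  then obtain \<xi>\<^sub>0 where x0: "norm \<xi>\<^sub>0 = 1" "\<And>\<eta>. norm \<eta> = 1 \<Longrightarrow> R \<xi>\<^sub>0 \<le> R \<eta>" by auto
  have "\<exists>\<xi>\<in>cball (0::'a) 2. \<forall>\<eta>\<in>cball 0 2. R \<eta> \<le> R \<xi>"
    using R_continuous by (intro continuous_attains_sup) auto
  then obtain \<xi>\<^sub>1 where x1: "\<And>\<eta>. norm \<eta> \<le> 2 \<Longrightarrow> R \<eta> \<le> R \<xi>\<^sub>1" by (metis dist_0_norm mem_cball)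
  define m where "m = R \<xi>\<^sub>0"
  have m: "m > 0" using x0(1) R_pos[of \<xi>\<^sub>0] by (force simp: m_def)
  define t where "t = 1 + R \<xi>\<^sub>1 / m"
  have t: "t \<ge> 1" using m nonneg[of \<xi>\<^sub>1] by (simp add: t_def)
  have tm: "t * m > R \<xi>\<^sub>1" using m by (simp add: t_def field_simps)
  have "norm (T t \<xi>) \<ge> 2 * norm \<xi>" for \<xi>
  proof (cases "\<xi> = 0")
    case False
    define \<zeta> where "\<zeta> = \<xi> /\<^sub>R norm \<xi>"
    have z: "norm \<zeta> = 1" "\<xi> = norm \<xi> *\<^sub>R \<zeta>" using False by (auto simp: \<zeta>_def)
    have "R (T t \<zeta>) > R \<xi>\<^sub>1"
    proof -
      have "t * m \<le> t * R \<zeta>" using x0(2)[OF z(1)] t by (intro mult_left_mono) (auto simp: m_def)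
      moreover have "R (T t \<zeta>) = t * R \<zeta>" using t by (intro R_hom) simp
      ultimately show ?thesis using tm by linarith
    qed
    then have *: "norm (T t \<zeta>) > 2" using x1[of "T t \<zeta>"] by linarith
    have "T t \<xi> = norm \<xi> *\<^sub>R T t \<zeta>"
      by (subst z(2), rule linear_scale[OF lin]) (use t in simp)
    then have "norm (T t \<xi>) = norm \<xi> * norm (T t \<zeta>)" by simp
    also have "\<dots> \<ge> norm \<xi> * 2" using * by (intro mult_left_mono) auto
    finally show ?thesis by simp
  qed (use t in simp)
  then show ?thesis using t by blast
qed

lemma expanding_annulus:
  assumes "t > 0"
  shows "\<exists>m>0. \<forall>\<zeta>. norm \<zeta> \<le> 1 \<longrightarrow> norm (T t \<zeta>) \<ge> 1 \<longrightarrow> R \<zeta> \<ge> m"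
proof -
  define A where "A = cball 0 1 \<inter> {\<zeta>. norm (T t \<zeta>) \<ge> 1}"
  have "compact A"
    unfolding A_def
    by (intro compact_Int_closed compact_cball closed_Collect_le continuous_intros T_continuous assms)
  show ?thesis
  proof (cases "A = {}")
    case True
    then show ?thesis by (intro exI[of _ 1]) (auto simp: A_def)
  next
    case False
    then obtain \<xi> where "\<xi> \<in> A" "\<And>\<eta>. \<eta> \<in> A \<Longrightarrow> R \<xi> \<le> R \<eta>"
      using continuous_attains_inf[OF \<open>compact A\<close> False R_continuous] by blast
    moreover have "\<xi> \<noteq> 0" using \<open>\<xi> \<in> A\<close> assms by (auto simp: A_def)
    ultimately show ?thesis using R_pos by (intro exI[of _ "R \<xi>"]) (auto simp: A_def)
  qed
qed

text \<open>
  A point outside the unit ball is pulled back by an expanding dilation until it first enters the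
  ball; there it lies in the compact shell of the previous lemma, and \<open>R\<close> has only become smaller on
  the way.
\<close>
lemma R_bounded_below_outside_ball: "\<exists>m>0. \<forall>\<eta>. norm \<eta> \<ge> 1 \<longrightarrow> R \<eta> \<ge> m"
proof -
  obtain t where t: "t \<ge> 1" "\<And>\<xi>. norm (T t \<xi>) \<ge> 2 * norm \<xi>" using expanding_dilation by blast
  obtain m where m: "m > 0" "\<And>\<zeta>. norm \<zeta> \<le> 1 \<Longrightarrow> norm (T t \<zeta>) \<ge> 1 \<Longrightarrow> R \<zeta> \<ge> m"
    using expanding_annulus[of t] t(1) by auto
  have "norm \<eta> \<ge> 1 \<Longrightarrow> norm \<eta> \<le> 2 ^ k \<Longrightarrow> R \<eta> \<ge> m" for \<eta> k
  proof (induction k arbitrary: \<eta>)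
    case 0
    then have "norm \<eta> = 1" by simp
    then show ?case using m(2)[of \<eta>] t(2)[of \<eta>] by simp
  next
    case (Suc k)
    have "\<eta> \<in> range (T t)" using T_surj[of t] t(1) by auto
    then obtain \<zeta> where z: "\<eta> = T t \<zeta>" by blast
    have "R \<zeta> \<ge> m"
    proof (cases "norm \<zeta> \<ge> 1")
      case True
      then show ?thesis using Suc.IH[of \<zeta>] Suc.prems t(2)[of \<zeta>] z by simp
    next
      case False
      then show ?thesis using m(2)[of \<zeta>] Suc.prems z by simp
    qed
    then have "t * R \<zeta> \<ge> 1 * m" using t(1) m(1) by (intro mult_mono) auto
    then show ?case using R_hom[of t \<zeta>] z t(1) by simp
  qed
  moreover have "\<exists>k. norm \<eta> \<le> 2 ^ k" for \<eta> :: 'a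
    using real_arch_pow[of 2 "norm \<eta>"] by (auto intro: less_imp_le)
  ultimately show ?thesis using m(1) by blast
qed

text \<open>
  Near 0 the symbol dominates a power of the norm: each application of an expanding dilation
  multiplies \<open>R\<close> by \<open>t\<close> and the norm by at least 2, so any \<open>N\<close> with \<open>2\<^sup>N \<ge> t\<close> serves. The exponent makes
  Taylor remainders of high order negligible against \<open>R\<close>.
\<close>
lemma norm_power_le_R: "\<exists>N C. C > 0 \<and> (\<forall>\<nu>. norm \<nu> \<le> 1 \<longrightarrow> norm \<nu> ^ N \<le> C * R \<nu>)"
proof -
  obtain t where t: "t \<ge> 1" "\<And>\<xi>. norm (T t \<xi>) \<ge> 2 * norm \<xi>" using expanding_dilation by blast
  obtain m where m: "m > 0" "\<And>\<zeta>. norm \<zeta> \<le> 1 \<Longrightarrow> norm (T t \<zeta>) \<ge> 1 \<Longrightarrow> R \<zeta> \<ge> m"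
    using expanding_annulus[of t] t(1) by auto
  obtain N where N: "t < 2 ^ N" using real_arch_pow[of 2 t] by auto
  have "norm \<nu> \<le> 1 \<Longrightarrow> norm \<nu> \<ge> (1/2) ^ k \<Longrightarrow> norm \<nu> ^ N \<le> 1 / m * R \<nu>" for \<nu> k
  proof (induction k arbitrary: \<nu>)
    case 0
    then have "norm \<nu> = 1" by simp
    then show ?case using m(2)[of \<nu>] t(2)[of \<nu>] m(1) by (simp add: field_simps)
  next
    case (Suc k)
    show ?case
    proof (cases "norm (T t \<nu>) \<ge> 1")
      case True
      then have "R \<nu> \<ge> m" using m(2) Suc.prems by simp
      moreover have "norm \<nu> ^ N \<le> 1" using Suc.prems by (simp add: power_le_one)
      moreover have "1 \<le> 1 / m * R \<nu>" using m(1) \<open>R \<nu> \<ge> m\<close> by (simp add: field_simps)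
      ultimately show ?thesis by linarith
    next
      case False
      have "(2 * norm \<nu>) ^ N \<le> norm (T t \<nu>) ^ N" using t(2) by (intro power_mono) auto
      also have "\<dots> \<le> 1 / m * R (T t \<nu>)"
        using Suc.IH[of "T t \<nu>"] False Suc.prems t(2)[of \<nu>] by simp
      also have "\<dots> = t * (1 / m * R \<nu>)" using t(1) by (simp add: R_hom)
      also have "\<dots> \<le> 2 ^ N * (1 / m * R \<nu>)"
        using N m(1) nonneg[of \<nu>] by (intro mult_right_mono) auto
      finally have "2 ^ N * norm \<nu> ^ N \<le> 2 ^ N * (1 / m * R \<nu>)" by (simp add: power_mult_distrib)
      then show ?thesis by (simp only: mult_le_cancel_left_pos[of "2 ^ N :: real"] zero_less_power zero_less_numeral)
    qed
  qed
  note * = this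
  \<comment> \<open>The exponent is raised by one so that the zero vector is covered whatever \<open>N\<close> is.\<close>
  have "norm \<nu> ^ Suc N \<le> 1 / m * R \<nu>" if "norm \<nu> \<le> 1" for \<nu>
  proof (cases "\<nu> = 0")
    case False
    then obtain k where "(1/2) ^ k < norm \<nu>" using real_arch_pow_inv[of "norm \<nu>" "1/2"] by auto
    then have "norm \<nu> ^ N \<le> 1 / m * R \<nu>" using *[of \<nu> k] that by simp
    moreover have "norm \<nu> ^ Suc N \<le> norm \<nu> ^ N" using that by (simp add: mult_left_le_one_le)
    ultimately show ?thesis by linarith
  qed simp
  then show ?thesis using m(1) by (intro exI[of _ "Suc N"] exI[of _ "1/m"]) auto
qed

lemma sublevel_bounded: "bounded {\<xi>. R \<xi> \<le> s}"
proof -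
  obtain m where m: "m > 0" "\<And>\<eta>. norm \<eta> \<ge> 1 \<Longrightarrow> R \<eta> \<ge> m"
    using R_bounded_below_outside_ball by blast
  define t where "t = (\<bar>s\<bar> + m) / (m / 2)"
  have t: "t > 0" using m(1) by (simp add: t_def add_nonneg_pos)
  have "{\<xi>. R \<xi> \<le> s} \<subseteq> T t ` cball 0 1"
  proof
    fix \<xi> assume "\<xi> \<in> {\<xi>. R \<xi> \<le> s}"
    then have s: "R \<xi> \<le> s" by simp
    have "\<xi> \<in> range (T t)" using T_surj[OF t] by auto
    then obtain \<zeta> where z: "\<xi> = T t \<zeta>" by blast
    have "t * R \<zeta> \<le> s" using s R_hom[OF t, of \<zeta>] z by simp
    also have "s < 2 * (\<bar>s\<bar> + m)" using m(1) by (simp add: abs_if)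
    also have "\<dots> = t * m" using m(1) by (simp add: t_def)
    finally have "R \<zeta> < m" using t by simp
    then have "norm \<zeta> < 1" using m(2)[of \<zeta>] by force
    then show "\<xi> \<in> T t ` cball 0 1" using z by auto
  qed
  moreover have "bounded (T t ` cball 0 1)"
    by (intro compact_imp_bounded compact_continuous_image T_continuous t compact_cball)
  ultimately show ?thesis using bounded_subset by blast
qed

lemma sublevel_compact: "compact {\<xi>. R \<xi> \<le> s}"
  unfolding compact_eq_bounded_closed
  by (intro conjI sublevel_bounded closed_Collect_le R_continuous continuous_intros)

text \<open>
  The level set to which inequalities between homogeneous functions of the two vectors \<open>(\<xi>, \<nu>)\<close>
  (the real and the imaginary part of a frequency) are reduced by scaling.
\<close>
definition level :: "('a \<times> 'a) set" where "level = {z. R (fst z) + R (snd z) = 1}"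

lemma level_compact: "compact level"
proof -
  have c: "continuous_on UNIV (\<lambda>z :: 'a \<times> 'a. R (fst z) + R (snd z))"
    using continuous_on_compose2[OF R_continuous[of UNIV] continuous_on_fst[OF continuous_on_id]]
      continuous_on_compose2[OF R_continuous[of UNIV] continuous_on_snd[OF continuous_on_id]]
    by (intro continuous_on_add) auto
  have "closed level"
    unfolding level_def by (intro closed_Collect_eq c continuous_intros)
  moreover have "level \<subseteq> {\<xi>. R \<xi> \<le> 1} \<times> {\<xi>. R \<xi> \<le> 1}"
  proof
    fix z assume "z \<in> level"
    then show "z \<in> {\<xi>. R \<xi> \<le> 1} \<times> {\<xi>. R \<xi> \<le> 1}"
      using nonneg[of "fst z"] nonneg[of "snd z"] by (cases z) (auto simp: level_def)
  qed
  ultimately show ?thesis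
    using compact_Times[OF sublevel_compact sublevel_compact] compact_Int_closed
    by (metis inf.absorb_iff2)
qed

lemma scale_to_level:
  assumes "\<xi> \<noteq> 0 \<or> \<nu> \<noteq> 0"
  obtains t \<xi>' \<nu>' where "t > 0" "t = R \<xi> + R \<nu>" "\<xi> = T t \<xi>'" "\<nu> = T t \<nu>'" "(\<xi>', \<nu>') \<in> level"
proof -
  define t where "t = R \<xi> + R \<nu>"
  have t: "t > 0"
    using assms R_pos[of \<xi>] R_pos[of \<nu>] nonneg[of \<xi>] nonneg[of \<nu>] unfolding t_def by fastforce
  have "\<xi> \<in> range (T t)" "\<nu> \<in> range (T t)" using T_surj[OF t] by auto
  then obtain \<xi>' \<nu>' where z: "\<xi> = T t \<xi>'" "\<nu> = T t \<nu>'" by blast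
  have "R \<xi> = t * R \<xi>'" "R \<nu> = t * R \<nu>'"
    using R_hom[OF t, of \<xi>'] R_hom[OF t, of \<nu>'] unfolding z[symmetric] by blast+
  then have "t * (R \<xi>' + R \<nu>') = t * 1" using t_def unfolding distrib_left by linarith
  then have "R \<xi>' + R \<nu>' = 1" using t by (metis less_irrefl mult_left_cancel)
  then have "(\<xi>', \<nu>') \<in> level" unfolding level_def by simp
  then show ?thesis by (rule that[OF t t_def z])
qed

lemma homogeneous_le:
  assumes "continuous_on UNIV f"
    and "\<And>t \<xi> \<nu>. t > 0 \<Longrightarrow> f (T t \<xi>, T t \<nu>) = t * f (\<xi>, \<nu>)"
  shows "\<exists>C>0. \<forall>\<xi> \<nu>. \<bar>f (\<xi>, \<nu>)\<bar> \<le> C * (R \<xi> + R \<nu>)"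
proof -
  have "bounded (f ` level)"
    by (intro compact_imp_bounded compact_continuous_image level_compact
        continuous_on_subset[OF assms(1)]) auto
  then obtain C where C: "C > 0" "\<And>z. z \<in> level \<Longrightarrow> \<bar>f z\<bar> \<le> C"
    using bounded_pos by (metis imageI real_norm_def)
  have "\<bar>f (\<xi>, \<nu>)\<bar> \<le> C * (R \<xi> + R \<nu>)" for \<xi> \<nu>
  proof (cases "\<xi> \<noteq> 0 \<or> \<nu> \<noteq> 0")
    case True
    then obtain t \<xi>' \<nu>' where z: "t > 0" "t = R \<xi> + R \<nu>" "\<xi> = T t \<xi>'" "\<nu> = T t \<nu>'"
      "(\<xi>', \<nu>') \<in> level" by (rule scale_to_level)
    have "\<bar>f (\<xi>, \<nu>)\<bar> = t * \<bar>f (\<xi>', \<nu>')\<bar>" unfolding z(3,4) using assms(2) z(1) by (simp add: abs_mult)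
    also have "\<dots> \<le> t * C" using C(2)[OF z(5)] z(1) by simp
    finally show ?thesis using z(2) by (simp add: mult.commute)
  next
    case False
    then show ?thesis using assms(2)[of 2 0 0] by simp
  qed
  then show ?thesis using C(1) by blast
qed

text \<open>
  On the level set, the points where \<open>f\<close> is not positive form a compact set that avoids \<open>\<nu> = 0\<close>, so
  \<open>R \<nu>\<close> is bounded below on it and a large multiple of \<open>R \<nu>\<close> compensates there.
\<close>
lemma homogeneous_ge:
  assumes "continuous_on UNIV f"
    and "\<And>t \<xi> \<nu>. t > 0 \<Longrightarrow> f (T t \<xi>, T t \<nu>) = t * f (\<xi>, \<nu>)"
    and "\<And>\<xi>. \<xi> \<noteq> 0 \<Longrightarrow> f (\<xi>, 0) > 0"
  shows "\<exists>M>0. \<forall>\<xi> \<nu>. f (\<xi>, \<nu>) \<ge> - M * R \<nu>"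
proof -
  define B where "B = level \<inter> {z. f z \<le> 0}"
  have cB: "compact B"
    unfolding B_def by (intro compact_Int_closed level_compact closed_Collect_le assms continuous_intros)
  have "\<exists>k>0. \<forall>z\<in>B. R (snd z) \<ge> k"
  proof (cases "B = {}")
    case False
    have "continuous_on B (\<lambda>z. R (snd z))"
      by (rule continuous_on_compose2[OF R_continuous[of UNIV] continuous_on_snd[OF continuous_on_id]]) auto
    then obtain w where w: "w \<in> B" "\<And>z. z \<in> B \<Longrightarrow> R (snd w) \<le> R (snd z)"
      using continuous_attains_inf[OF cB False] by blast
    have "snd w \<noteq> 0"
    proof
      assume 0: "snd w = 0"
      then have "R (fst w) = 1" using w(1) by (simp add: B_def level_def)
      then have "fst w \<noteq> 0" by auto
      then show False using assms(3) w(1) 0 by (cases w) (force simp: B_def)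
    qed
    then show ?thesis using w R_pos by blast
  qed (auto intro: exI[of _ 1])
  then obtain k where k: "k > 0" "\<And>z. z \<in> B \<Longrightarrow> R (snd z) \<ge> k" by blast
  obtain C where C: "C > 0" "\<And>\<xi> \<nu>. \<bar>f (\<xi>, \<nu>)\<bar> \<le> C * (R \<xi> + R \<nu>)"
    using homogeneous_le[OF assms(1,2)] by blast
  define M where "M = C / k"
  have "f (\<xi>, \<nu>) \<ge> - M * R \<nu>" for \<xi> \<nu>
  proof (cases "\<xi> \<noteq> 0 \<or> \<nu> \<noteq> 0")
    case True
    then obtain t \<xi>' \<nu>' where z: "t > 0" "t = R \<xi> + R \<nu>" "\<xi> = T t \<xi>'" "\<nu> = T t \<nu>'"
      "(\<xi>', \<nu>') \<in> level" by (rule scale_to_level)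
    have "f (\<xi>', \<nu>') \<ge> - M * R \<nu>'"
    proof (cases "f (\<xi>', \<nu>') \<le> 0")
      case True
      then have "R \<nu>' \<ge> k" using k(2)[of "(\<xi>', \<nu>')"] z(5) by (simp add: B_def)
      then have "M * R \<nu>' \<ge> C" using k(1) C(1) by (simp add: M_def field_simps)
      moreover have "\<bar>f (\<xi>', \<nu>')\<bar> \<le> C" using C(2)[of \<xi>' \<nu>'] z(5) by (simp add: level_def)
      ultimately show ?thesis by linarith
    next
      case False
      have "M * R \<nu>' \<ge> 0" using C(1) k(1) nonneg[of \<nu>'] by (simp add: M_def)
      then show ?thesis using False by linarith
    qed
    then have "t * f (\<xi>', \<nu>') \<ge> t * (- M * R \<nu>')" using z(1) by (intro mult_left_mono) auto
    then show ?thesis unfolding z(3,4) using assms(2)[OF z(1)] R_hom[OF z(1)] by (simp add: algebra_simps)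
  next
    case False
    then show ?thesis using assms(2)[of 2 0 0] by simp
  qed
  then show ?thesis using C(1) k(1) by (intro exI[of _ M]) (auto simp: M_def)
qed

text \<open>
  The minimum of \<open>R\<close> at 0 forces its derivative to vanish there, so \<open>R (c \<xi>) = o(c)\<close> as \<open>c\<close> tends to 0,
  uniformly for \<open>\<xi>\<close> in the level set \<open>R = 1\<close>; scaling extends this to all \<open>\<xi>\<close>.
\<close>
lemma R_scaled_small:
  assumes "R differentiable (at 0)" "\<kappa> > 0"
  shows "\<exists>c\<^sub>0>0. c\<^sub>0 \<le> 1 \<and> (\<forall>c \<xi>. 0 < c \<longrightarrow> c \<le> c\<^sub>0 \<longrightarrow> R (c *\<^sub>R \<xi>) \<le> \<kappa> * c * R \<xi>)"
proof -
  obtain R' where R': "(R has_derivative R') (at 0)" using assms(1) unfolding differentiable_def by blast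
  have "R' = (\<lambda>v. 0)"
    using nonneg by (intro differential_zero_maxmin[OF _ _ R', of UNIV]) simp_all
  then have "((\<lambda>y. R y / norm y) \<longlongrightarrow> 0) (at 0)"
    using R' nonneg unfolding has_derivative_at by simp
  obtain b where b: "b > 0" "\<And>\<xi>. R \<xi> \<le> 1 \<Longrightarrow> norm \<xi> \<le> b"
    using sublevel_bounded[of 1] by (auto simp: bounded_pos)
  have "\<forall>\<^sub>F y in at 0. R y / norm y < \<kappa> / b"
    using order_tendstoD(2)[OF \<open>((\<lambda>y. R y / norm y) \<longlongrightarrow> 0) (at 0)\<close>, of "\<kappa> / b"] assms(2) b(1) by simp
  then obtain d where d: "d > 0" "\<And>y. y \<noteq> 0 \<Longrightarrow> norm y < d \<Longrightarrow> R y / norm y < \<kappa> / b"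
    by (auto simp: eventually_at)
  define c\<^sub>0 where "c\<^sub>0 = min 1 (d / (2 * b))"
  have "R (c *\<^sub>R \<xi>) \<le> \<kappa> * c * R \<xi>" if c: "0 < c" "c \<le> c\<^sub>0" for c \<xi>
  proof (cases "\<xi> = 0")
    case False
    then obtain t \<xi>' \<nu>' where z: "t > 0" "\<xi> = T t \<xi>'" "0 = T t \<nu>'" "(\<xi>', \<nu>') \<in> level"
      using scale_to_level[of \<xi> 0] by metis
    have "\<nu>' = 0" using T_inj[OF z(1)] z(1,3) by (metis T_zero[OF z(1)] injD)
    then have R1: "R \<xi>' = 1" using z(4) by (simp add: level_def)
    then have nz: "\<xi>' \<noteq> 0" by auto
    have nb: "norm (c *\<^sub>R \<xi>') \<le> c * b" using b(2)[of \<xi>'] R1 c(1) by simp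
    also have "\<dots> \<le> d / 2"
      using c b(1) by (simp add: c\<^sub>0_def field_simps)
    finally have "norm (c *\<^sub>R \<xi>') < d" using d(1) by simp
    then have "R (c *\<^sub>R \<xi>') / norm (c *\<^sub>R \<xi>') < \<kappa> / b" using d(2)[of "c *\<^sub>R \<xi>'"] nz c(1) by simp
    then have "R (c *\<^sub>R \<xi>') < \<kappa> / b * norm (c *\<^sub>R \<xi>')" using nz c(1) by (simp add: divide_less_eq)
    also have "\<dots> \<le> \<kappa> / b * (c * b)" using nb assms(2) b(1) by (intro mult_left_mono) auto
    also have "\<dots> = \<kappa> * c" using b(1) by simp
    finally have "R (c *\<^sub>R \<xi>') \<le> \<kappa> * c" by simp
    moreover have "c *\<^sub>R \<xi> = T t (c *\<^sub>R \<xi>')" unfolding z(2) using lin[OF z(1)] by (simp add: linear_scale)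
    ultimately show ?thesis using z(1) R1 z(2) by (simp add: R_hom mult.commute)
  qed simp
  then show ?thesis using d(1) b(1) by (intro exI[of _ c\<^sub>0]) (auto simp: c\<^sub>0_def)
qed

lemma R_superlinear:
  assumes "R differentiable (at 0)"
  shows "\<exists>L. \<forall>\<xi>. norm \<xi> \<ge> L \<longrightarrow> B * norm \<xi> \<le> R \<xi>"
proof -
  obtain m where m: "m > 0" "\<And>\<eta>. norm \<eta> \<ge> 1 \<Longrightarrow> R \<eta> \<ge> m"
    using R_bounded_below_outside_ball by blast
  define \<kappa> where "\<kappa> = m / (\<bar>B\<bar> + 1)"
  have k: "\<kappa> > 0" using m(1) unfolding \<kappa>_def by (intro divide_pos_pos) auto
  obtain c\<^sub>0 where c0: "c\<^sub>0 > 0" "\<And>c \<xi>. 0 < c \<Longrightarrow> c \<le> c\<^sub>0 \<Longrightarrow> R (c *\<^sub>R \<xi>) \<le> \<kappa> * c * R \<xi>"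
    using R_scaled_small[OF assms k] by blast
  have "B * norm \<xi> \<le> R \<xi>" if "norm \<xi> \<ge> 1 / c\<^sub>0" for \<xi>
  proof -
    have n: "norm \<xi> > 0" using that c0(1) by (intro less_le_trans[OF _ that]) simp
    have c: "0 < 1 / norm \<xi>" "1 / norm \<xi> \<le> c\<^sub>0"
      using that c0(1) n by (simp_all add: pos_divide_le_eq mult.commute)
    \<comment> \<open>The unit vector in the direction of \<open>\<xi>\<close> is \<open>c \<xi>\<close> with \<open>c = 1 / norm \<xi>\<close>.\<close>
    have "m \<le> R ((1 / norm \<xi>) *\<^sub>R \<xi>)" using n by (intro m(2)) simp
    also have "\<dots> \<le> \<kappa> * (1 / norm \<xi>) * R \<xi>" by (rule c0(2)[OF c])
    also have "\<dots> = m * (R \<xi> / ((\<bar>B\<bar> + 1) * norm \<xi>))" by (simp add: \<kappa>_def)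
    finally have "m * 1 \<le> m * (R \<xi> / ((\<bar>B\<bar> + 1) * norm \<xi>))" by (simp only: mult_1_right)
    then have "1 \<le> R \<xi> / ((\<bar>B\<bar> + 1) * norm \<xi>)"
      using m(1) by (simp only: mult_le_cancel_left_pos)
    then have "(\<bar>B\<bar> + 1) * norm \<xi> \<le> R \<xi>"
      using n by (simp add: pos_le_divide_eq del: distrib_right_numeral)
    moreover have "B * norm \<xi> \<le> (\<bar>B\<bar> + 1) * norm \<xi>" by (intro mult_right_mono) auto
    ultimately show ?thesis by linarith
  qed
  then show ?thesis by blast
qed

text \<open>
  Superlinear growth confines the supremum in the Legendre-Fenchel transform to one ball for all
  \<open>y\<close> in a bounded set; \<open>\<xi> = 0\<close> shows that its value is nonnegative.
\<close>
lemma legendre_attained: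
  assumes "R differentiable (at 0)"
  shows "\<exists>L>0. \<forall>y. norm y \<le> B \<longrightarrow>
    (\<exists>\<xi>. norm \<xi> \<le> L \<and> (SUP \<xi>. y \<bullet> \<xi> - R \<xi>) = y \<bullet> \<xi> - R \<xi>)"
proof -
  obtain L\<^sub>0 where L0: "\<And>\<xi>. norm \<xi> \<ge> L\<^sub>0 \<Longrightarrow> B * norm \<xi> \<le> R \<xi>" using R_superlinear[OF assms] by blast
  define L where "L = max L\<^sub>0 1"
  have "\<exists>\<xi>. norm \<xi> \<le> L \<and> (SUP \<xi>. y \<bullet> \<xi> - R \<xi>) = y \<bullet> \<xi> - R \<xi>" if y: "norm y \<le> B" for y
  proof -
    have "continuous_on (cball 0 L) (\<lambda>\<xi>. y \<bullet> \<xi> - R \<xi>)"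
      by (intro continuous_intros R_continuous)
    moreover have "cball (0::'a) L \<noteq> {}" by (simp add: L_def)
    ultimately obtain \<xi>\<^sub>0 where x0: "\<xi>\<^sub>0 \<in> cball 0 L"
      "\<And>\<xi>. \<xi> \<in> cball 0 L \<Longrightarrow> y \<bullet> \<xi> - R \<xi> \<le> y \<bullet> \<xi>\<^sub>0 - R \<xi>\<^sub>0"
      using continuous_attains_sup[OF compact_cball] by blast
    have "y \<bullet> \<xi> - R \<xi> \<le> y \<bullet> \<xi>\<^sub>0 - R \<xi>\<^sub>0" for \<xi>
    proof (cases "norm \<xi> \<le> L")
      case False
      have "y \<bullet> \<xi> \<le> norm y * norm \<xi>" by (rule norm_cauchy_schwarz)
      also have "\<dots> \<le> B * norm \<xi>" using y by (intro mult_right_mono) auto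
      also have "\<dots> \<le> R \<xi>" using False by (intro L0) (simp add: L_def)
      finally have "y \<bullet> \<xi> - R \<xi> \<le> 0" by simp
      also have "0 \<le> y \<bullet> \<xi>\<^sub>0 - R \<xi>\<^sub>0" using x0(2)[of 0] by (simp add: L_def)
      finally show ?thesis .
    qed (use x0 in auto)
    then have "(SUP \<xi>. y \<bullet> \<xi> - R \<xi>) = y \<bullet> \<xi>\<^sub>0 - R \<xi>\<^sub>0"
      by (intro cSup_eq_maximum) auto
    then show ?thesis using x0(1) by auto
  qed
  then show ?thesis by (intro exI[of _ L]) (auto simp: L_def)
qed

end

section \<open>Interpolating imaginary shifts from real points\<close>

text \<open>
  Lagrange interpolation at the nodes \<open>0, ..., N\<close>: the weights evaluate every polynomial of degree at
  most \<open>N\<close> at the point \<open>z\<close> from its values at the nodes.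
\<close>
lemma lagrange_weights:
  fixes z :: complex
  shows "\<exists>l :: nat \<Rightarrow> complex. \<forall>k\<le>N. (\<Sum>j\<le>N. l j * of_nat j ^ k) = z ^ k"
proof -
  define L :: "nat \<Rightarrow> complex poly" where
    "L j = smult (1 / (\<Prod>i\<in>{..N} - {j}. of_nat j - of_nat i)) (\<Prod>i\<in>{..N} - {j}. [:- of_nat i, 1:])" for j
  have degL: "degree (L j) \<le> N" if "j \<le> N" for j
  proof -
    have "degree (\<Prod>i\<in>{..N} - {j}. [:- of_nat i, 1 :: complex:]) \<le> (\<Sum>i\<in>{..N} - {j}. degree [:- of_nat i, 1 :: complex:])"
      using degree_prod_sum_le[of "{..N} - {j}" "\<lambda>i. [:- of_nat i, 1 :: complex:]"] by (simp add: o_def)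
    also have "\<dots> = N" using that by simp
    finally show ?thesis by (simp add: L_def)
  qed
  have polyL: "poly (L j) (of_nat m) = (if m = j then 1 else 0)" if "j \<le> N" "m \<le> N" for j m
  proof (cases "m = j")
    case True
    have "(\<Prod>i\<in>{..N} - {j}. of_nat j - of_nat i :: complex) \<noteq> 0" by simp
    then show ?thesis using True by (simp add: L_def poly_prod)
  next
    case False
    then have "(\<Prod>i\<in>{..N} - {j}. of_nat m - of_nat i :: complex) = 0" using that by auto
    then show ?thesis using False by (simp add: L_def poly_prod)
  qed
  have "(\<Sum>j\<le>N. poly (L j) z * of_nat j ^ k) = z ^ k" if k: "k \<le> N" for k
  proof -
    define q where "q = (\<Sum>j\<le>N. smult (of_nat j ^ k) (L j)) - monom 1 k"
    have "degree q \<le> N"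
      unfolding q_def
      by (intro degree_diff_le degree_sum_le) (use degL k in \<open>auto simp: degree_monom_eq\<close>)
    moreover have "poly q (of_nat m) = 0" if "m \<le> N" for m
    proof -
      have "poly q (of_nat m) = (\<Sum>j\<le>N. of_nat j ^ k * (if m = j then 1 else 0)) - of_nat m ^ k"
        using that by (simp add: q_def poly_sum poly_monom polyL)
      also have "\<dots> = 0" using that by (simp add: if_distrib cong: if_cong)
      finally show ?thesis .
    qed
    then have "of_nat ` {..N} \<subseteq> {x. poly q x = 0}" by auto
    then have "q \<noteq> 0 \<Longrightarrow> card (of_nat ` {..N} :: complex set) \<le> degree q"
      using card_poly_roots_bound[of q] poly_roots_finite[of q] card_mono order_trans by blast
    then have "q \<noteq> 0 \<Longrightarrow> Suc N \<le> degree q"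
      by (simp add: card_image inj_on_def)
    ultimately have "q = 0" by linarith
    then have "poly q z = 0" by simp
    then show ?thesis by (simp add: q_def poly_sum poly_monom mult.commute)
  qed
  then show ?thesis by (intro exI[of _ "\<lambda>j. poly (L j) z"]) auto
qed

text \<open>
  With \<open>z = -\<i>\<close>, the weights reproduce \<open>exp a = exp (\<i> * (-\<i>) * a)\<close> from the unimodular values
  \<open>exp (\<i> * j * a)\<close>, up to the Taylor remainder of order \<open>N + 1\<close>.
\<close>
lemma exp_imaginary_interpolation:
  fixes l :: "nat \<Rightarrow> complex"
  assumes "\<forall>k\<le>N. (\<Sum>j\<le>N. l j * of_nat j ^ k) = (- \<i>) ^ k"
  shows "\<exists>C>0. \<forall>a::real. \<bar>a\<bar> \<le> 1 \<longrightarrow>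
    norm (of_real (exp a) - (\<Sum>j\<le>N. l j * exp (\<i> * of_real (real j * a)))) \<le> C * \<bar>a\<bar> ^ Suc N"
proof -
  define r where "r w = exp w - (\<Sum>k\<le>N. w ^ k / fact k)" for w :: complex
  define C where "C = exp 1 + (\<Sum>j\<le>N. norm (l j) * real j ^ Suc N)"
  have r: "norm (r w) \<le> exp \<bar>Re w\<bar> * norm w ^ Suc N" for w
  proof -
    have "norm (r w) \<le> exp \<bar>Re w\<bar> * norm w ^ Suc N / fact N"
      unfolding r_def by (rule Taylor_exp)
    also have "\<dots> \<le> exp \<bar>Re w\<bar> * norm w ^ Suc N / 1"
      by (intro divide_left_mono) (auto simp: fact_ge_1)
    finally show ?thesis by simp
  qed
  have "norm (of_real (exp a) - (\<Sum>j\<le>N. l j * exp (\<i> * of_real (real j * a)))) \<le> C * \<bar>a\<bar> ^ Suc N"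
    if a: "\<bar>a\<bar> \<le> 1" for a :: real
  proof -
    have "(\<Sum>j\<le>N. l j * (\<Sum>k\<le>N. (\<i> * of_real (real j * a)) ^ k / fact k))
      = (\<Sum>k\<le>N. (\<i> * of_real a) ^ k / fact k * (\<Sum>j\<le>N. l j * of_nat j ^ k))"
      by (subst (2) sum_distrib_left, subst sum_distrib_left, subst sum.swap)
         (simp add: power_mult_distrib field_simps)
    also have "\<dots> = (\<Sum>k\<le>N. (\<i> * of_real a) ^ k / fact k * (- \<i>) ^ k)"
      using assms by (intro sum.cong) auto
    also have "\<dots> = (\<Sum>k\<le>N. of_real a ^ k / fact k)"
    proof (rule sum.cong[OF refl])
      fix k
      have "(\<i> * of_real a) ^ k * (- \<i>) ^ k = (of_real a :: complex) ^ k"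
        by (simp add: mult.assoc mult.left_commute[of \<i>] flip: power_mult_distrib)
      then show "(\<i> * of_real a) ^ k / fact k * (- \<i>) ^ k = (of_real a :: complex) ^ k / fact k"
        by (metis times_divide_eq_left)
    qed
    finally have "of_real (exp a) - (\<Sum>j\<le>N. l j * exp (\<i> * of_real (real j * a)))
       = r (of_real a) - (\<Sum>j\<le>N. l j * r (\<i> * of_real (real j * a)))"
      by (simp add: r_def algebra_simps sum_subtractf exp_of_real)
    also have "norm \<dots> \<le> norm (r (of_real a)) + (\<Sum>j\<le>N. norm (l j * r (\<i> * of_real (real j * a))))"
      by (intro order_trans[OF norm_triangle_ineq4] add_left_mono norm_sum)
    also have "\<dots> \<le> exp 1 * \<bar>a\<bar> ^ Suc N + (\<Sum>j\<le>N. norm (l j) * (real j ^ Suc N * \<bar>a\<bar> ^ Suc N))"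
    proof (intro add_mono sum_mono)
      have "norm (r (of_real a)) \<le> exp \<bar>a\<bar> * \<bar>a\<bar> ^ Suc N" using r[of "of_real a"] by simp
      also have "\<dots> \<le> exp 1 * \<bar>a\<bar> ^ Suc N" using a by (intro mult_right_mono) auto
      finally show "norm (r (of_real a)) \<le> exp 1 * \<bar>a\<bar> ^ Suc N" .
      show "norm (l j * r (\<i> * of_real (real j * a))) \<le> norm (l j) * (real j ^ Suc N * \<bar>a\<bar> ^ Suc N)" for j
        unfolding norm_mult power_mult_distrib[symmetric]
        using r[of "\<i> * of_real (real j * a)"] by (intro mult_left_mono) (auto simp: norm_mult abs_mult)
    qed
    also have "\<dots> = C * \<bar>a\<bar> ^ Suc N"
      by (simp add: C_def distrib_right sum_distrib_right mult.assoc)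
    finally show ?thesis .
  qed
  moreover have "C > 0" unfolding C_def by (intro add_pos_nonneg sum_nonneg) auto
  ultimately show ?thesis by blast
qed

lemma norm_one_minus_le:
  fixes w :: complex
  shows "norm (1 - w) \<le> 1 - Re w + (norm w)\<^sup>2 / 2"
proof (rule power2_le_imp_le)
  define h where "h = - Re w + (norm w)\<^sup>2 / 2"
  have "(norm (1 - w))\<^sup>2 = 1 + 2 * h"
    by (simp add: h_def cmod_power2 power2_diff)
  also have "\<dots> \<le> (1 + h)\<^sup>2" by (simp add: power2_sum)
  finally show "(norm (1 - w))\<^sup>2 \<le> (1 - Re w + (norm w)\<^sup>2 / 2)\<^sup>2" by (simp add: h_def add_diff_eq diff_add_eq)
  have "(Re w)\<^sup>2 \<le> (norm w)\<^sup>2" by (simp add: cmod_power2)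
  moreover have "0 \<le> (1 - Re w)\<^sup>2" by simp
  ultimately show "0 \<le> 1 - Re w + (norm w)\<^sup>2 / 2" unfolding power2_diff by (simp add: field_simps)
qed

context homogeneous_symbol
begin

text \<open>
  \<open>G \<xi> \<nu>\<close> is the exponential sum at the complex frequency \<open>\<xi> - \<i>\<nu>\<close>. It is recovered from the real
  frequencies \<open>\<xi> + j\<nu>\<close>, up to an error of high order in \<open>\<nu>\<close> that is uniform in \<open>\<xi>\<close>.
\<close>
lemma exponential_sum_interpolation:
  fixes a :: "'b \<Rightarrow> 'a" and b :: "'b \<Rightarrow> complex"
  assumes "\<forall>k\<le>N. (\<Sum>j\<le>N. l j * of_nat j ^ k) = (- \<i>) ^ k" and "finite S"
    and G: "\<And>\<xi> \<nu>. G \<xi> \<nu> = (\<Sum>x\<in>S. b x * exp (Complex (a x \<bullet> \<nu>) (a x \<bullet> \<xi>)))"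
  shows "\<exists>r>0. \<exists>A>0. \<forall>\<xi> \<nu>. norm \<nu> < r \<longrightarrow>
    norm (G \<xi> \<nu> - (\<Sum>j\<le>N. l j * G (\<xi> + real j *\<^sub>R \<nu>) 0)) \<le> A * norm \<nu> ^ Suc N"
proof -
  obtain C where C: "C > 0" "\<And>u::real. \<bar>u\<bar> \<le> 1 \<Longrightarrow>
      norm (of_real (exp u) - (\<Sum>j\<le>N. l j * exp (\<i> * of_real (real j * u)))) \<le> C * \<bar>u\<bar> ^ Suc N"
    using exp_imaginary_interpolation[OF assms(1)] by blast
  define r where "r = 1 / (1 + (\<Sum>x\<in>S. norm (a x)))"
  have s0: "(\<Sum>x\<in>S. norm (a x)) \<ge> 0" by (intro sum_nonneg) auto
  then have r: "r > 0" by (simp add: r_def add_pos_nonneg)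
  define A where "A = 1 + (\<Sum>x\<in>S. norm (b x) * (C * norm (a x) ^ Suc N))"
  have A: "A > 0" unfolding A_def using C(1) by (intro add_pos_nonneg sum_nonneg) auto
  have "norm (G \<xi> \<nu> - (\<Sum>j\<le>N. l j * G (\<xi> + real j *\<^sub>R \<nu>) 0)) \<le> A * norm \<nu> ^ Suc N"
    if nu: "norm \<nu> < r" for \<xi> \<nu>
  proof -
    define e where "e x = of_real (exp (a x \<bullet> \<nu>)) - (\<Sum>j\<le>N. l j * exp (\<i> * of_real (real j * (a x \<bullet> \<nu>))))" for x
    have ex: "exp (Complex p q) = exp (\<i> * of_real q) * of_real (exp p)" for p q
      by (simp add: Complex_eq exp_add exp_of_real[symmetric] add.commute)
    have "G \<xi> \<nu> - (\<Sum>j\<le>N. l j * G (\<xi> + real j *\<^sub>R \<nu>) 0) = (\<Sum>x\<in>S. b x * exp (\<i> * of_real (a x \<bullet> \<xi>)) * e x)"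
    proof -
      have "(\<Sum>j\<le>N. l j * G (\<xi> + real j *\<^sub>R \<nu>) 0)
        = (\<Sum>x\<in>S. \<Sum>j\<le>N. l j * (b x * (exp (\<i> * of_real (a x \<bullet> \<xi>)) * exp (\<i> * of_real (real j * (a x \<bullet> \<nu>))))))"
        unfolding G sum_distrib_left
        by (subst sum.swap) (simp add: ex inner_add_right distrib_left exp_add)
      then show ?thesis
        unfolding G e_def ex right_diff_distrib sum_subtractf
        by (simp add: sum_distrib_left mult_ac)
    qed
    also have "norm \<dots> \<le> (\<Sum>x\<in>S. norm (b x * exp (\<i> * of_real (a x \<bullet> \<xi>)) * e x))" by (rule norm_sum)
    also have "\<dots> \<le> (\<Sum>x\<in>S. norm (b x) * (C * norm (a x) ^ Suc N) * norm \<nu> ^ Suc N)"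
    proof (rule sum_mono)
      fix x assume x: "x \<in> S"
      have le: "\<bar>a x \<bullet> \<nu>\<bar> \<le> norm (a x) * norm \<nu>" by (rule Cauchy_Schwarz_ineq2)
      also have "\<dots> \<le> (1 + (\<Sum>x\<in>S. norm (a x))) * r"
        using member_le_sum[OF x, of "\<lambda>x. norm (a x)"] nu assms(2) s0
        by (intro mult_mono) auto
      also have "\<dots> = 1" using s0 by (simp add: r_def)
      finally have "norm (e x) \<le> C * \<bar>a x \<bullet> \<nu>\<bar> ^ Suc N" unfolding e_def by (rule C(2))
      also have "\<dots> \<le> C * (norm (a x) * norm \<nu>) ^ Suc N"
        using C(1) le by (intro mult_left_mono power_mono) auto
      finally have "norm (b x) * norm (e x) \<le> norm (b x) * (C * (norm (a x) * norm \<nu>) ^ Suc N)"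
        by (intro mult_left_mono) auto
      then show "norm (b x * exp (\<i> * of_real (a x \<bullet> \<xi>)) * e x)
          \<le> norm (b x) * (C * norm (a x) ^ Suc N) * norm \<nu> ^ Suc N"
        by (simp add: norm_mult power_mult_distrib mult_ac)
    qed
    also have "\<dots> = (A - 1) * norm \<nu> ^ Suc N" by (simp add: A_def sum_distrib_right)
    also have "\<dots> \<le> A * norm \<nu> ^ Suc N" by (intro mult_right_mono) auto
    finally show ?thesis .
  qed
  then show ?thesis using r A by blast
qed

text \<open>
  The passage from real to complex frequencies. On real points \<open>G = 1 - P + o(R)\<close>; interpolation turns
  this into \<open>G \<xi> \<nu> = 1 - Q \<xi> \<nu> + o(R \<xi> + R \<nu>)\<close>, where \<open>Q\<close> interpolates \<open>P\<close> in the same way, the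
  remainder \<open>norm \<nu> ^ (N + 1)\<close> being absorbed by \<open>R \<nu>\<close>. The function \<open>Q\<close> is again homogeneous and
  \<open>Q \<xi> 0 = P \<xi>\<close>, so \<open>Re Q \<ge> R \<xi> / 2 - M * R \<nu>\<close> by compactness.
\<close>
lemma complex_shift_bound:
  fixes a :: "'b \<Rightarrow> 'a" and b :: "'b \<Rightarrow> complex"
  assumes "finite S"
    and G: "\<And>\<xi> \<nu>. G \<xi> \<nu> = (\<Sum>x\<in>S. b x * exp (Complex (a x \<bullet> \<nu>) (a x \<bullet> \<xi>)))"
    and small: "\<And>\<delta>. \<delta> > 0 \<Longrightarrow> \<forall>\<^sub>F \<xi> in nhds 0. norm (G \<xi> 0 - 1 + P \<xi>) \<le> \<delta> * R \<xi>"
  shows "\<exists>r>0. \<exists>\<epsilon>>0. \<exists>M>0. \<forall>\<xi> \<nu>. norm \<xi> < r \<longrightarrow> norm \<nu> < r \<longrightarrow>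
    norm (G \<xi> \<nu>) \<le> exp (- \<epsilon> * R \<xi> + M * R \<nu>)"
proof -
  obtain N C\<^sub>0 where N: "C\<^sub>0 > 0" "\<And>\<nu>. norm \<nu> \<le> 1 \<Longrightarrow> norm \<nu> ^ N \<le> C\<^sub>0 * R \<nu>"
    using norm_power_le_R by blast
  obtain l :: "nat \<Rightarrow> complex" where l: "\<forall>k\<le>N. (\<Sum>j\<le>N. l j * of_nat j ^ k) = (- \<i>) ^ k"
    using lagrange_weights by blast
  have l1: "(\<Sum>j\<le>N. l j) = 1" using l[rule_format, of 0] by simp
  obtain r1 A where A: "r1 > 0" "A > 0" "\<And>\<xi> \<nu>. norm \<nu> < r1 \<Longrightarrow>
    norm (G \<xi> \<nu> - (\<Sum>j\<le>N. l j * G (\<xi> + real j *\<^sub>R \<nu>) 0)) \<le> A * norm \<nu> ^ Suc N"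
    using exponential_sum_interpolation[OF l assms(1) G] by blast
  define Q where "Q \<xi> \<nu> = (\<Sum>j\<le>N. l j * P (\<xi> + real j *\<^sub>R \<nu>))" for \<xi> \<nu>
  have Tadd: "T t \<xi> + real j *\<^sub>R T t \<nu> = T t (\<xi> + real j *\<^sub>R \<nu>)" if "t > 0" for t \<xi> \<nu> j
    using lin[OF that] by (simp add: linear_add linear_scale)
  have contP: "continuous_on UNIV (\<lambda>z :: 'a \<times> 'a. P (fst z + real j *\<^sub>R snd z))" for j
    by (rule continuous_on_compose2[OF cont]) (auto intro!: continuous_intros)
  have Qhom: "Q (T t \<xi>) (T t \<nu>) = of_real t * Q \<xi> \<nu>" if "t > 0" for t \<xi> \<nu>
    unfolding Q_def Tadd[OF that] hom[OF that] by (simp add: sum_distrib_left mult_ac)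
  have contQ: "continuous_on UNIV (\<lambda>z. Q (fst z) (snd z))"
    unfolding Q_def by (intro continuous_intros contP)
  have "\<exists>C>0. \<forall>\<xi> \<nu>. \<bar>(\<lambda>z. norm (Q (fst z) (snd z))) (\<xi>, \<nu>)\<bar> \<le> C * (R \<xi> + R \<nu>)"
    by (rule homogeneous_le) (auto intro!: continuous_on_norm contQ simp: Qhom norm_mult)
  then obtain C1 where C1: "C1 > 0" "\<And>\<xi> \<nu>. norm (Q \<xi> \<nu>) \<le> C1 * (R \<xi> + R \<nu>)" by auto
  have "\<exists>C>0. \<forall>\<xi> \<nu>. \<bar>(\<lambda>z. \<Sum>j\<le>N. norm (l j) * R (fst z + real j *\<^sub>R snd z)) (\<xi>, \<nu>)\<bar> \<le> C * (R \<xi> + R \<nu>)"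
    by (rule homogeneous_le)
       (auto intro!: continuous_intros contP simp: Tadd hom sum_distrib_left mult_ac)
  then obtain C2 where C2: "C2 > 0"
    "\<And>\<xi> \<nu>. (\<Sum>j\<le>N. norm (l j) * R (\<xi> + real j *\<^sub>R \<nu>)) \<le> C2 * (R \<xi> + R \<nu>)"
    by (auto dest: abs_le_D1)
  have "\<exists>M>0. \<forall>\<xi> \<nu>. (\<lambda>z. Re (Q (fst z) (snd z)) - R (fst z) / 2) (\<xi>, \<nu>) \<ge> - M * R \<nu>"
  proof (rule homogeneous_ge)
    have "continuous_on UNIV (\<lambda>z :: 'a \<times> 'a. P (fst z))" using contP[of 0] by simp
    then show "continuous_on UNIV (\<lambda>z. Re (Q (fst z) (snd z)) - R (fst z) / 2)"
      by (intro continuous_intros contQ) auto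
    show "Re (Q (fst (\<xi>, 0)) (snd (\<xi>, 0))) - R (fst (\<xi>, 0)) / 2 > 0" if "\<xi> \<noteq> 0" for \<xi>
      using R_pos[OF that] l1 by (simp add: Q_def flip: sum_distrib_right)
  qed (simp add: Qhom hom right_diff_distrib)
  then obtain M where M: "M > 0" "\<And>\<xi> \<nu>. Re (Q \<xi> \<nu>) - R \<xi> / 2 \<ge> - M * R \<nu>" by auto
  \<comment> \<open>Three error terms of size at most \<open>(R \<xi> + R \<nu>) / 16\<close> each are arranged: the little-o term, the
    interpolation error, and the quadratic term of \<open>norm (1 - Q)\<close>. Their sum is below a quarter of
    \<open>R \<xi> + R \<nu>\<close>, which leaves \<open>R \<xi> / 4\<close> of the gain \<open>R \<xi> / 2\<close>.\<close>
  define \<delta> where "\<delta> = 1 / (16 * C2)"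
  have d: "\<delta> > 0" using C2(1) by (simp add: \<delta>_def)
  obtain r2 where r2: "r2 > 0" "\<And>\<xi>. norm \<xi> < r2 \<Longrightarrow> norm (G \<xi> 0 - 1 + P \<xi>) \<le> \<delta> * R \<xi>"
    using small[OF d] by (auto simp: eventually_nhds_metric)
  have "isCont R 0" using R_continuous[of UNIV] by (simp only: continuous_on_eq_continuous_at open_UNIV UNIV_I)
  then have "(R \<longlongrightarrow> R 0) (nhds 0)" unfolding isCont_def by (rule tendsto_at_iff_tendsto_nhds[where g=R and l=0, THEN iffD1])
  then have "\<forall>\<^sub>F \<xi> in nhds 0. R \<xi> < 1 / (16 * C1\<^sup>2)"
    using C1(1) by (intro order_tendstoD(2)) auto
  then obtain r3 where r3: "r3 > 0" "\<And>\<xi>. norm \<xi> < r3 \<Longrightarrow> R \<xi> < 1 / (16 * C1\<^sup>2)"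
    by (auto simp: eventually_nhds_metric)
  define r4 where "r4 = 1 / (16 * A * C\<^sub>0)"
  have r4: "r4 > 0" using A(2) N(1) by (simp add: r4_def)
  define r where "r = min 1 (min r1 (min (r2 / (real N + 1)) (min r3 r4)))"
  have rle: "r \<le> 1" "r \<le> r1" "r \<le> r2 / (real N + 1)" "r \<le> r3" "r \<le> r4"
    unfolding r_def by linarith+
  have "r2 / (real N + 1) > 0" using r2(1) by (intro divide_pos_pos) auto
  then have rpos: "r > 0" using A(1) r3(1) r4 unfolding r_def by linarith
  have "norm (G \<xi> \<nu>) \<le> exp (- (1/4) * R \<xi> + (M + 1/4) * R \<nu>)" if xi: "norm \<xi> < r" and nu: "norm \<nu> < r" for \<xi> \<nu>
  proof -
    define s where "s = R \<xi> + R \<nu>"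
    have s0: "s \<ge> 0" using nonneg[of \<xi>] nonneg[of \<nu>] by (simp add: s_def)
    define h where "h \<eta> = G \<eta> 0 - 1 + P \<eta>" for \<eta>
    have h: "norm (h (\<xi> + real j *\<^sub>R \<nu>)) \<le> \<delta> * R (\<xi> + real j *\<^sub>R \<nu>)" if "j \<le> N" for j
    proof -
      have "norm (\<xi> + real j *\<^sub>R \<nu>) \<le> norm \<xi> + real j * norm \<nu>" by (rule norm_triangle_le) simp
      also have "\<dots> \<le> norm \<xi> + real N * norm \<nu>" using that by (intro add_left_mono mult_right_mono) auto
      also have "\<dots> < r + real N * r" using xi nu by (intro add_less_le_mono mult_left_mono) auto
      also have "\<dots> = r * (real N + 1)" by (simp add: algebra_simps)
      also have "\<dots> \<le> r2" using rle(3) by (simp add: pos_le_divide_eq)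
      finally show ?thesis unfolding h_def by (rule r2(2))
    qed
    have "(\<Sum>j\<le>N. l j * G (\<xi> + real j *\<^sub>R \<nu>) 0) = (\<Sum>j\<le>N. l j * (1 - P (\<xi> + real j *\<^sub>R \<nu>) + h (\<xi> + real j *\<^sub>R \<nu>)))"
      by (simp add: h_def)
    also have "\<dots> = 1 - Q \<xi> \<nu> + (\<Sum>j\<le>N. l j * h (\<xi> + real j *\<^sub>R \<nu>))"
      using l1 by (simp add: Q_def algebra_simps sum.distrib sum_subtractf)
    finally have eq: "G \<xi> \<nu> = (1 - Q \<xi> \<nu>) + (\<Sum>j\<le>N. l j * h (\<xi> + real j *\<^sub>R \<nu>))
       + (G \<xi> \<nu> - (\<Sum>j\<le>N. l j * G (\<xi> + real j *\<^sub>R \<nu>) 0))" by simp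
    have e1: "norm (\<Sum>j\<le>N. l j * h (\<xi> + real j *\<^sub>R \<nu>)) \<le> s / 16"
    proof -
      have "norm (\<Sum>j\<le>N. l j * h (\<xi> + real j *\<^sub>R \<nu>)) \<le> (\<Sum>j\<le>N. norm (l j) * (\<delta> * R (\<xi> + real j *\<^sub>R \<nu>)))"
        by (rule order_trans[OF norm_sum]) (auto simp: norm_mult intro!: sum_mono mult_left_mono h)
      also have "\<dots> = \<delta> * (\<Sum>j\<le>N. norm (l j) * R (\<xi> + real j *\<^sub>R \<nu>))"
        by (simp add: sum_distrib_left mult_ac)
      also have "\<dots> \<le> \<delta> * (C2 * s)" unfolding s_def using d by (intro mult_left_mono C2(2)) auto
      also have "\<dots> = s / 16" using C2(1) by (simp add: \<delta>_def)
      finally show ?thesis .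
    qed
    have e2: "norm (G \<xi> \<nu> - (\<Sum>j\<le>N. l j * G (\<xi> + real j *\<^sub>R \<nu>) 0)) \<le> s / 16"
    proof -
      have "norm (G \<xi> \<nu> - (\<Sum>j\<le>N. l j * G (\<xi> + real j *\<^sub>R \<nu>) 0)) \<le> A * norm \<nu> ^ Suc N"
        using nu rle by (intro A(3)) auto
      also have "\<dots> = A * norm \<nu> * norm \<nu> ^ N" by simp
      also have "\<dots> \<le> A * r4 * (C\<^sub>0 * R \<nu>)"
        using nu rle A(2) r4 by (intro mult_mono N(2)) auto
      also have "\<dots> = R \<nu> / 16" using A(2) N(1) by (simp add: r4_def)
      also have "\<dots> \<le> s / 16" using nonneg[of \<xi>] by (simp add: s_def)
      finally show ?thesis .
    qed
    have e3: "(norm (Q \<xi> \<nu>))\<^sup>2 / 2 \<le> s / 16"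
    proof -
      have "R \<xi> < 1 / (16 * C1\<^sup>2)" "R \<nu> < 1 / (16 * C1\<^sup>2)" using xi nu rle by (intro r3(2); simp)+
      then have "s \<le> 1 / (8 * C1\<^sup>2)" by (simp add: s_def)
      have "(norm (Q \<xi> \<nu>))\<^sup>2 \<le> (C1 * s)\<^sup>2" using C1(2)[of \<xi> \<nu>] by (intro power_mono) (auto simp: s_def)
      also have "\<dots> = C1\<^sup>2 * s * s" by (simp add: power2_eq_square)
      also have "\<dots> \<le> C1\<^sup>2 * s * (1 / (8 * C1\<^sup>2))"
        using \<open>s \<le> 1 / (8 * C1\<^sup>2)\<close> s0 by (intro mult_left_mono) auto
      also have "\<dots> = s / 8" using C1(1) by simp
      finally show ?thesis by simp
    qed
    have "norm (G \<xi> \<nu>) \<le> norm (1 - Q \<xi> \<nu>) + s / 16 + s / 16"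
      by (subst eq) (intro norm_triangle_mono e1 e2 order_refl)
    also have "\<dots> \<le> 1 + (- Re (Q \<xi> \<nu>) + s / 4)" using norm_one_minus_le[of "Q \<xi> \<nu>"] e3 s0 by linarith
    also have "\<dots> \<le> exp (- Re (Q \<xi> \<nu>) + s / 4)" by (rule exp_ge_add_one_self)
    also have "exp (- Re (Q \<xi> \<nu>) + s / 4) \<le> exp (- (1/4) * R \<xi> + (M + 1/4) * R \<nu>)"
    proof -
      have "- (1/4) * R \<xi> + (M + 1/4) * R \<nu> - (- Re (Q \<xi> \<nu>) + s / 4)
          = (Re (Q \<xi> \<nu>) - R \<xi> / 2) - (- M * R \<nu>)"
        by (simp add: s_def field_simps)
      also have "\<dots> \<ge> 0" using M(2)[of \<nu> \<xi>] by (rule diff_ge_0_iff_ge[THEN iffD2])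
      finally show ?thesis by (simp only: exp_le_cancel_iff diff_ge_0_iff_ge)
    qed
    finally show ?thesis .
  qed
  moreover have "M + 1/4 > 0" using M(1) by simp
  ultimately show ?thesis using rpos by (intro exI[of _ r] conjI exI[of _ "1/4"] exI[of _ "M + 1/4"]) auto
qed

end

section \<open>The volume of sublevel sets\<close>

lemma summable_exp_neg_times_powr:
  fixes \<epsilon> \<mu> :: real
  assumes "\<epsilon> > 0"
  shows "summable (\<lambda>k. exp (- \<epsilon> * real k) * (real k + 1) powr \<mu>)"
proof (rule summable_comparison_test_bigo)
  show "summable (\<lambda>k. norm (1 / real k ^ 2))"
    using inverse_power_summable[of 2, where 'a=real] by (simp add: inverse_eq_divide power_divide)
  show "(\<lambda>k. exp (- \<epsilon> * real k) * (real k + 1) powr \<mu>) \<in> O(\<lambda>k. 1 / real k ^ 2)"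
    using assms by real_asymp
qed

locale homogeneous_symbol_volume = homogeneous_symbol P T
  for P :: "'a::euclidean_space \<Rightarrow> complex" and T +
  fixes \<mu> :: real
  assumes volume: "t > 0 \<Longrightarrow> compact S \<Longrightarrow> measure lborel (T t ` S) = t powr \<mu> * measure lborel S"
begin

lemma measure_sublevel:
  assumes "s > 0"
  shows "measure lborel {\<xi>. R \<xi> \<le> s} = s powr \<mu> * measure lborel {\<xi>. R \<xi> \<le> 1}"
proof -
  have "{\<xi>. R \<xi> \<le> s} = T s ` {\<xi>. R \<xi> \<le> 1}"
  proof (intro set_eqI iffI)
    fix \<xi> assume x: "\<xi> \<in> {\<xi>. R \<xi> \<le> s}"
    obtain \<zeta> where "\<xi> = T s \<zeta>" using T_surj[OF assms] by (metis surjD)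
    then show "\<xi> \<in> T s ` {\<xi>. R \<xi> \<le> 1}" using x assms by (auto simp: R_hom)
  qed (use assms in \<open>auto simp: R_hom\<close>)
  then show ?thesis using volume[OF assms sublevel_compact] by simp
qed

text \<open>
  The integral over space is split along the level sets of \<open>n * R\<close> at the integers. The sublevel set
  \<open>n * R \<le> k + 1\<close> has volume proportional to \<open>((k + 1) / n) powr \<mu>\<close>, which pulls out the factor
  \<open>n powr - \<mu>\<close> and leaves a convergent series.
\<close>
lemma integral_exp_neg_R:
  assumes "\<epsilon> > 0"
  shows "\<exists>C>0. \<forall>n\<ge>1. (\<integral>\<^sup>+\<xi>. ennreal (exp (- (real n * \<epsilon> * R \<xi>))) \<partial>lborel) \<le> ennreal (C / real n powr \<mu>)"
proof -
  define m where "m = measure lborel {\<xi>. R \<xi> \<le> 1}"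
  define w where "w k = exp (- \<epsilon> * real k) * (real k + 1) powr \<mu> * m" for k
  have w0: "w k \<ge> 0" for k by (simp add: w_def m_def)
  have "summable (\<lambda>k. exp (- \<epsilon> * real k) * (real k + 1) powr \<mu>)"
    by (rule summable_exp_neg_times_powr[OF assms])
  then have sw: "summable w" unfolding w_def by (rule summable_mult2)
  have "(\<integral>\<^sup>+\<xi>. ennreal (exp (- (real n * \<epsilon> * R \<xi>))) \<partial>lborel) \<le> ennreal ((suminf w + 1) / real n powr \<mu>)"
    if n: "n \<ge> 1" for n
  proof -
    define A where "A k = {\<xi>. R \<xi> \<le> (real k + 1) / real n}" for k
    have Ac: "compact (A k)" for k unfolding A_def by (rule sublevel_compact)
    have Am [measurable]: "A k \<in> sets borel" for k using Ac by (rule borel_compact)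
    have eA: "emeasure lborel (A k) = ennreal (((real k + 1) / real n) powr \<mu> * m)" for k
    proof -
      have "emeasure lborel (A k) = ennreal (measure lborel (A k))"
        using emeasure_compact_finite[OF Ac, of k] by (intro emeasure_eq_ennreal_measure) (simp add: less_top)
      then show ?thesis using n unfolding A_def m_def by (subst (asm) measure_sublevel) auto
    qed
    have "ennreal (exp (- (real n * \<epsilon> * R \<xi>))) \<le> (\<Sum>k. ennreal (exp (- \<epsilon> * real k)) * indicator (A k) \<xi>)" for \<xi>
    proof -
      define k where "k = nat \<lfloor>real n * R \<xi>\<rfloor>"
      have nR: "0 \<le> real n * R \<xi>" using nonneg[of \<xi>] by simp
      then have k: "real k \<le> real n * R \<xi>" "real n * R \<xi> \<le> real k + 1"
        unfolding k_def by linarith+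
      have "\<xi> \<in> A k" using k(2) n by (simp add: A_def pos_le_divide_eq mult.commute)
      moreover have "\<epsilon> * real k \<le> real n * \<epsilon> * R \<xi>"
        using mult_left_mono[OF k(1), of \<epsilon>] assms by (simp add: mult_ac)
      ultimately have "ennreal (exp (- (real n * \<epsilon> * R \<xi>))) \<le> ennreal (exp (- \<epsilon> * real k)) * indicator (A k) \<xi>"
        by (auto intro!: ennreal_leI)
      also have "\<dots> \<le> (\<Sum>k. ennreal (exp (- \<epsilon> * real k)) * indicator (A k) \<xi>)"
      proof -
        define f where "f j = ennreal (exp (- \<epsilon> * real j)) * indicator (A j) \<xi>" for j
        have "f k \<le> suminf f" using sum_le_suminf[of f "{k}"] by simp
        then show ?thesis unfolding f_def .
      qed
      finally show ?thesis .
    qed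
    then have "(\<integral>\<^sup>+\<xi>. ennreal (exp (- (real n * \<epsilon> * R \<xi>))) \<partial>lborel)
      \<le> (\<integral>\<^sup>+\<xi>. (\<Sum>k. ennreal (exp (- \<epsilon> * real k)) * indicator (A k) \<xi>) \<partial>lborel)"
      by (intro nn_integral_mono) auto
    also have "\<dots> = (\<Sum>k. \<integral>\<^sup>+\<xi>. ennreal (exp (- \<epsilon> * real k)) * indicator (A k) \<xi> \<partial>lborel)"
      by (intro nn_integral_suminf) auto
    also have "\<dots> = (\<Sum>k. ennreal (w k / real n powr \<mu>))"
    proof (rule suminf_cong)
      fix k
      have "(\<integral>\<^sup>+\<xi>. ennreal (exp (- \<epsilon> * real k)) * indicator (A k) \<xi> \<partial>lborel)
        = ennreal (exp (- \<epsilon> * real k)) * emeasure lborel (A k)"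
        by (rule nn_integral_cmult_indicator) auto
      also have "\<dots> = ennreal (w k / real n powr \<mu>)"
        using n unfolding eA by (subst ennreal_mult[symmetric]) (auto simp: w_def powr_divide m_def)
      finally show "(\<integral>\<^sup>+\<xi>. ennreal (exp (- \<epsilon> * real k)) * indicator (A k) \<xi> \<partial>lborel)
        = ennreal (w k / real n powr \<mu>)" .
    qed
    also have "\<dots> = ennreal (\<Sum>k. w k / real n powr \<mu>)"
      using sw w0 by (intro suminf_ennreal2 summable_divide) auto
    also have "(\<Sum>k. w k / real n powr \<mu>) = suminf w / real n powr \<mu>"
      by (rule suminf_divide[OF sw])
    also have "ennreal \<dots> \<le> ennreal ((suminf w + 1) / real n powr \<mu>)"
      by (intro ennreal_leI divide_right_mono) auto
    finally show ?thesis .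
  qed
  moreover have "suminf w + 1 > 0" using suminf_nonneg[OF sw w0] by simp
  ultimately show ?thesis by blast
qed

end

section \<open>Trigonometric polynomials at complex frequencies\<close>

lemma integral_lborel_prod:
  fixes g :: "'a::euclidean_space \<Rightarrow> real \<Rightarrow> complex"
  assumes "\<And>b. b \<in> Basis \<Longrightarrow> integrable lborel (g b)"
  shows "(\<integral>x. (\<Prod>b\<in>Basis. g b (x \<bullet> b)) \<partial>lborel) = (\<Prod>b\<in>Basis. \<integral>u. g b u \<partial>lborel)"
proof -
  interpret product_sigma_finite "\<lambda>b::'a. lborel :: real measure" ..
  have [measurable]: "g b \<in> borel_measurable borel" if "b \<in> Basis" for b
    using borel_measurable_integrable[OF assms[OF that]] by simp
  have "(\<integral>x. (\<Prod>b\<in>Basis. g b (x \<bullet> b)) \<partial>(lborel :: 'a measure))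
    = (\<integral>f. (\<Prod>b\<in>Basis. g b ((\<Sum>c\<in>Basis. f c *\<^sub>R c) \<bullet> b)) \<partial>(\<Pi>\<^sub>M b\<in>Basis. lborel))"
    by (subst lborel_eq, subst integral_distr) auto
  also have "\<dots> = (\<integral>f. (\<Prod>b\<in>Basis. g b (f b)) \<partial>(\<Pi>\<^sub>M b\<in>Basis. lborel))"
    by (intro Bochner_Integration.integral_cong prod.cong refl) simp
  also have "\<dots> = (\<Prod>b\<in>Basis. \<integral>u. g b u \<partial>lborel)"
    by (intro product_integral_prod assms) auto
  finally show ?thesis .
qed

lemma integral_exp_int:
  fixes m :: int
  shows "(\<integral>u. indicator {- pi..pi} u *\<^sub>R exp (\<i> * of_real (of_int m * u)) \<partial>lborel)
    = (if m = 0 then of_real (2 * pi) else 0 :: complex)"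
proof (cases "m = 0")
  case True
  have "(\<integral>u. indicator {- pi..pi} u *\<^sub>R (1 :: complex) \<partial>lborel) = of_real pi - of_real (- pi)"
    by (rule integral_FTC_atLeastAtMost) (auto intro!: derivative_eq_intros)
  then show ?thesis using True by simp
next
  case False
  define F where "F u = exp (\<i> * of_real (of_int m * u)) / (\<i> * of_int m)" for u :: real
  have "(\<integral>u. indicator {- pi..pi} u *\<^sub>R exp (\<i> * of_real (of_int m * u)) \<partial>lborel) = F pi - F (- pi)"
  proof (rule integral_FTC_atLeastAtMost)
    fix x :: real
    have "((\<lambda>z. exp (\<i> * (of_int m * z)) / (\<i> * of_int m)) has_field_derivative
        exp (\<i> * (of_int m * of_real x))) (at (of_real x))"
      using False by (auto intro!: derivative_eq_intros simp: field_simps)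
    then have "(F has_vector_derivative exp (\<i> * of_real (of_int m * x))) (at x)"
      unfolding F_def using has_vector_derivative_real_field[of "\<lambda>z. exp (\<i> * (of_int m * z)) / (\<i> * of_int m)"]
      by simp
    then show "(F has_vector_derivative exp (\<i> * of_real (of_int m * x))) (at x within {- pi..pi})"
      by (rule has_vector_derivative_at_within)
  qed (auto intro!: continuous_intros)
  also have "exp (\<i> * of_real (of_int m * pi)) = exp (\<i> * of_real (of_int m * - pi))"
  proof -
    have "exp (\<i> * of_real (of_int m * pi)) = exp (\<i> * of_real (of_int m * - pi)) * exp (2 * of_int m * pi * \<i>)"
      by (simp flip: exp_add)
    also have "exp (2 * of_int m * pi * \<i>) = 1"
      by (rule exp_integer_2pi) auto
    finally show ?thesis by simp
  qed
  then have "F pi - F (- pi) = 0" unfolding F_def by simp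
  finally show ?thesis using False by simp
qed

text \<open>
  The character \<open>exp (\<i> x \<bullet> z)\<close> at the complex frequency \<open>z = \<xi> - \<i>\<nu>\<close>, as a function of the two real
  vectors.
\<close>
definition lattice_char :: "int ^ 'd \<Rightarrow> real ^ 'd \<Rightarrow> real ^ 'd \<Rightarrow> complex" where
  "lattice_char x \<xi> \<nu> = exp (Complex (real_vec x \<bullet> \<nu>) (real_vec x \<bullet> \<xi>))"

lemma real_vec_simps [simp]:
  "real_vec 0 = 0" "real_vec (x + y) = real_vec x + real_vec y"
  "real_vec (- x) = - real_vec x" "real_vec (x - y) = real_vec x - real_vec y"
  by (simp_all add: real_vec_def vec_eq_iff)

lemma lattice_char_add: "lattice_char (x + y) \<xi> \<nu> = lattice_char x \<xi> \<nu> * lattice_char y \<xi> \<nu>"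
  by (simp add: lattice_char_def inner_add_left complex_add flip: exp_add)

lemma lattice_char_0 [simp]: "lattice_char 0 \<xi> \<nu> = 1"
  by (simp add: lattice_char_def zero_complex.code[symmetric])

lemma lattice_char_shift: "lattice_char x \<xi> \<nu> = of_real (exp (real_vec x \<bullet> \<nu>)) * lattice_char x \<xi> 0"
  by (simp add: lattice_char_def Complex_eq exp_add exp_of_real[symmetric] add.commute)

definition cube :: "(real ^ 'd) set" where
  "cube = cbox (\<chi> i. - pi) (\<chi> i. pi)"

lemma compact_cube: "compact cube" by (simp add: cube_def compact_cbox)

lemma integral_lattice_char:
  fixes x :: "int ^ 'd"
  shows "(LINT \<xi>:cube|lborel. lattice_char x \<xi> 0) = (if x = 0 then of_real ((2 * pi) ^ CARD('d)) else 0)"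
proof -
  define g :: "real ^ 'd \<Rightarrow> real \<Rightarrow> complex" where
    "g b u = indicator {- pi..pi} u *\<^sub>R exp (\<i> * of_real ((real_vec x \<bullet> b) * u))" for b u
  have ig: "integrable lborel (g b)" for b
    unfolding g_def by (intro borel_integrable_compact) (auto intro!: continuous_intros)
  have "indicator cube \<xi> *\<^sub>R lattice_char x \<xi> 0 = (\<Prod>b\<in>Basis. g b (\<xi> \<bullet> b))" for \<xi> :: "real ^ 'd"
  proof -
    have "(\<Prod>b\<in>Basis. g b (\<xi> \<bullet> b)) = (\<Prod>i\<in>UNIV. of_real (indicator {- pi..pi} (\<xi> $ i)) *
       exp (\<i> * of_real (real_of_int (x $ i) * \<xi> $ i)))"
      unfolding g_def prod_Basis_vec by (simp add: inner_axis real_vec_def scaleR_conv_of_real)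
    also have "\<dots> = of_real (\<Prod>i\<in>UNIV. indicator {- pi..pi} (\<xi> $ i)) *
       exp (\<Sum>i\<in>UNIV. \<i> * of_real (real_of_int (x $ i) * \<xi> $ i))"
      by (simp add: prod.distrib exp_sum)
    also have "(\<Prod>i\<in>UNIV. indicator {- pi..pi} (\<xi> $ i)) = (indicator cube \<xi> :: real)"
    proof (cases "\<xi> \<in> cube")
      case True
      then have "indicator {- pi..pi} (\<xi> $ i) = (1 :: real)" for i
        by (simp add: cube_def mem_box_cart)
      then show ?thesis using True by simp
    next
      case False
      then obtain i where "\<xi> $ i \<notin> {- pi..pi}" by (auto simp: cube_def mem_box_cart)
      then have "(\<Prod>i\<in>UNIV. indicator {- pi..pi} (\<xi> $ i)) = (0 :: real)" by (intro prod_zero) (auto intro!: exI[of _ i])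
      then show ?thesis using False by simp
    qed
    also have "(\<Sum>i\<in>UNIV. \<i> * of_real (real_of_int (x $ i) * \<xi> $ i)) = Complex 0 (real_vec x \<bullet> \<xi>)"
      by (simp add: Complex_eq inner_vec_def real_vec_def sum_distrib_left)
    finally show ?thesis by (simp add: lattice_char_def scaleR_conv_of_real)
  qed
  then have "(LINT \<xi>:cube|lborel. lattice_char x \<xi> 0) = (\<Prod>b\<in>Basis. \<integral>u. g b u \<partial>lborel)"
    unfolding set_lebesgue_integral_def using integral_lborel_prod[OF ig] by simp
  also have "\<dots> = (\<Prod>i\<in>UNIV. if x $ i = 0 then of_real (2 * pi) else 0)"
    unfolding prod_Basis_vec g_def
    by (intro prod.cong refl) (simp add: inner_axis real_vec_def integral_exp_int del: of_real_mult)
  also have "\<dots> = (if x = 0 then of_real ((2 * pi) ^ CARD('d)) else 0)"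
  proof (cases "x = 0")
    case False
    then obtain i where "x $ i \<noteq> 0" by (auto simp: vec_eq_iff)
    then show ?thesis using False by (auto intro!: prod_zero)
  qed simp
  finally show ?thesis .
qed

inductive trig_poly :: "(real ^ 'd \<Rightarrow> real ^ 'd \<Rightarrow> complex) \<Rightarrow> bool" where
  monomial: "trig_poly (\<lambda>\<xi> \<nu>. c * lattice_char x \<xi> \<nu>)"
| add: "trig_poly f \<Longrightarrow> trig_poly g \<Longrightarrow> trig_poly (\<lambda>\<xi> \<nu>. f \<xi> \<nu> + g \<xi> \<nu>)"

lemma trig_poly_const: "trig_poly (\<lambda>\<xi> \<nu>. c)"
  using trig_poly.monomial[of c 0] by simp

lemma trig_poly_sum: "(\<And>i. i \<in> I \<Longrightarrow> trig_poly (f i)) \<Longrightarrow> trig_poly (\<lambda>\<xi> \<nu>. \<Sum>i\<in>I. f i \<xi> \<nu>)"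
  by (induction I rule: infinite_finite_induct) (auto intro: trig_poly_const trig_poly.add)

lemma trig_poly_mult:
  assumes "trig_poly f" "trig_poly g"
  shows "trig_poly (\<lambda>\<xi> \<nu>. f \<xi> \<nu> * g \<xi> \<nu>)"
  using assms
proof (induction f)
  case (monomial c x)
  show ?case using monomial
  proof (induction g)
    case (monomial e y)
    have "(\<lambda>\<xi> \<nu>. c * lattice_char x \<xi> \<nu> * (e * lattice_char y \<xi> \<nu>)) = (\<lambda>\<xi> \<nu>. (c * e) * lattice_char (x + y) \<xi> \<nu>)"
      by (simp add: lattice_char_add mult_ac)
    then show ?case by (simp only: trig_poly.monomial)
  next
    case (add f g)
    then show ?case by (simp add: distrib_left trig_poly.add)
  qed
next
  case (add f g)
  then show ?case by (simp add: distrib_right trig_poly.add)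
qed

lemma trig_poly_power: "trig_poly f \<Longrightarrow> trig_poly (\<lambda>\<xi> \<nu>. f \<xi> \<nu> ^ n)"
  by (induction n) (auto intro: trig_poly_const trig_poly_mult)

lemma trig_poly_diff:
  assumes "trig_poly f" "trig_poly g"
  shows "trig_poly (\<lambda>\<xi> \<nu>. f \<xi> \<nu> - g \<xi> \<nu>)"
  using trig_poly.add[OF assms(1) trig_poly_mult[OF trig_poly_const[of "-1"] assms(2)]] by simp

lemma continuous_on_lattice_char:
  "continuous_on A (\<lambda>z. lattice_char x (fst z) (snd z))"
  unfolding lattice_char_def Complex_eq by (intro continuous_intros)

lemma trig_poly_continuous: "trig_poly f \<Longrightarrow> continuous_on A (\<lambda>z. f (fst z) (snd z))"
  by (induction rule: trig_poly.induct) (intro continuous_intros continuous_on_lattice_char; assumption)+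

lemma trig_poly_continuous_fst: "trig_poly f \<Longrightarrow> continuous_on A (\<lambda>\<xi>. f \<xi> \<nu>)"
proof -
  assume f: "trig_poly f"
  have "continuous_on A (\<lambda>\<xi>. (\<xi>, \<nu>))"
    by (intro continuous_on_Pair continuous_on_const continuous_on_id)
  then show ?thesis using continuous_on_compose2[OF trig_poly_continuous[OF f, of UNIV]] by force
qed

lemma trig_poly_set_integrable:
  assumes "trig_poly f"
  shows "set_integrable lborel cube (\<lambda>\<xi>. f \<xi> \<nu> * lattice_char x \<xi> \<nu>)"
  unfolding set_integrable_def
  using trig_poly_continuous_fst[OF trig_poly_mult[OF assms trig_poly.monomial[of 1 x]]]
  by (intro borel_integrable_compact compact_cube) simp

text \<open>
  The Fourier coefficient is taken on the real torus, i.e. at \<open>\<nu> = 0\<close>, and without the normalizing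
  factor \<open>(2 * pi) ^ d\<close>.
\<close>
definition torus_coefficient :: "(real ^ 'd \<Rightarrow> real ^ 'd \<Rightarrow> complex) \<Rightarrow> int ^ 'd \<Rightarrow> complex" where
  "torus_coefficient f x = (LINT \<xi>:cube|lborel. f \<xi> 0 * lattice_char (- x) \<xi> 0)"

lemma torus_coefficient_sum:
  assumes "\<And>i. i \<in> I \<Longrightarrow> trig_poly (f i)"
  shows "torus_coefficient (\<lambda>\<xi> \<nu>. \<Sum>i\<in>I. f i \<xi> \<nu>) x = (\<Sum>i\<in>I. torus_coefficient (f i) x)"
  using trig_poly_set_integrable[OF assms]
  unfolding torus_coefficient_def set_lebesgue_integral_def set_integrable_def
    sum_distrib_right scaleR_sum_right
  by (intro Bochner_Integration.integral_sum) blast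

lemma torus_coefficient_add:
  assumes "trig_poly f" "trig_poly g"
  shows "torus_coefficient (\<lambda>\<xi> \<nu>. f \<xi> \<nu> + g \<xi> \<nu>) x = torus_coefficient f x + torus_coefficient g x"
  unfolding torus_coefficient_def distrib_right
  by (intro set_integral_add trig_poly_set_integrable assms)

lemma torus_coefficient_monomial:
  fixes x :: "int ^ 'd"
  shows "torus_coefficient (\<lambda>\<xi> \<nu>. c * lattice_char y \<xi> \<nu>) x
    = (if y = x then of_real ((2 * pi) ^ CARD('d)) * c else 0)"
proof -
  have eq: "c * lattice_char y \<xi> 0 * lattice_char (- x) \<xi> 0 = c * lattice_char (y - x) \<xi> 0" for \<xi>
    using lattice_char_add[of y "- x" \<xi> 0] by simp
  show ?thesis unfolding torus_coefficient_def eq by (simp add: integral_lattice_char)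
qed

text \<open>
  The contour of integration may be moved to any imaginary part \<open>\<nu>\<close>. For a single character this is
  orthogonality: the factor \<open>exp ((y - x) \<bullet> \<nu>)\<close> appears only where the integral vanishes, or is 1.
\<close>
lemma torus_coefficient_shift:
  assumes "trig_poly f"
  shows "torus_coefficient f x = (LINT \<xi>:cube|lborel. f \<xi> \<nu> * lattice_char (- x) \<xi> \<nu>)"
  using assms
proof (induction f)
  case (monomial c y)
  have eq: "c * lattice_char y \<xi> \<nu> * lattice_char (- x) \<xi> \<nu>
      = c * of_real (exp (real_vec (y - x) \<bullet> \<nu>)) * lattice_char (y - x) \<xi> 0" for \<xi>
    using lattice_char_add[of y "- x" \<xi> \<nu>] lattice_char_shift[of "y - x" \<xi> \<nu>] by simp
  show ?case unfolding torus_coefficient_monomial eq by (simp add: integral_lattice_char)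
next
  case (add f g)
  then show ?case
    by (simp add: torus_coefficient_add distrib_right set_integral_add trig_poly_set_integrable)
qed

section \<open>Convolution powers as Fourier coefficients\<close>

definition supp :: "('a \<Rightarrow> complex) \<Rightarrow> 'a set" where "supp \<psi> = {x. \<psi> x \<noteq> 0}"

text \<open>
  The Fourier transform of a finitely supported function, extended to complex frequencies. The sum is
  taken over the support, so it has its meaning only if that is finite.
\<close>
definition exp_poly :: "(int ^ 'd \<Rightarrow> complex) \<Rightarrow> real ^ 'd \<Rightarrow> real ^ 'd \<Rightarrow> complex" where
  "exp_poly \<psi> \<xi> \<nu> = (\<Sum>x\<in>supp \<psi>. \<psi> x * lattice_char x \<xi> \<nu>)"

lemma exp_poly_superset:
  assumes "finite A" "supp \<psi> \<subseteq> A"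
  shows "exp_poly \<psi> \<xi> \<nu> = (\<Sum>x\<in>A. \<psi> x * lattice_char x \<xi> \<nu>)"
  unfolding exp_poly_def by (rule sum.mono_neutral_left) (use assms in \<open>auto simp: supp_def\<close>)

lemma trig_poly_exp_poly: "trig_poly (exp_poly \<psi>)"
proof -
  have "exp_poly \<psi> = (\<lambda>\<xi> \<nu>. \<Sum>x\<in>supp \<psi>. \<psi> x * lattice_char x \<xi> \<nu>)"
    by (simp add: exp_poly_def fun_eq_iff)
  then show ?thesis by (simp only: trig_poly_sum trig_poly.monomial)
qed

lemma exp_poly_zero_shift:
  assumes "finite (supp \<psi>)"
  shows "exp_poly \<psi> \<xi> 0 = fourier \<psi> \<xi>"
proof -
  have "fourier \<psi> \<xi> = (\<Sum>\<^sub>\<infinity>x\<in>supp \<psi>. \<psi> x * exp (\<i> * complex_of_real (real_vec x \<bullet> \<xi>)))"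
    unfolding fourier_def by (rule infsum_cong_neutral) (auto simp: supp_def)
  then show ?thesis
    using assms by (simp add: exp_poly_def lattice_char_def Complex_eq)
qed

lemma conv_finite:
  assumes "finite (supp \<phi>)"
  shows "conv \<psi> \<phi> x = (\<Sum>y\<in>supp \<phi>. \<psi> (x - y) * \<phi> y)"
proof -
  have "conv \<psi> \<phi> x = (\<Sum>\<^sub>\<infinity>y\<in>supp \<phi>. \<psi> (x - y) * \<phi> y)"
    unfolding conv_def by (rule infsum_cong_neutral) (auto simp: supp_def)
  then show ?thesis using assms by simp
qed

lemma supp_conv:
  assumes "finite (supp \<phi>)"
  shows "supp (conv \<psi> \<phi>) \<subseteq> (\<lambda>(x, y). x + y) ` (supp \<psi> \<times> supp \<phi>)"
proof
  fix x assume "x \<in> supp (conv \<psi> \<phi>)"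
  then have "(\<Sum>y\<in>supp \<phi>. \<psi> (x - y) * \<phi> y) \<noteq> 0" by (simp add: supp_def conv_finite[OF assms])
  then obtain y where "y \<in> supp \<phi>" "\<psi> (x - y) * \<phi> y \<noteq> 0" by (metis (mono_tags, lifting) sum.neutral)
  then have "(x - y, y) \<in> supp \<psi> \<times> supp \<phi>" by (simp add: supp_def)
  then show "x \<in> (\<lambda>(x, y). x + y) ` (supp \<psi> \<times> supp \<phi>)" by force
qed

lemma exp_poly_conv:
  assumes fin: "finite (supp \<phi>)" "finite (supp \<psi>)"
  shows "exp_poly (conv \<psi> \<phi>) \<xi> \<nu> = exp_poly \<psi> \<xi> \<nu> * exp_poly \<phi> \<xi> \<nu>"
proof -
  define D where "D = (\<lambda>(x, y). x + y) ` (supp \<psi> \<times> supp \<phi>)"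
  have D: "finite D" unfolding D_def using assms by simp
  have inner: "(\<Sum>x\<in>D. \<psi> (x - y) * lattice_char x \<xi> \<nu>) = exp_poly \<psi> \<xi> \<nu> * lattice_char y \<xi> \<nu>"
    if y: "y \<in> supp \<phi>" for y
  proof -
    have "(\<Sum>x\<in>D. \<psi> (x - y) * lattice_char x \<xi> \<nu>) = (\<Sum>x\<in>(\<lambda>z. z + y) ` supp \<psi>. \<psi> (x - y) * lattice_char x \<xi> \<nu>)"
    proof (rule sum.mono_neutral_right[OF D])
      show "(\<lambda>z. z + y) ` supp \<psi> \<subseteq> D" unfolding D_def using y by force
      show "\<forall>x\<in>D - (\<lambda>z. z + y) ` supp \<psi>. \<psi> (x - y) * lattice_char x \<xi> \<nu> = 0"
      proof
        fix x assume "x \<in> D - (\<lambda>z. z + y) ` supp \<psi>"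
        then have "x - y \<notin> supp \<psi>" by force
        then show "\<psi> (x - y) * lattice_char x \<xi> \<nu> = 0" by (simp add: supp_def)
      qed
    qed
    also have "\<dots> = (\<Sum>z\<in>supp \<psi>. \<psi> z * lattice_char (z + y) \<xi> \<nu>)"
      by (subst sum.reindex) (auto simp: inj_on_def)
    finally show ?thesis by (simp add: exp_poly_def lattice_char_add sum_distrib_right mult.assoc)
  qed
  have "exp_poly (conv \<psi> \<phi>) \<xi> \<nu> = (\<Sum>x\<in>D. \<Sum>y\<in>supp \<phi>. \<psi> (x - y) * \<phi> y * lattice_char x \<xi> \<nu>)"
    using exp_poly_superset[OF D supp_conv[OF fin(1), of \<psi>, folded D_def]]
    by (simp add: conv_finite[OF fin(1)] sum_distrib_right)
  also have "\<dots> = (\<Sum>y\<in>supp \<phi>. \<phi> y * (\<Sum>x\<in>D. \<psi> (x - y) * lattice_char x \<xi> \<nu>))"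
    by (subst sum.swap) (simp add: sum_distrib_left mult_ac)
  also have "\<dots> = exp_poly \<psi> \<xi> \<nu> * exp_poly \<phi> \<xi> \<nu>"
  proof -
    have "(\<Sum>y\<in>supp \<phi>. \<phi> y * (\<Sum>x\<in>D. \<psi> (x - y) * lattice_char x \<xi> \<nu>))
      = (\<Sum>y\<in>supp \<phi>. \<phi> y * (exp_poly \<psi> \<xi> \<nu> * lattice_char y \<xi> \<nu>))"
      by (intro sum.cong refl) (simp add: inner)
    then show ?thesis by (simp add: exp_poly_def[of \<phi>] sum_distrib_left mult_ac)
  qed
  finally show ?thesis .
qed

lemma conv_power_Suc: "n \<ge> 1 \<Longrightarrow> conv_power \<phi> (Suc n) = conv (conv_power \<phi> n) \<phi>"
  by (cases n) auto

lemma exp_poly_conv_power: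
  fixes \<phi> :: "int ^ 'd \<Rightarrow> complex"
  assumes fin: "finite (supp \<phi>)" and B: "\<And>x. x \<in> supp \<phi> \<Longrightarrow> norm (real_vec x) \<le> B" and n: "n \<ge> 1"
  shows "finite (supp (conv_power \<phi> n))"
    and "\<And>x. x \<in> supp (conv_power \<phi> n) \<Longrightarrow> norm (real_vec x) \<le> real n * B"
    and "exp_poly (conv_power \<phi> n) \<xi> \<nu> = exp_poly \<phi> \<xi> \<nu> ^ n"
proof -
  have "finite (supp (conv_power \<phi> n)) \<and> (\<forall>x\<in>supp (conv_power \<phi> n). norm (real_vec x) \<le> real n * B)
    \<and> exp_poly (conv_power \<phi> n) \<xi> \<nu> = exp_poly \<phi> \<xi> \<nu> ^ n"
    using n
  proof (induction n rule: dec_induct)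
    case base
    then show ?case using fin B by simp
  next
    case (step n)
    have sub: "supp (conv_power \<phi> (Suc n)) \<subseteq> (\<lambda>(x, y). x + y) ` (supp (conv_power \<phi> n) \<times> supp \<phi>)"
      using supp_conv[OF fin] step(1) by (simp add: conv_power_Suc)
    have "finite (supp (conv_power \<phi> (Suc n)))"
      using sub by (rule finite_subset) (use step fin in auto)
    moreover have "norm (real_vec x) \<le> real (Suc n) * B" if x: "x \<in> supp (conv_power \<phi> (Suc n))" for x
    proof -
      obtain y z where yz: "x = y + z" "y \<in> supp (conv_power \<phi> n)" "z \<in> supp \<phi>"
        using subsetD[OF sub x] by auto
      have "norm (real_vec x) \<le> norm (real_vec y) + norm (real_vec z)"
        using yz(1) by (simp add: norm_triangle_ineq)
      also have "\<dots> \<le> real n * B + B" using step.IH B yz by (intro add_mono) auto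
      finally show ?thesis by (simp add: algebra_simps)
    qed
    moreover have "exp_poly (conv_power \<phi> (Suc n)) \<xi> \<nu> = exp_poly \<phi> \<xi> \<nu> ^ Suc n"
      using step exp_poly_conv[OF fin, of "conv_power \<phi> n"] by (simp add: conv_power_Suc mult.commute)
    ultimately show ?case by blast
  qed
  then show "finite (supp (conv_power \<phi> n))"
    "\<And>x. x \<in> supp (conv_power \<phi> n) \<Longrightarrow> norm (real_vec x) \<le> real n * B"
    "exp_poly (conv_power \<phi> n) \<xi> \<nu> = exp_poly \<phi> \<xi> \<nu> ^ n" by auto
qed

lemma fourier_inversion:
  fixes \<psi> :: "int ^ 'd \<Rightarrow> complex"
  assumes "finite (supp \<psi>)"
  shows "torus_coefficient (exp_poly \<psi>) x = of_real ((2 * pi) ^ CARD('d)) * \<psi> x"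
proof -
  have "exp_poly \<psi> = (\<lambda>\<xi> \<nu>. \<Sum>y\<in>supp \<psi>. \<psi> y * lattice_char y \<xi> \<nu>)"
    by (simp add: exp_poly_def fun_eq_iff)
  then have "torus_coefficient (exp_poly \<psi>) x
    = (\<Sum>y\<in>supp \<psi>. torus_coefficient (\<lambda>\<xi> \<nu>. \<psi> y * lattice_char y \<xi> \<nu>) x)"
    by (simp only: torus_coefficient_sum trig_poly.monomial)
  also have "\<dots> = of_real ((2 * pi) ^ CARD('d)) * \<psi> x"
    using assms by (auto simp: torus_coefficient_monomial supp_def)
  finally show ?thesis .
qed

lemma norm_lattice_char: "norm (lattice_char x \<xi> \<nu>) = exp (real_vec x \<bullet> \<nu>)"
  by (simp add: lattice_char_def)

lemma torus_coefficient_bound: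
  assumes "trig_poly f"
  shows "ennreal (norm (torus_coefficient f x))
    \<le> ennreal (exp (- (real_vec x \<bullet> \<nu>))) * (\<integral>\<^sup>+\<xi>\<in>cube. ennreal (norm (f \<xi> \<nu>)) \<partial>lborel)"
proof -
  have "ennreal (norm (torus_coefficient f x))
    = ennreal (norm (LINT \<xi>:cube|lborel. f \<xi> \<nu> * lattice_char (- x) \<xi> \<nu>))"
    by (simp only: torus_coefficient_shift[OF assms, of x \<nu>])
  also have "\<dots> \<le> (\<integral>\<^sup>+\<xi>. norm (indicator cube \<xi> *\<^sub>R (f \<xi> \<nu> * lattice_char (- x) \<xi> \<nu>)) \<partial>lborel)"
    unfolding set_lebesgue_integral_def
    using trig_poly_set_integrable[OF assms, of \<nu> "-x"]
    by (intro integral_norm_bound_ennreal) (simp add: set_integrable_def)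
  also have "\<dots> = (\<integral>\<^sup>+\<xi>. ennreal (exp (- (real_vec x \<bullet> \<nu>))) * (ennreal (norm (f \<xi> \<nu>)) * indicator cube \<xi>) \<partial>lborel)"
    by (intro nn_integral_cong)
       (auto simp: norm_mult norm_lattice_char ennreal_mult mult_ac split: split_indicator)
  also have "\<dots> = ennreal (exp (- (real_vec x \<bullet> \<nu>))) * (\<integral>\<^sup>+\<xi>\<in>cube. ennreal (norm (f \<xi> \<nu>)) \<partial>lborel)"
  proof (rule nn_integral_cmult)
    have "(\<lambda>\<xi>. f \<xi> \<nu>) \<in> borel_measurable borel"
      by (intro borel_measurable_continuous_onI trig_poly_continuous_fst assms)
    then show "(\<lambda>\<xi>. ennreal (norm (f \<xi> \<nu>)) * indicator cube \<xi>) \<in> borel_measurable lborel"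
      using borel_compact[OF compact_cube] by measurable
  qed
  finally show ?thesis .
qed

section \<open>Polynomial cutoffs\<close>

text \<open>
  For \<open>q \<in> [0, 1]\<close> this is the probability of at least \<open>n\<close> successes in \<open>2 * n\<close> trials of success
  probability \<open>q\<close>. As \<open>n\<close> grows it is exponentially close to 0 near \<open>q = 0\<close> and to 1 near \<open>q = 1\<close>; being
  a polynomial in \<open>q\<close>, it turns a trigonometric polynomial that separates points into a cutoff that is
  again a trigonometric polynomial.
\<close>
definition upper_binomial_tail :: "nat \<Rightarrow> complex \<Rightarrow> complex" where
  "upper_binomial_tail n q = (\<Sum>j=n..2*n. of_nat ((2 * n) choose j) * q ^ j * (1 - q) ^ (2 * n - j))"

text \<open>
  A Chernoff bound: the terms with \<open>j \<ge> n\<close> are weighted by \<open>s ^ (j - n) \<ge> 1\<close>, and the binomial theorem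
  sums them.
\<close>
lemma binomial_part_bound:
  fixes a b s :: real
  assumes "A \<subseteq> {..m}" "a \<ge> 0" "b \<ge> 0" "s \<ge> 1" "\<And>j. j \<in> A \<Longrightarrow> j \<ge> n"
  shows "s ^ n * (\<Sum>j\<in>A. real (m choose j) * a ^ j * b ^ (m - j)) \<le> (s * a + b) ^ m"
proof -
  have "s ^ n * (\<Sum>j\<in>A. real (m choose j) * a ^ j * b ^ (m - j))
      \<le> (\<Sum>j\<in>A. s ^ j * (real (m choose j) * a ^ j * b ^ (m - j)))"
    unfolding sum_distrib_left
    using assms by (intro sum_mono mult_right_mono power_increasing) auto
  also have "\<dots> \<le> (\<Sum>j\<le>m. s ^ j * (real (m choose j) * a ^ j * b ^ (m - j)))"
    using assms by (intro sum_mono2) auto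
  also have "\<dots> = (s * a + b) ^ m"
    by (simp add: binomial_ring power_mult_distrib mult_ac)
  finally show ?thesis .
qed

lemma norm_upper_binomial_tail:
  assumes "s \<ge> 1"
  shows "s ^ n * norm (upper_binomial_tail n q) \<le> (s * norm q + norm (1 - q)) ^ (2 * n)"
proof -
  have "norm (upper_binomial_tail n q) \<le> (\<Sum>j=n..2*n. real ((2 * n) choose j) * norm q ^ j * norm (1 - q) ^ (2 * n - j))"
    unfolding upper_binomial_tail_def
    by (rule order_trans[OF norm_sum]) (simp add: norm_mult norm_power)
  then have "s ^ n * norm (upper_binomial_tail n q) \<le> s ^ n * (\<Sum>j=n..2*n. real ((2 * n) choose j) * norm q ^ j * norm (1 - q) ^ (2 * n - j))"
    using assms by (intro mult_left_mono) auto
  also have "\<dots> \<le> (s * norm q + norm (1 - q)) ^ (2 * n)"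
    using assms by (intro binomial_part_bound) auto
  finally show ?thesis .
qed

lemma norm_one_minus_upper_binomial_tail:
  assumes "s \<ge> 1"
  shows "s ^ n * norm (1 - upper_binomial_tail n q) \<le> (norm q + s * norm (1 - q)) ^ (2 * n)"
proof -
  have "1 = (q + (1 - q)) ^ (2 * n)" by simp
  also have "\<dots> = (\<Sum>j\<le>2*n. of_nat ((2 * n) choose j) * q ^ j * (1 - q) ^ (2 * n - j))"
    by (rule binomial_ring)
  also have "{..2 * n} = {..<n} \<union> {n..2*n}" by auto
  also have "(\<Sum>j\<in>{..<n} \<union> {n..2*n}. of_nat ((2 * n) choose j) * q ^ j * (1 - q) ^ (2 * n - j))
    = (\<Sum>j<n. of_nat ((2 * n) choose j) * q ^ j * (1 - q) ^ (2 * n - j)) + upper_binomial_tail n q"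
    unfolding upper_binomial_tail_def by (rule sum.union_disjoint) auto
  finally have "1 - upper_binomial_tail n q = (\<Sum>j<n. of_nat ((2 * n) choose j) * q ^ j * (1 - q) ^ (2 * n - j))"
    by (metis add_diff_cancel_right')
  also have "norm \<dots> \<le> (\<Sum>j<n. real ((2 * n) choose j) * norm q ^ j * norm (1 - q) ^ (2 * n - j))"
    by (rule order_trans[OF norm_sum]) (simp add: norm_mult norm_power)
  also have "\<dots> = (\<Sum>i\<in>(\<lambda>j. 2 * n - j) ` {..<n}. real ((2 * n) choose i) * norm (1 - q) ^ i * norm q ^ (2 * n - i))"
  proof (subst sum.reindex)
    show "inj_on (\<lambda>j. 2 * n - j) {..<n}" by (auto simp: inj_on_def)
    have "(2 * n) choose (2 * n - j) = (2 * n) choose j" if "j < n" for j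
      using that by (intro binomial_symmetric[symmetric]) simp
    then show "(\<Sum>j<n. real ((2 * n) choose j) * norm q ^ j * norm (1 - q) ^ (2 * n - j))
      = sum ((\<lambda>i. real ((2 * n) choose i) * norm (1 - q) ^ i * norm q ^ (2 * n - i)) \<circ> (\<lambda>j. 2 * n - j)) {..<n}"
      by (intro sum.cong refl) auto
  qed
  finally have "s ^ n * norm (1 - upper_binomial_tail n q) \<le> s ^ n * \<dots>"
    using assms by (intro mult_left_mono) auto
  also have "\<dots> \<le> (s * norm (1 - q) + norm q) ^ (2 * n)"
    using assms by (intro binomial_part_bound) auto
  finally show ?thesis by (simp add: add.commute)
qed

lemma upper_binomial_tail_near_0:
  assumes "norm q \<le> 1 / 16"
  shows "norm (upper_binomial_tail n q) \<le> (1 / 2) ^ n"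
proof -
  have "norm (1 - q) \<le> 17 / 16" using assms norm_triangle_ineq4[of 1 q] by simp
  \<comment> \<open>The weight \<open>s = 4\<close> turns \<open>norm q \<le> 1/16\<close> into \<open>(4/16 + 17/16)\<^sup>2 < 2\<close>, half of \<open>s\<close>.\<close>
  then have "(4 * norm q + norm (1 - q))\<^sup>2 \<le> (21 / 16)\<^sup>2" using assms by (intro power_mono) auto
  also have "\<dots> \<le> (2 :: real)" by (simp add: power2_eq_square)
  finally have "((4 * norm q + norm (1 - q))\<^sup>2) ^ n \<le> 2 ^ n" by (intro power_mono) auto
  then have "4 ^ n * norm (upper_binomial_tail n q) \<le> 2 ^ n"
    using norm_upper_binomial_tail[of 4 n q] by (simp add: power_mult)
  also have "(2 :: real) ^ n = 4 ^ n * (1 / 2) ^ n" by (simp flip: power_mult_distrib)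
  finally show ?thesis by simp
qed

lemma upper_binomial_tail_near_1:
  assumes "norm (1 - q) \<le> 1 / 16"
  shows "norm (1 - upper_binomial_tail n q) \<le> (1 / 2) ^ n"
proof -
  have "norm q \<le> 17 / 16" using assms norm_triangle_ineq2[of q 1] by (simp add: norm_minus_commute)
  then have "(norm q + 4 * norm (1 - q))\<^sup>2 \<le> (21 / 16)\<^sup>2" using assms by (intro power_mono) auto
  also have "\<dots> \<le> (2 :: real)" by (simp add: power2_eq_square)
  finally have "((norm q + 4 * norm (1 - q))\<^sup>2) ^ n \<le> 2 ^ n" by (intro power_mono) auto
  then have "4 ^ n * norm (1 - upper_binomial_tail n q) \<le> 2 ^ n"
    using norm_one_minus_upper_binomial_tail[of 4 n q] by (simp add: power_mult)
  also have "(2 :: real) ^ n = 4 ^ n * (1 / 2) ^ n" by (simp flip: power_mult_distrib)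
  finally show ?thesis by simp
qed

lemma norm_upper_binomial_tail_le: "norm (upper_binomial_tail n q) \<le> ((norm q + norm (1 - q))\<^sup>2) ^ n"
  using norm_upper_binomial_tail[of 1 n q] by (simp add: power_mult)

lemma trig_poly_upper_binomial_tail:
  assumes "trig_poly q"
  shows "trig_poly (\<lambda>\<xi> \<nu>. upper_binomial_tail n (q \<xi> \<nu>))"
  unfolding upper_binomial_tail_def
  by (intro trig_poly_sum trig_poly_mult trig_poly_power trig_poly_diff trig_poly_const assms)

section \<open>The Fourier transform near its maximum points\<close>

lemma Re_differentiable_of_polynomial_function:
  fixes P :: "'a::euclidean_space \<Rightarrow> complex"
  assumes "polynomial_function P"
  shows "(\<lambda>\<xi>. Re (P \<xi>)) differentiable (at x)"
proof -
  have "real_polynomial_function (Re \<circ> P)"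
    using assms bounded_linear_Re unfolding polynomial_function_def by blast
  then have "polynomial_function (Re \<circ> P)" by (simp add: real_polynomial_function_eq)
  then show ?thesis using differentiable_at_polynomial_function by (simp add: o_def)
qed

lemma pos_hom_polynomial_homogeneous_symbol:
  fixes P :: "real ^ 'd \<Rightarrow> complex"
  assumes "pos_hom_polynomial P"
  obtains T where "homogeneous_symbol_volume P T (hom_order P)"
proof -
  define E where "E = (SOME E. E \<in> Exp_set P)"
  have "E \<in> Exp_set P"
    unfolding E_def some_in_eq using assms unfolding pos_hom_polynomial_def by blast
  then have hom: "complex_of_real t * P \<xi> = P (matrix_dilation t E *v \<xi>)" if "t > 0" for t \<xi>
    using that by (simp add: Exp_set_def)
  have "homogeneous_symbol_volume P (\<lambda>t. (*v) (matrix_dilation t E)) (hom_order P)"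
  proof unfold_locales
    show "continuous_on UNIV P"
      using assms continuous_on_polymonial_function unfolding pos_hom_polynomial_def by blast
    show "measure lborel ((*v) (matrix_dilation t E) ` S) = t powr hom_order P * measure lborel S"
      if "t > 0" "compact S" for t and S :: "(real ^ 'd) set"
      using measure_matrix_dilation_image[OF that] by (simp add: hom_order_def E_def)
    show "P (matrix_dilation t E *v \<xi>) = complex_of_real t * P \<xi>" if "t > 0" for t \<xi>
      using hom[OF that] by simp
    show "0 \<le> Re (P \<xi>)" "Re (P \<xi>) = 0 \<Longrightarrow> \<xi> = 0" for \<xi>
      using assms unfolding pos_hom_polynomial_def by blast+
  qed (simp_all add: matrix_vector_right_distrib matrix_vector_mult_scaleR)
  then show ?thesis by (rule that)
qed

text \<open>
  Dividing by the value at \<open>\<omega>\<close> and by the drift factor makes the Fourier transform an exponential sum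
  \<open>G\<close> with frequencies \<open>x - \<alpha>\<close> and \<open>G 0 = 1\<close>. Exponentiating the expansion of the logarithm gives
  \<open>G = exp (- P + \<Upsilon>) = 1 - P + o(R)\<close> on real points, since \<open>norm P \<le> C * R\<close> makes the quadratic terms
  negligible; the complex shift bound then applies.
\<close>
lemma exp_poly_pos_hom_type_shift_bound:
  fixes \<phi> :: "int ^ 'd \<Rightarrow> complex"
  assumes fin: "finite (supp \<phi>)"
    and type: "pos_hom_type_with (fourier \<phi>) \<omega> \<alpha> P"
    and unit: "norm (fourier \<phi> \<omega>) = 1"
  shows "\<exists>r>0. \<exists>\<epsilon>>0. \<exists>M>0. \<forall>\<xi> \<nu>. norm \<xi> < r \<longrightarrow> norm \<nu> < r \<longrightarrow>
    norm (exp_poly \<phi> (\<omega> + \<xi>) \<nu>) \<le> exp (\<alpha> \<bullet> \<nu> - \<epsilon> * Re (P \<xi>) + M * Re (P \<nu>))"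
proof -
  have php: "pos_hom_polynomial P" using type by (simp add: pos_hom_type_with_def)
  obtain T where "homogeneous_symbol_volume P T (hom_order P)"
    using pos_hom_polynomial_homogeneous_symbol[OF php] by blast
  then interpret homogeneous_symbol_volume P T "hom_order P" .
  define f\<omega> where "f\<omega> = fourier \<phi> \<omega>"
  have f\<omega>: "f\<omega> \<noteq> 0" using unit by (auto simp: f\<omega>_def)
  define G where "G \<xi> \<nu> = (\<Sum>x\<in>supp \<phi>. (\<phi> x * lattice_char x \<omega> 0 / f\<omega>) *
    exp (Complex ((real_vec x - \<alpha>) \<bullet> \<nu>) ((real_vec x - \<alpha>) \<bullet> \<xi>)))" for \<xi> \<nu>
  have G_eq: "G \<xi> \<nu> = exp_poly \<phi> (\<omega> + \<xi>) \<nu> / f\<omega> * exp (- Complex (\<alpha> \<bullet> \<nu>) (\<alpha> \<bullet> \<xi>))" for \<xi> \<nu>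
  proof -
    have "exp (Complex ((real_vec x - \<alpha>) \<bullet> \<nu>) ((real_vec x - \<alpha>) \<bullet> \<xi>))
      = lattice_char x \<xi> \<nu> * exp (- Complex (\<alpha> \<bullet> \<nu>) (\<alpha> \<bullet> \<xi>))" for x
      by (simp add: lattice_char_def inner_diff_left complex_diff flip: exp_add)
    moreover have "lattice_char x \<omega> 0 * lattice_char x \<xi> \<nu> = lattice_char x (\<omega> + \<xi>) \<nu>" for x
      by (simp add: lattice_char_def inner_add_right complex_add flip: exp_add)
    ultimately show ?thesis
      unfolding G_def exp_poly_def sum_divide_distrib sum_distrib_right
      by (intro sum.cong refl) (simp add: field_simps)
  qed
  have G00: "G 0 0 = 1"
    using f\<omega> exp_poly_zero_shift[OF fin, of \<omega>] by (simp add: G_eq f\<omega>_def zero_complex.code[symmetric])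
  obtain \<Upsilon> where log: "\<forall>\<^sub>F \<xi> in nhds 0. Gamma_log (fourier \<phi>) \<omega> \<xi> = \<i> * complex_of_real (\<alpha> \<bullet> \<xi>) - P \<xi> + \<Upsilon> \<xi>"
    and little: "\<Upsilon> \<in> o[at 0](\<lambda>\<xi>. complex_of_real (Re (P \<xi>)))"
    using type unfolding pos_hom_type_with_def by blast
  have "\<exists>C>0. \<forall>\<xi> \<nu>. \<bar>(\<lambda>z. norm (P (fst z))) (\<xi>, \<nu>)\<bar> \<le> C * (R \<xi> + R \<nu>)"
  proof (rule homogeneous_le)
    show "continuous_on UNIV (\<lambda>z :: (real ^ 'd) \<times> (real ^ 'd). norm (P (fst z)))"
      by (intro continuous_on_norm continuous_on_compose2[OF cont] continuous_on_fst continuous_on_id) auto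
  qed (simp add: hom norm_mult)
  then obtain C where C: "C > 0" "\<And>\<xi>. norm (P \<xi>) \<le> C * R \<xi>"
    by (metis P_zero abs_norm_cancel add.right_neutral fst_conv zero_complex.simps(1))
  have R0: "(R \<longlongrightarrow> 0) (at 0)"
  proof -
    have "isCont R 0" using R_continuous[of UNIV] by (simp only: continuous_on_eq_continuous_at open_UNIV UNIV_I)
    then have "(R \<longlongrightarrow> R 0) (at 0)" unfolding isCont_def .
    then show ?thesis by simp
  qed
  have nz: "\<forall>\<^sub>F \<xi> in at 0. fourier \<phi> (\<xi> + \<omega>) \<noteq> 0"
  proof -
    have "continuous_on UNIV (\<lambda>\<xi>. exp_poly \<phi> (\<xi> + \<omega>) 0)"
      by (intro continuous_on_compose2[OF trig_poly_continuous_fst[OF trig_poly_exp_poly, of UNIV]] continuous_intros) auto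
    then have "isCont (\<lambda>\<xi>. exp_poly \<phi> (\<xi> + \<omega>) 0) 0"
      by (simp only: continuous_on_eq_continuous_at open_UNIV UNIV_I)
    then have "((\<lambda>\<xi>. fourier \<phi> (\<xi> + \<omega>)) \<longlongrightarrow> f\<omega>) (at 0)"
      by (simp add: isCont_def exp_poly_zero_shift[OF fin] f\<omega>_def)
    then show ?thesis using f\<omega> by (rule tendsto_imp_eventually_ne)
  qed
  have small: "\<forall>\<^sub>F \<xi> in nhds 0. norm (G \<xi> 0 - 1 + P \<xi>) \<le> \<delta> * R \<xi>" if d: "\<delta> > 0" for \<delta>
  proof -
    define \<delta>' where "\<delta>' = min 1 (\<delta> / 2)"
    have d': "\<delta>' > 0" using d by (simp add: \<delta>'_def)
    have U: "\<forall>\<^sub>F \<xi> in at 0. norm (\<Upsilon> \<xi>) \<le> \<delta>' * R \<xi>"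
      using landau_o.smallD[OF little d'] nonneg by simp
    have r1: "\<forall>\<^sub>F \<xi> in at 0. R \<xi> < \<delta> / (6 * (C + 1)\<^sup>2)"
      using R0 d C(1) by (intro order_tendstoD(2)) auto
    have r2: "\<forall>\<^sub>F \<xi> in at 0. R \<xi> < 1 / (C + 1)"
      using R0 C(1) by (intro order_tendstoD(2)) auto
    have log': "\<forall>\<^sub>F \<xi> in at 0. Gamma_log (fourier \<phi>) \<omega> \<xi> = \<i> * complex_of_real (\<alpha> \<bullet> \<xi>) - P \<xi> + \<Upsilon> \<xi>"
      using log by (simp add: eventually_nhds_conv_at)
    have "\<forall>\<^sub>F \<xi> in at 0. norm (G \<xi> 0 - 1 + P \<xi>) \<le> \<delta> * R \<xi>"
      using U r1 r2 log' nz
    proof eventually_elim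
      case (elim \<xi>)
      define u where "u = \<Upsilon> \<xi> - P \<xi>"
      have "fourier \<phi> (\<xi> + \<omega>) / f\<omega> = exp (\<i> * complex_of_real (\<alpha> \<bullet> \<xi>) - P \<xi> + \<Upsilon> \<xi>)"
        using elim(4,5) f\<omega> by (metis Gamma_log_def divide_eq_0_iff exp_Ln f\<omega>_def)
      then have "G \<xi> 0 = exp (\<i> * complex_of_real (\<alpha> \<bullet> \<xi>) - P \<xi> + \<Upsilon> \<xi>) * exp (- Complex 0 (\<alpha> \<bullet> \<xi>))"
        unfolding G_eq by (simp add: exp_poly_zero_shift[OF fin] add.commute)
      also have "\<dots> = exp u" by (simp add: u_def Complex_eq flip: exp_add)
      finally have Gu: "G \<xi> 0 = exp u" .
      have "norm (\<Upsilon> \<xi>) \<le> 1 * R \<xi>"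
        using elim(1) by (rule order_trans) (intro mult_right_mono nonneg, simp add: \<delta>'_def)
      then have nu: "norm u \<le> (C + 1) * R \<xi>"
        using C(2)[of \<xi>] norm_triangle_ineq4[of "\<Upsilon> \<xi>" "P \<xi>"] by (simp add: u_def distrib_right)
      have "(C + 1) * R \<xi> \<le> 1" using elim(3) C(1) by (simp add: pos_less_divide_eq mult.commute)
      then have u1: "norm u \<le> 1" using nu by linarith
      \<comment> \<open>The thresholds on \<open>R \<xi>\<close> give \<open>norm u \<le> 1\<close> and make \<open>3 * (norm u)\<^sup>2\<close> at most \<open>\<delta> / 2 * R \<xi>\<close>.\<close>
      have "norm (exp u - (1 + u)) \<le> exp \<bar>Re u\<bar> * (norm u)\<^sup>2"
        using Taylor_exp[of u 1] by (simp add: numeral_2_eq_2)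
      also have "\<dots> \<le> 3 * ((C + 1) * R \<xi>)\<^sup>2"
      proof (intro mult_mono power_mono nu)
        have "exp \<bar>Re u\<bar> \<le> exp 1" using u1 abs_Re_le_cmod[of u] by simp
        then show "exp \<bar>Re u\<bar> \<le> 3" using exp_le by linarith
      qed auto
      also have "\<dots> = 3 * (C + 1)\<^sup>2 * R \<xi> * R \<xi>" by (simp add: power2_eq_square)
      also have "\<dots> \<le> \<delta> / 2 * R \<xi>"
      proof (intro mult_right_mono nonneg)
        have "(6 * (C + 1)\<^sup>2) * R \<xi> \<le> (6 * (C + 1)\<^sup>2) * (\<delta> / (6 * (C + 1)\<^sup>2))"
          using elim(2) by (intro mult_left_mono) auto
        also have "\<dots> = \<delta>" using C(1) by simp
        finally show "3 * (C + 1)\<^sup>2 * R \<xi> \<le> \<delta> / 2" by simp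
      qed
      finally have e1: "norm (exp u - (1 + u)) \<le> \<delta> / 2 * R \<xi>" .
      have e2: "norm (\<Upsilon> \<xi>) \<le> \<delta> / 2 * R \<xi>"
        using elim(1) by (rule order_trans) (intro mult_right_mono nonneg, simp add: \<delta>'_def)
      have "G \<xi> 0 - 1 + P \<xi> = (exp u - (1 + u)) + \<Upsilon> \<xi>" by (simp add: Gu u_def)
      also have "norm \<dots> \<le> \<delta> / 2 * R \<xi> + \<delta> / 2 * R \<xi>" by (rule norm_triangle_mono[OF e1 e2])
      finally show ?case by (simp add: distrib_right[symmetric])
    qed
    then show ?thesis by (simp add: eventually_nhds_conv_at G00)
  qed
  obtain r \<epsilon> M where rem: "r > 0" "\<epsilon> > 0" "M > 0"
    "\<And>\<xi> \<nu>. norm \<xi> < r \<Longrightarrow> norm \<nu> < r \<Longrightarrow> norm (G \<xi> \<nu>) \<le> exp (- \<epsilon> * R \<xi> + M * R \<nu>)"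
    using complex_shift_bound[OF fin, of G, OF G_def small] by blast
  have "norm (exp_poly \<phi> (\<omega> + \<xi>) \<nu>) \<le> exp (\<alpha> \<bullet> \<nu> - \<epsilon> * R \<xi> + M * R \<nu>)"
    if "norm \<xi> < r" "norm \<nu> < r" for \<xi> \<nu>
  proof -
    have "norm (G \<xi> \<nu>) = norm (exp_poly \<phi> (\<omega> + \<xi>) \<nu>) * exp (- (\<alpha> \<bullet> \<nu>))"
      using unit by (simp add: G_eq norm_mult norm_divide f\<omega>_def)
    then have "norm (exp_poly \<phi> (\<omega> + \<xi>) \<nu>) = norm (G \<xi> \<nu>) * exp (\<alpha> \<bullet> \<nu>)"
      by (simp add: exp_minus field_simps)
    also have "\<dots> \<le> exp (- \<epsilon> * R \<xi> + M * R \<nu>) * exp (\<alpha> \<bullet> \<nu>)"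
      using rem(4)[OF that] by (intro mult_right_mono) auto
    also have "\<dots> = exp (\<alpha> \<bullet> \<nu> - \<epsilon> * R \<xi> + M * R \<nu>)" by (simp flip: exp_add)
    finally show ?thesis .
  qed
  then show ?thesis using rem(1-3) by blast
qed

section \<open>Localization by trigonometric polynomials\<close>

definition lattice_equiv :: "real ^ 'd \<Rightarrow> real ^ 'd \<Rightarrow> bool" where
  "lattice_equiv p q \<longleftrightarrow> (\<exists>k. p = q + (2 * pi) *\<^sub>R real_vec k)"

lemma lattice_char_periodic: "lattice_char x (\<xi> + (2 * pi) *\<^sub>R real_vec k) \<nu> = lattice_char x \<xi> \<nu>"
proof -
  define m where "m = (\<Sum>i\<in>UNIV. x $ i * k $ i)"
  have "real_vec x \<bullet> real_vec k = real_of_int m"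
    by (simp add: inner_vec_def real_vec_def m_def)
  then have "Complex (real_vec x \<bullet> \<nu>) (real_vec x \<bullet> (\<xi> + (2 * pi) *\<^sub>R real_vec k))
    = Complex (real_vec x \<bullet> \<nu>) (real_vec x \<bullet> \<xi>) + 2 * of_int m * pi * \<i>"
    by (simp add: complex_eq_iff inner_add_right)
  moreover have "exp (2 * of_int m * pi * \<i>) = 1" by (rule exp_integer_2pi) auto
  ultimately show ?thesis by (simp add: lattice_char_def exp_add)
qed

lemma trig_poly_lattice_equiv:
  assumes "trig_poly f" "lattice_equiv p q"
  shows "f (p + \<xi>) \<nu> = f (q + \<xi>) \<nu>"
proof -
  obtain k where k: "p + \<xi> = q + \<xi> + (2 * pi) *\<^sub>R real_vec k"
    using assms(2) by (auto simp: lattice_equiv_def)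
  show ?thesis
    using assms(1) unfolding k by induction (simp_all only: lattice_char_periodic)
qed

lemma lattice_equiv_torus:
  fixes p :: "real ^ 'd"
  shows "\<exists>\<omega>\<in>torus. lattice_equiv p \<omega>"
proof -
  define k :: "int ^ 'd" where "k = (\<chi> i. \<lceil>(p $ i - pi) / (2 * pi)\<rceil>)"
  define \<omega> where "\<omega> = p - (2 * pi) *\<^sub>R real_vec k"
  have "- pi < \<omega> $ i \<and> \<omega> $ i \<le> pi" for i
  proof -
    have "(p $ i - pi) / (2 * pi) \<le> real_of_int (k $ i)" "real_of_int (k $ i) < (p $ i - pi) / (2 * pi) + 1"
      unfolding k_def by (simp, linarith?)+
    then have "(2 * pi) * ((p $ i - pi) / (2 * pi)) \<le> (2 * pi) * real_of_int (k $ i)"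
      "(2 * pi) * real_of_int (k $ i) < (2 * pi) * ((p $ i - pi) / (2 * pi) + 1)"
      by (intro mult_left_mono mult_strict_left_mono; simp)+
    moreover have "(2 * pi) * ((p $ i - pi) / (2 * pi)) = p $ i - pi" by simp
    moreover have "\<omega> $ i = p $ i - (2 * pi) * real_of_int (k $ i)" by (simp add: \<omega>_def real_vec_def)
    ultimately show ?thesis unfolding distrib_left by linarith
  qed
  then have "\<omega> \<in> torus" by (simp add: torus_def)
  moreover have "lattice_equiv p \<omega>" unfolding lattice_equiv_def \<omega>_def by (intro exI[of _ k]) simp
  ultimately show ?thesis by blast
qed

lemma torus_lattice_equiv_eq:
  assumes "\<omega> \<in> torus" "\<omega>' \<in> torus" "lattice_equiv \<omega> \<omega>'"
  shows "\<omega> = \<omega>'"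
proof -
  obtain k where k: "\<omega> = \<omega>' + (2 * pi) *\<^sub>R real_vec k" using assms(3) by (auto simp: lattice_equiv_def)
  have "k $ i = 0" for i
  proof -
    have "\<omega> $ i = \<omega>' $ i + 2 * pi * real_of_int (k $ i)" using k by (simp add: real_vec_def)
    moreover have "- pi < \<omega> $ i" "\<omega> $ i \<le> pi" "- pi < \<omega>' $ i" "\<omega>' $ i \<le> pi"
      using assms(1,2) by (auto simp: torus_def)
    ultimately have "\<bar>2 * pi * real_of_int (k $ i)\<bar> < 2 * pi * 1" by linarith
    then have "\<bar>real_of_int (k $ i)\<bar> < 1" by (simp add: abs_mult)
    then show ?thesis by linarith
  qed
  then have "k = 0" by (simp add: vec_eq_iff)
  then show ?thesis using k by simp
qed

lemma lattice_equiv_cos: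
  assumes "\<And>i. cos (p $ i - q $ i) = 1"
  shows "lattice_equiv p q"
proof -
  have "\<exists>m::int. p $ i - q $ i = real_of_int m * (2 * pi)" for i
    using assms[of i] cos_one_2pi_int[of "p $ i - q $ i"] by (auto simp: mult_ac)
  then obtain m :: "'a \<Rightarrow> int" where m: "\<And>i. p $ i - q $ i = real_of_int (m i) * (2 * pi)" by metis
  have "p = q + (2 * pi) *\<^sub>R real_vec (\<chi> i. m i)"
    using m by (auto simp: vec_eq_iff real_vec_def algebra_simps)
  then show ?thesis unfolding lattice_equiv_def by blast
qed

text \<open>
  Such a \<open>q\<close> takes values in \<open>[0, 1]\<close> at real frequencies, the value 1 at \<open>\<omega>\<close>, and small values at the
  other points of \<open>\<Omega>\<close>. The bound \<open>1 / 32\<close> leaves room for a neighbourhood, also in the imaginary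
  direction, on which \<open>norm q \<le> 1 / 16\<close>.
\<close>
definition localizes :: "(real ^ 'd) set \<Rightarrow> real ^ 'd \<Rightarrow> (real ^ 'd \<Rightarrow> real ^ 'd \<Rightarrow> complex) \<Rightarrow> bool" where
  "localizes \<Omega> \<omega> q \<longleftrightarrow> trig_poly q \<and> (\<forall>\<xi>. \<exists>u\<in>{0..1}. q \<xi> 0 = of_real u) \<and>
    (\<forall>p. lattice_equiv p \<omega> \<longrightarrow> q p 0 = 1) \<and>
    (\<forall>\<omega>'\<in>\<Omega>. \<omega>' \<noteq> \<omega> \<longrightarrow> (\<forall>p. lattice_equiv p \<omega>' \<longrightarrow> norm (q p 0) \<le> 1 / 32))"

text \<open>
  The average over the coordinates of \<open>(1 + cos (\<xi>\<^sub>i - \<omega>\<^sub>i)) / 2\<close> is 1 exactly at the lattice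
  translates of \<open>\<omega>\<close>; a high power of it is small at the finitely many other points.
\<close>
lemma localizing_trig_poly:
  fixes \<omega> :: "real ^ 'd"
  assumes "finite \<Omega>" "\<Omega> \<subseteq> torus" "\<omega> \<in> \<Omega>"
  shows "\<exists>q. localizes \<Omega> \<omega> q"
proof -
  define h where "h \<xi> \<nu> = (\<Sum>i\<in>UNIV. (1/2) / of_nat CARD('d) +
      (exp (- \<i> * of_real (\<omega> $ i)) / 4 / of_nat CARD('d) * lattice_char (axis i 1) \<xi> \<nu>
     + exp (\<i> * of_real (\<omega> $ i)) / 4 / of_nat CARD('d) * lattice_char (axis i (-1)) \<xi> \<nu>))" for \<xi> \<nu>
  define u where "u \<xi> = (\<Sum>i\<in>UNIV. (1 + cos (\<xi> $ i - \<omega> $ i)) / 2) / real CARD('d)" for \<xi> :: "real ^ 'd"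
  have trig: "trig_poly h"
    unfolding h_def by (intro trig_poly_sum trig_poly.add trig_poly_const trig_poly.monomial)
  have hu: "h \<xi> 0 = of_real (u \<xi>)" for \<xi>
  proof -
    have "real_vec (axis i c :: int ^ 'd) \<bullet> \<xi> = real_of_int c * \<xi> $ i" for i c
    proof -
      have "real_vec (axis i c :: int ^ 'd) = axis i (real_of_int c)"
        by (simp add: real_vec_def axis_def vec_eq_iff)
      then show ?thesis by (simp add: inner_axis')
    qed
    then have lc: "lattice_char (axis i c) \<xi> 0 = exp (\<i> * of_real (real_of_int c * \<xi> $ i))" for i c
      by (simp add: lattice_char_def Complex_eq)
    have "exp (- \<i> * of_real (\<omega> $ i)) * lattice_char (axis i 1) \<xi> 0
        + exp (\<i> * of_real (\<omega> $ i)) * lattice_char (axis i (-1)) \<xi> 0 = 2 * of_real (cos (\<xi> $ i - \<omega> $ i))" for i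
    proof -
      have "exp (- \<i> * of_real (\<omega> $ i)) * lattice_char (axis i 1) \<xi> 0 = exp (\<i> * of_real (\<xi> $ i - \<omega> $ i))"
        unfolding lc by (simp add: algebra_simps flip: exp_add)
      moreover have "exp (\<i> * of_real (\<omega> $ i)) * lattice_char (axis i (-1)) \<xi> 0 = exp (- (\<i> * of_real (\<xi> $ i - \<omega> $ i)))"
        unfolding lc by (simp add: algebra_simps flip: exp_add)
      ultimately show ?thesis by (simp add: cos_of_real[symmetric] cos_exp_eq)
    qed
    then have "(1/2) / of_nat CARD('d) +
      (exp (- \<i> * of_real (\<omega> $ i)) / 4 / of_nat CARD('d) * lattice_char (axis i 1) \<xi> 0
     + exp (\<i> * of_real (\<omega> $ i)) / 4 / of_nat CARD('d) * lattice_char (axis i (-1)) \<xi> 0)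
      = of_real ((1 + cos (\<xi> $ i - \<omega> $ i)) / 2 / real CARD('d))" for i
      by (simp add: field_simps)
    then show ?thesis by (simp add: h_def u_def sum_divide_distrib)
  qed
  have u01: "0 \<le> u \<xi>" "u \<xi> \<le> 1" for \<xi>
  proof -
    have t: "0 \<le> (1 + cos (\<xi> $ i - \<omega> $ i)) / 2" "(1 + cos (\<xi> $ i - \<omega> $ i)) / 2 \<le> 1" for i
      using cos_ge_minus_one[of "\<xi> $ i - \<omega> $ i"] cos_le_one[of "\<xi> $ i - \<omega> $ i"]
      by (simp_all only: field_simps)
    show "0 \<le> u \<xi>" unfolding u_def by (intro divide_nonneg_nonneg sum_nonneg t) auto
    have "(\<Sum>i\<in>UNIV. (1 + cos (\<xi> $ i - \<omega> $ i)) / 2) \<le> (\<Sum>i\<in>(UNIV::'d set). 1)" by (intro sum_mono t)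
    then show "u \<xi> \<le> 1" unfolding u_def by simp
  qed
  have u1: "u p = 1" if "lattice_equiv p \<omega>" for p
  proof -
    obtain k where "p = \<omega> + (2 * pi) *\<^sub>R real_vec k" using \<open>lattice_equiv p \<omega>\<close> by (auto simp: lattice_equiv_def)
    then have "cos (p $ i - \<omega> $ i) = 1" for i
      using cos_int_2pin[of "k $ i"] by (simp add: real_vec_def)
    then show ?thesis by (simp add: u_def)
  qed
  have ult1: "u p < 1" if p: "lattice_equiv p \<omega>'" "\<omega>' \<in> \<Omega>" "\<omega>' \<noteq> \<omega>" for p \<omega>'
  proof (rule ccontr)
    assume "\<not> u p < 1"
    then have "(\<Sum>i\<in>(UNIV::'d set). 1) \<le> (\<Sum>i\<in>UNIV. (1 + cos (p $ i - \<omega> $ i)) / 2)"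
      using u01(2)[of p] unfolding u_def by (simp add: field_simps)
    then have s: "(\<Sum>i\<in>UNIV. 1 - (1 + cos (p $ i - \<omega> $ i)) / 2) \<le> 0"
      unfolding sum_subtractf by linarith
    have t: "0 \<le> 1 - (1 + cos (p $ i - \<omega> $ i)) / 2" for i
      using cos_le_one[of "p $ i - \<omega> $ i"] by (simp only: field_simps)
    then have "(\<Sum>i\<in>UNIV. 1 - (1 + cos (p $ i - \<omega> $ i)) / 2) = 0" using s by (intro antisym sum_nonneg) auto
    then have "1 - (1 + cos (p $ i - \<omega> $ i)) / 2 = 0" for i
      using t sum_nonneg_eq_0_iff[of UNIV "\<lambda>i. 1 - (1 + cos (p $ i - \<omega> $ i)) / 2"] by simp
    then have "cos (p $ i - \<omega> $ i) = 1" for i by (simp add: field_simps)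
    then have "lattice_equiv p \<omega>" by (rule lattice_equiv_cos)
    then obtain k where k: "p = \<omega> + (2 * pi) *\<^sub>R real_vec k" unfolding lattice_equiv_def by blast
    obtain k' where k': "p = \<omega>' + (2 * pi) *\<^sub>R real_vec k'" using p(1) unfolding lattice_equiv_def by blast
    have "\<omega>' = \<omega> + (2 * pi) *\<^sub>R real_vec k - (2 * pi) *\<^sub>R real_vec k'"
      unfolding k[symmetric] using k' by simp
    then have "\<omega>' = \<omega> + (2 * pi) *\<^sub>R real_vec (k - k')" by (simp add: scaleR_diff_right)
    then have "lattice_equiv \<omega>' \<omega>" unfolding lattice_equiv_def by blast
    then show False using torus_lattice_equiv_eq assms p by blast
  qed
  \<comment> \<open>One exponent for all points: the sum of the exponents that suit each of them.\<close>
  have "\<exists>L. \<forall>\<omega>'\<in>\<Omega> - {\<omega>}. u \<omega>' ^ L \<le> 1 / 32"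
  proof -
    have "\<exists>L. u \<omega>' ^ L < 1 / 32" if "\<omega>' \<in> \<Omega> - {\<omega>}" for \<omega>'
    proof (rule real_arch_pow_inv)
      show "u \<omega>' < 1" using that by (intro ult1[of \<omega>' \<omega>']) (auto simp: lattice_equiv_def intro: exI[of _ 0])
    qed simp
    then obtain L where L: "\<And>\<omega>'. \<omega>' \<in> \<Omega> - {\<omega>} \<Longrightarrow> u \<omega>' ^ L \<omega>' < 1 / 32" by metis
    have "u \<omega>' ^ Sum (L ` (\<Omega> - {\<omega>})) \<le> 1 / 32" if o: "\<omega>' \<in> \<Omega> - {\<omega>}" for \<omega>'
    proof -
      have "L \<omega>' \<le> Sum (L ` (\<Omega> - {\<omega>}))"
        using o assms(1) by (intro member_le_sum) auto
      then have "u \<omega>' ^ Sum (L ` (\<Omega> - {\<omega>})) \<le> u \<omega>' ^ L \<omega>'" by (intro power_decreasing u01)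
      then show ?thesis using L[OF o] by linarith
    qed
    then show ?thesis by blast
  qed
  then obtain L where L: "\<And>\<omega>'. \<omega>' \<in> \<Omega> - {\<omega>} \<Longrightarrow> u \<omega>' ^ L \<le> 1 / 32" by blast
  show ?thesis
    unfolding localizes_def
  proof (intro exI[of _ "\<lambda>\<xi> \<nu>. h \<xi> \<nu> ^ L"] conjI allI ballI impI)
    show "trig_poly (\<lambda>\<xi> \<nu>. h \<xi> \<nu> ^ L)" by (intro trig_poly_power trig)
    show "\<exists>v\<in>{0..1}. h \<xi> 0 ^ L = of_real v" for \<xi>
      using u01[of \<xi>] by (intro bexI[of _ "u \<xi> ^ L"]) (auto simp: hu power_le_one)
    show "h p 0 ^ L = 1" if "lattice_equiv p \<omega>" for p
      using u1[OF that] by (simp add: hu)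
    show "norm (h p 0 ^ L) \<le> 1 / 32" if "\<omega>' \<in> \<Omega>" "\<omega>' \<noteq> \<omega>" "lattice_equiv p \<omega>'" for \<omega>' p
    proof -
      have "h p 0 = h \<omega>' 0" using trig_poly_lattice_equiv[OF trig that(3), of 0 0] by simp
      then show ?thesis using L[of \<omega>'] that u01[of \<omega>'] by (simp add: hu norm_power)
    qed
  qed
qed

section \<open>Local integral estimates\<close>

text \<open>
  Local bounds on balls add up over a finite subcover. The error terms may have different rates
  \<open>\<rho> < 1\<close> and radii, of which the worst is kept; the main term \<open>e\<close> is common to all points.
\<close>
lemma compact_patching:
  fixes u :: "nat \<Rightarrow> 'v::real_normed_vector \<Rightarrow> 'a::euclidean_space \<Rightarrow> ennreal" and e :: "nat \<Rightarrow> 'v \<Rightarrow> real"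
  assumes "compact K"
    and meas: "\<And>n \<nu>. u n \<nu> \<in> borel_measurable borel"
    and e0: "\<And>n \<nu>. e n \<nu> \<ge> 0"
    and loc: "\<And>p. p \<in> K \<Longrightarrow> \<exists>r>0. \<exists>C>0. \<exists>\<rho>. 0 < \<rho> \<and> \<rho> < 1 \<and> (\<forall>n\<ge>1. \<forall>\<nu>. norm \<nu> < r \<longrightarrow>
      (\<integral>\<^sup>+\<xi>\<in>ball p r. u n \<nu> \<xi> \<partial>lborel) \<le> ennreal (C * (\<rho> ^ n + e n \<nu>)))"
  shows "\<exists>r>0. \<exists>C>0. \<exists>\<rho>. 0 < \<rho> \<and> \<rho> < 1 \<and> (\<forall>n\<ge>1. \<forall>\<nu>. norm \<nu> < r \<longrightarrow>
      (\<integral>\<^sup>+\<xi>\<in>K. u n \<nu> \<xi> \<partial>lborel) \<le> ennreal (C * (\<rho> ^ n + e n \<nu>)))"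
proof -
  define good where "good p r C \<rho> \<longleftrightarrow> r > 0 \<and> C > 0 \<and> 0 < \<rho> \<and> \<rho> < 1 \<and> (\<forall>n\<ge>1. \<forall>\<nu>. norm \<nu> < r \<longrightarrow>
      (\<integral>\<^sup>+\<xi>\<in>ball p r. u n \<nu> \<xi> \<partial>lborel) \<le> ennreal (C * (\<rho> ^ n + e n \<nu>)))" for p r C \<rho>
  have "\<forall>p\<in>K. \<exists>r C \<rho>. good p r C \<rho>" unfolding good_def using loc by blast
  then obtain r C \<rho> where good: "\<And>p. p \<in> K \<Longrightarrow> good p (r p) (C p) (\<rho> p)" by metis
  have loc': "p \<in> K \<Longrightarrow> r p > 0" "p \<in> K \<Longrightarrow> C p > 0"
    "p \<in> K \<Longrightarrow> 0 < \<rho> p" "p \<in> K \<Longrightarrow> \<rho> p < 1"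
    "p \<in> K \<Longrightarrow> n \<ge> 1 \<Longrightarrow> norm \<nu> < r p \<Longrightarrow>
      (\<integral>\<^sup>+\<xi>\<in>ball p (r p). u n \<nu> \<xi> \<partial>lborel) \<le> ennreal (C p * (\<rho> p ^ n + e n \<nu>))" for p n \<nu>
    using good[of p] unfolding good_def by blast+
  obtain D where D: "D \<subseteq> K" "finite D" "K \<subseteq> (\<Union>p\<in>D. ball p (r p))"
  proof (rule compactE_image[OF assms(1), of K "\<lambda>p. ball p (r p)"])
    show "K \<subseteq> (\<Union>p\<in>K. ball p (r p))" using loc'(1) by force
  qed auto
  define r' where "r' = Min (insert 1 (r ` D))"
  define \<rho>' where "\<rho>' = Max (insert (1/2) (\<rho> ` D))"
  define C' where "C' = (\<Sum>p\<in>D. C p) + 1"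
  have Cnn: "(\<Sum>p\<in>D. C p) \<ge> 0" using loc'(2) D(1) by (intro sum_nonneg) (auto intro: less_imp_le)
  have r': "r' > 0" "\<And>p. p \<in> D \<Longrightarrow> r' \<le> r p"
    using loc'(1) D by (auto simp: r'_def)
  have \<rho>': "0 < \<rho>'" "\<rho>' < 1" "\<And>p. p \<in> D \<Longrightarrow> \<rho> p \<le> \<rho>'"
  proof -
    have "1/2 \<le> \<rho>'" unfolding \<rho>'_def using D(2) by (intro Max_ge) auto
    then show "0 < \<rho>'" by linarith
    show "\<rho>' < 1" unfolding \<rho>'_def using D loc'(4) by (subst Max_less_iff) auto
    show "\<And>p. p \<in> D \<Longrightarrow> \<rho> p \<le> \<rho>'" unfolding \<rho>'_def using D(2) by (intro Max_ge) auto
  qed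
  have "(\<integral>\<^sup>+\<xi>\<in>K. u n \<nu> \<xi> \<partial>lborel) \<le> ennreal (C' * (\<rho>' ^ n + e n \<nu>))" if n: "n \<ge> 1" and nu: "norm \<nu> < r'" for n \<nu>
  proof -
    have "(\<integral>\<^sup>+\<xi>\<in>K. u n \<nu> \<xi> \<partial>lborel) \<le> (\<integral>\<^sup>+\<xi>. (\<Sum>p\<in>D. u n \<nu> \<xi> * indicator (ball p (r p)) \<xi>) \<partial>lborel)"
    proof (intro nn_integral_mono)
      fix \<xi>
      show "u n \<nu> \<xi> * indicator K \<xi> \<le> (\<Sum>p\<in>D. u n \<nu> \<xi> * indicator (ball p (r p)) \<xi>)"
      proof (cases "\<xi> \<in> K")
        case True
        then obtain p where p: "p \<in> D" "\<xi> \<in> ball p (r p)" using D(3) by blast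
        have "u n \<nu> \<xi> * indicator K \<xi> = u n \<nu> \<xi> * indicator (ball p (r p)) \<xi>" using True p by simp
        also have "\<dots> \<le> (\<Sum>p\<in>D. u n \<nu> \<xi> * indicator (ball p (r p)) \<xi>)"
          using member_le_sum[OF p(1), of "\<lambda>p. u n \<nu> \<xi> * indicator (ball p (r p)) \<xi>"] D(2) by simp
        finally show ?thesis .
      qed simp
    qed
    also have "\<dots> = (\<Sum>p\<in>D. \<integral>\<^sup>+\<xi>\<in>ball p (r p). u n \<nu> \<xi> \<partial>lborel)"
      using meas[of n \<nu>] by (intro nn_integral_sum) (auto intro!: borel_measurable_times_ennreal borel_measurable_indicator)
    also have "\<dots> \<le> (\<Sum>p\<in>D. ennreal (C p * (\<rho>' ^ n + e n \<nu>)))"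
    proof (rule sum_mono)
      fix p assume p: "p \<in> D"
      then have pK: "p \<in> K" using D(1) by blast
      have "(\<integral>\<^sup>+\<xi>\<in>ball p (r p). u n \<nu> \<xi> \<partial>lborel) \<le> ennreal (C p * (\<rho> p ^ n + e n \<nu>))"
        using loc'(5)[OF pK n] nu r'(2)[OF p] by simp
      also have "\<dots> \<le> ennreal (C p * (\<rho>' ^ n + e n \<nu>))"
        using loc'(2,3)[OF pK] \<rho>'(3)[OF p]
        by (intro ennreal_leI mult_left_mono add_right_mono power_mono) auto
      finally show "(\<integral>\<^sup>+\<xi>\<in>ball p (r p). u n \<nu> \<xi> \<partial>lborel) \<le> ennreal (C p * (\<rho>' ^ n + e n \<nu>))" .
    qed
    also have "\<dots> = ennreal (\<Sum>p\<in>D. C p * (\<rho>' ^ n + e n \<nu>))"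
      by (intro sum_ennreal mult_nonneg_nonneg add_nonneg_nonneg zero_le_power e0)
         (use loc'(2) D(1) \<rho>'(1) in \<open>auto intro: less_imp_le\<close>)
    also have "\<dots> \<le> ennreal (C' * (\<rho>' ^ n + e n \<nu>))"
      unfolding C'_def using \<rho>'(1) e0
      by (intro ennreal_leI) (auto simp: sum_distrib_right[symmetric] intro!: mult_right_mono add_nonneg_nonneg)
    finally show ?thesis .
  qed
  moreover have "C' > 0" using Cnn by (simp add: C'_def)
  ultimately show ?thesis using r'(1) \<rho>'(1,2) by blast
qed

lemma continuous_pair_less:
  fixes h :: "'a::real_normed_vector \<Rightarrow> 'b::real_normed_vector \<Rightarrow> real"
  assumes "continuous_on UNIV (\<lambda>z. h (fst z) (snd z))" "h p 0 < c"
  shows "\<exists>r>0. \<forall>\<xi> \<nu>. norm (\<xi> - p) < r \<longrightarrow> norm \<nu> < r \<longrightarrow> h \<xi> \<nu> < c"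
proof -
  have "open {z. h (fst z) (snd z) < c}"
    using assms(1) by (intro open_Collect_less continuous_intros)
  moreover have "(p, 0) \<in> {z. h (fst z) (snd z) < c}" using assms(2) by simp
  ultimately obtain e where e: "e > 0" "ball (p, 0) e \<subseteq> {z. h (fst z) (snd z) < c}"
    using openE by blast
  have "h \<xi> \<nu> < c" if "norm (\<xi> - p) < e / 2" "norm \<nu> < e / 2" for \<xi> \<nu>
  proof -
    have "dist (p, 0) (\<xi>, \<nu>) \<le> dist p \<xi> + dist 0 \<nu>"
      unfolding dist_Pair_Pair by (intro sqrt_sum_squares_le_sum) auto
    also have "\<dots> < e" using that by (simp add: dist_norm norm_minus_commute)
    finally show ?thesis using e(2) by (auto simp: subset_iff)
  qed
  then show ?thesis using e(1) by (intro exI[of _ "e / 2"]) auto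
qed

lemma nn_integral_ball_const_le:
  fixes p :: "'a::euclidean_space"
  assumes "\<And>\<xi>. norm (\<xi> - p) < r \<Longrightarrow> u \<xi> \<le> ennreal c" "c \<ge> 0" "r \<ge> 0"
  shows "(\<integral>\<^sup>+\<xi>\<in>ball p r. u \<xi> \<partial>lborel) \<le> ennreal ((measure lborel (ball p r) + 1) * c)"
proof -
  have "(\<integral>\<^sup>+\<xi>\<in>ball p r. u \<xi> \<partial>lborel) \<le> (\<integral>\<^sup>+\<xi>. ennreal c * indicator (ball p r) \<xi> \<partial>lborel)"
    using assms(1) by (intro nn_integral_mono) (auto split: split_indicator simp: dist_norm norm_minus_commute)
  also have "\<dots> = ennreal c * emeasure lborel (ball p r)"
    by (rule nn_integral_cmult_indicator) auto
  also have "emeasure lborel (ball p r) = ennreal (measure lborel (ball p r))"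
    using emeasure_lborel_ball_finite[of p r] by (intro emeasure_eq_ennreal_measure) auto
  also have "ennreal c * ennreal (measure lborel (ball p r)) = ennreal (measure lborel (ball p r) * c)"
    using assms(2) by (subst ennreal_mult[symmetric]) (auto simp: mult.commute)
  also have "\<dots> \<le> ennreal ((measure lborel (ball p r) + 1) * c)"
    using assms(2) by (intro ennreal_leI mult_right_mono) auto
  finally show ?thesis .
qed

text \<open>
  Away from the peak the localized power decays exponentially for one of two reasons: either \<open>F\<close> itself
  is smaller than 1, and the cutoff is bounded by \<open>((norm q + norm (1 - q))\<^sup>2) ^ n\<close> with a base near 1; or
  the cutoff is at most \<open>(1/2) ^ n\<close>, and \<open>F\<close> is bounded by \<open>3/2\<close>.
\<close>
lemma localized_power_off_peak:
  fixes p :: "real ^ 'd"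
  assumes F: "trig_poly F" and q: "trig_poly q"
    and "(\<exists>u\<in>{0..1}. q p 0 = of_real u) \<and> norm (F p 0) < 1 \<or> norm (q p 0) \<le> 1 / 32 \<and> norm (F p 0) \<le> 1"
  shows "\<exists>r>0. \<exists>\<rho>. 0 < \<rho> \<and> \<rho> < 1 \<and> (\<forall>n \<xi> \<nu>. norm (\<xi> - p) < r \<longrightarrow> norm \<nu> < r \<longrightarrow>
    norm (upper_binomial_tail n (q \<xi> \<nu>) * F \<xi> \<nu> ^ n) \<le> \<rho> ^ n)"
  using assms(3)
proof (elim disjE conjE bexE)
  fix u assume u: "u \<in> {0..1}" "q p 0 = of_real u" and lt: "norm (F p 0) < 1"
  define h where "h \<xi> \<nu> = (norm (q \<xi> \<nu>) + norm (1 - q \<xi> \<nu>))\<^sup>2 * norm (F \<xi> \<nu>)" for \<xi> \<nu>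
  have "continuous_on UNIV (\<lambda>z. h (fst z) (snd z))"
    unfolding h_def by (intro continuous_intros trig_poly_continuous F q)
  moreover have "norm (1 - q p 0) = 1 - u"
  proof -
    have "1 - q p 0 = of_real (1 - u)" using u by simp
    then show ?thesis using u(1) by (metis abs_of_nonneg atLeastAtMost_iff diff_ge_0_iff_ge norm_of_real)
  qed
  then have "h p 0 = norm (F p 0)" using u by (simp add: h_def)
  moreover obtain \<rho> where \<rho>: "norm (F p 0) < \<rho>" "\<rho> < 1" using dense[OF lt] by blast
  ultimately obtain r where r: "r > 0" "\<And>\<xi> \<nu>. norm (\<xi> - p) < r \<Longrightarrow> norm \<nu> < r \<Longrightarrow> h \<xi> \<nu> < \<rho>"
    using continuous_pair_less[of h p \<rho>] by auto
  have "norm (upper_binomial_tail n (q \<xi> \<nu>) * F \<xi> \<nu> ^ n) \<le> \<rho> ^ n" if "norm (\<xi> - p) < r" "norm \<nu> < r" for n \<xi> \<nu>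
  proof -
    have "norm (upper_binomial_tail n (q \<xi> \<nu>) * F \<xi> \<nu> ^ n) \<le> ((norm (q \<xi> \<nu>) + norm (1 - q \<xi> \<nu>))\<^sup>2) ^ n * norm (F \<xi> \<nu>) ^ n"
      unfolding norm_mult norm_power by (intro mult_right_mono norm_upper_binomial_tail_le) auto
    also have "\<dots> = h \<xi> \<nu> ^ n" by (simp add: h_def power_mult_distrib)
    also have "\<dots> \<le> \<rho> ^ n" using r(2)[OF that] by (intro power_mono) (auto simp: h_def)
    finally show ?thesis .
  qed
  moreover have "0 < \<rho>" using \<rho>(1) norm_ge_zero[of "F p 0"] by linarith
  ultimately show ?thesis using r(1) \<rho>(2) by blast
next
  assume le: "norm (q p 0) \<le> 1 / 32" "norm (F p 0) \<le> 1"
  have cq: "continuous_on UNIV (\<lambda>z. norm (q (fst z) (snd z)))" and cF: "continuous_on UNIV (\<lambda>z. norm (F (fst z) (snd z)))"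
    by (intro continuous_intros trig_poly_continuous F q)+
  obtain r1 where r1: "r1 > 0" "\<And>\<xi> \<nu>. norm (\<xi> - p) < r1 \<Longrightarrow> norm \<nu> < r1 \<Longrightarrow> norm (q \<xi> \<nu>) < 1 / 16"
    using continuous_pair_less[OF cq, of p "1/16"] le by auto
  obtain r2 where r2: "r2 > 0" "\<And>\<xi> \<nu>. norm (\<xi> - p) < r2 \<Longrightarrow> norm \<nu> < r2 \<Longrightarrow> norm (F \<xi> \<nu>) < 3 / 2"
    using continuous_pair_less[OF cF, of p "3/2"] le by auto
  have "norm (upper_binomial_tail n (q \<xi> \<nu>) * F \<xi> \<nu> ^ n) \<le> (3 / 4) ^ n"
    if "norm (\<xi> - p) < min r1 r2" "norm \<nu> < min r1 r2" for n \<xi> \<nu>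
  proof -
    have "norm (upper_binomial_tail n (q \<xi> \<nu>) * F \<xi> \<nu> ^ n) \<le> (1 / 2) ^ n * (3 / 2) ^ n"
      unfolding norm_mult norm_power using r1(2)[of \<xi> \<nu>] r2(2)[of \<xi> \<nu>] that
      by (intro mult_mono power_mono upper_binomial_tail_near_0) auto
    also have "\<dots> = (3 / 4) ^ n" by (simp flip: power_mult_distrib)
    finally show ?thesis .
  qed
  then show ?thesis using r1(1) r2(1)
    by (intro exI[of _ "min r1 r2"] conjI exI[of _ "3/4 :: real"]) auto
qed

lemma norm_upper_binomial_tail_near_1_le:
  assumes "norm (1 - q) \<le> 1 / 16"
  shows "norm (upper_binomial_tail n q) \<le> 2"
proof -
  have "norm (upper_binomial_tail n q) \<le> norm (1 :: complex) + norm (1 - upper_binomial_tail n q)"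
    by (metis diff_diff_eq2 add_diff_cancel_left' norm_triangle_ineq4)
  also have "\<dots> \<le> 1 + (1/2) ^ n" using upper_binomial_tail_near_1[OF assms, of n] by simp
  also have "(1/2 :: real) ^ n \<le> 1" by (rule power_le_one) auto
  finally show ?thesis by simp
qed

lemma nn_integral_lborel_translation:
  fixes p :: "'a::euclidean_space"
  assumes [measurable]: "f \<in> borel_measurable borel"
  shows "(\<integral>\<^sup>+\<xi>. f (\<xi> - p) \<partial>lborel) = (\<integral>\<^sup>+\<xi>. f \<xi> \<partial>lborel)"
proof -
  have "(\<integral>\<^sup>+\<xi>. f \<xi> \<partial>lborel) = (\<integral>\<^sup>+\<xi>. f \<xi> \<partial>(distr lborel borel (\<lambda>x. - p + x)))"
    by (simp only: lborel_distr_plus)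
  also have "\<dots> = (\<integral>\<^sup>+\<xi>. f (- p + \<xi>) \<partial>lborel)" by (rule nn_integral_distr) auto
  finally show ?thesis by simp
qed

context homogeneous_symbol_volume
begin

text \<open>
  The constant is uniform in the power \<open>n\<close>, the centre, the radius, and the number \<open>A\<close> that collects the
  part of the exponent not depending on \<open>\<xi>\<close>, in particular everything that depends on \<open>\<nu>\<close>.
\<close>
lemma local_integral_at_peak:
  assumes "\<epsilon> > 0"
  shows "\<exists>C>0. \<forall>n\<ge>1. \<forall>u A p r. (\<forall>\<xi>. norm (\<xi> - p) < r \<longrightarrow> u \<xi> \<le> ennreal (2 * exp (real n * (A - \<epsilon> * R (\<xi> - p))))) \<longrightarrow>
     (\<integral>\<^sup>+\<xi>\<in>ball p r. u \<xi> \<partial>lborel) \<le> ennreal (C * (exp (real n * A) / real n powr \<mu>))"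
proof -
  obtain C where C: "C > 0" "\<And>n. n \<ge> 1 \<Longrightarrow> (\<integral>\<^sup>+\<xi>. ennreal (exp (- (real n * \<epsilon> * R \<xi>))) \<partial>lborel) \<le> ennreal (C / real n powr \<mu>)"
    using integral_exp_neg_R[OF assms] by blast
  have "(\<integral>\<^sup>+\<xi>\<in>ball p r. u \<xi> \<partial>lborel) \<le> ennreal (2 * C * (exp (real n * A) / real n powr \<mu>))"
    if n: "n \<ge> 1" and u: "\<And>\<xi>. norm (\<xi> - p) < r \<Longrightarrow> u \<xi> \<le> ennreal (2 * exp (real n * (A - \<epsilon> * R (\<xi> - p))))" for n u A p r
  proof -
    define g where "g \<xi> = ennreal (exp (- (real n * \<epsilon> * R \<xi>)))" for \<xi>
    have [measurable]: "g \<in> borel_measurable borel"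
      unfolding g_def using borel_measurable_continuous_onI[OF R_continuous] by measurable
    have "(\<integral>\<^sup>+\<xi>\<in>ball p r. u \<xi> \<partial>lborel) \<le> (\<integral>\<^sup>+\<xi>. ennreal (2 * exp (real n * A)) * g (\<xi> - p) \<partial>lborel)"
    proof (intro nn_integral_mono)
      fix \<xi>
      have eq: "ennreal (2 * exp (real n * (A - \<epsilon> * R (\<xi> - p)))) = ennreal (2 * exp (real n * A)) * g (\<xi> - p)"
        unfolding g_def by (subst ennreal_mult[symmetric]) (auto simp: algebra_simps simp flip: exp_add)
      show "u \<xi> * indicator (ball p r) \<xi> \<le> ennreal (2 * exp (real n * A)) * g (\<xi> - p)"
        using u[of \<xi>] unfolding eq by (auto split: split_indicator simp: dist_norm norm_minus_commute)
    qed
    also have "\<dots> = ennreal (2 * exp (real n * A)) * (\<integral>\<^sup>+\<xi>. g (\<xi> - p) \<partial>lborel)"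
      by (rule nn_integral_cmult) measurable
    also have "(\<integral>\<^sup>+\<xi>. g (\<xi> - p) \<partial>lborel) = (\<integral>\<^sup>+\<xi>. g \<xi> \<partial>lborel)"
      by (rule nn_integral_lborel_translation) measurable
    also have "\<dots> \<le> ennreal (C / real n powr \<mu>)" unfolding g_def by (rule C(2)[OF n])
    also have "ennreal (2 * exp (real n * A)) * ennreal (C / real n powr \<mu>) = ennreal (2 * C * (exp (real n * A) / real n powr \<mu>))"
      using C(1) by (subst ennreal_mult[symmetric]) (auto simp: mult_ac)
    finally show ?thesis by (simp add: mult_left_mono)
  qed
  then show ?thesis using C(1) by (intro exI[of _ "2 * C"]) auto
qed

text \<open>
  The choice of the shift: \<open>\<nu> = c \<xi>\<close> with \<open>\<xi>\<close> maximizing \<open>y \<bullet> \<xi> - R \<xi>\<close>. For small \<open>c\<close> one has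
  \<open>M * R (c \<xi>) \<le> c * R \<xi>\<close>, so the shifted exponent retains the fraction \<open>c\<close> of the transform. The bound
  by \<open>\<eta>\<close> lets errors decaying at the rate \<open>\<eta>\<close> be absorbed.
\<close>
lemma legendre_shift:
  assumes diff: "R differentiable (at 0)" and pos: "M > 0" "\<nu>\<^sub>0 > 0" "\<eta> > 0" "B \<ge> 0"
  shows "\<exists>c>0. \<forall>y. norm y \<le> B \<longrightarrow> c * (SUP \<xi>. y \<bullet> \<xi> - R \<xi>) \<le> \<eta> \<and>
    (\<exists>\<nu>. norm \<nu> < \<nu>\<^sub>0 \<and> c * (SUP \<xi>. y \<bullet> \<xi> - R \<xi>) \<le> y \<bullet> \<nu> - M * R \<nu>)"
proof -
  obtain L where L: "L > 0" "\<And>y. norm y \<le> B \<Longrightarrow> \<exists>\<xi>. norm \<xi> \<le> L \<and> (SUP \<xi>. y \<bullet> \<xi> - R \<xi>) = y \<bullet> \<xi> - R \<xi>"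
    using legendre_attained[OF diff] by blast
  have "1 / M > 0" using pos(1) by simp
  then obtain c\<^sub>0 where c0: "c\<^sub>0 > 0" "\<And>c \<xi>. 0 < c \<Longrightarrow> c \<le> c\<^sub>0 \<Longrightarrow> R (c *\<^sub>R \<xi>) \<le> 1 / M * c * R \<xi>"
    using R_scaled_small[OF diff, of "1 / M"] by blast
  define c where "c = min c\<^sub>0 (min (\<nu>\<^sub>0 / (2 * L)) (\<eta> / (B * L + 1)))"
  have BL: "B * L \<ge> 0" using pos L(1) by simp
  then have BL1: "B * L + 1 > 0" by linarith
  have c: "c > 0" "c \<le> c\<^sub>0" "c \<le> \<nu>\<^sub>0 / (2 * L)" "c \<le> \<eta> / (B * L + 1)"
    using c0(1) pos L(1) BL1 by (auto simp: c_def)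
  have cL: "c * L \<le> \<nu>\<^sub>0 / 2" using c(3) L(1) by (simp add: pos_le_divide_eq mult_ac)
  have cB: "c * (B * L + 1) \<le> \<eta>" using c(4) BL1 by (simp add: pos_le_divide_eq)
  have "c * (SUP \<xi>. y \<bullet> \<xi> - R \<xi>) \<le> \<eta> \<and> (\<exists>\<nu>. norm \<nu> < \<nu>\<^sub>0 \<and> c * (SUP \<xi>. y \<bullet> \<xi> - R \<xi>) \<le> y \<bullet> \<nu> - M * R \<nu>)"
    if y: "norm y \<le> B" for y
  proof -
    obtain \<xi> where xi: "norm \<xi> \<le> L" "(SUP \<xi>. y \<bullet> \<xi> - R \<xi>) = y \<bullet> \<xi> - R \<xi>" using L(2)[OF y] by blast
    have "y \<bullet> \<xi> \<le> norm y * norm \<xi>" by (rule norm_cauchy_schwarz)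
    also have "\<dots> \<le> B * L" using y xi(1) pos by (intro mult_mono) auto
    finally have "y \<bullet> \<xi> - R \<xi> \<le> B * L + 1" using nonneg[of \<xi>] by linarith
    then have "c * (y \<bullet> \<xi> - R \<xi>) \<le> c * (B * L + 1)" using c(1) by (intro mult_left_mono) auto
    then have 1: "c * (SUP \<xi>. y \<bullet> \<xi> - R \<xi>) \<le> \<eta>" using cB xi(2) by simp
    have "norm (c *\<^sub>R \<xi>) \<le> c * L" using c(1) xi(1) by simp
    then have 2: "norm (c *\<^sub>R \<xi>) < \<nu>\<^sub>0" using cL pos by linarith
    have "M * R (c *\<^sub>R \<xi>) \<le> M * (1 / M * c * R \<xi>)" using c0(2)[OF c(1,2)] pos(1) by (intro mult_left_mono) auto
    also have "\<dots> = c * R \<xi>" using pos(1) by simp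
    finally have "c * (y \<bullet> \<xi> - R \<xi>) \<le> y \<bullet> (c *\<^sub>R \<xi>) - M * R (c *\<^sub>R \<xi>)" by (simp add: right_diff_distrib)
    then show ?thesis using 1 2 xi(2) by metis
  qed
  then show ?thesis using c(1) by blast
qed

end

lemma exp_decay_le_powr:
  fixes \<eta> \<mu> :: real
  assumes "\<eta> > 0"
  shows "\<exists>C>0. \<forall>n\<ge>1. exp (- (\<eta> * real n)) \<le> C / real n powr \<mu>"
proof -
  have "(\<lambda>n. exp (- (\<eta> * real n)) * real n powr \<mu>) \<longlonglongrightarrow> 0" using assms by real_asymp
  then have "Bseq (\<lambda>n. exp (- (\<eta> * real n)) * real n powr \<mu>)" by (rule convergent_imp_Bseq[OF convergentI])
  then obtain C where C: "C > 0" "\<And>n. norm (exp (- (\<eta> * real n)) * real n powr \<mu>) \<le> C"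
    by (auto elim: BseqE)
  have "exp (- (\<eta> * real n)) \<le> C / real n powr \<mu>" if "n \<ge> 1" for n
    using C(2)[of n] that by (simp add: pos_le_divide_eq)
  then show ?thesis using C(1) by blast
qed

section \<open>The maximum points\<close>

lemma torus_subset_cube: "torus \<subseteq> cube"
  unfolding torus_def cube_def mem_box_cart subset_eq by (simp add: less_imp_le)

lemma normalized_exp_poly:
  fixes \<phi> :: "int ^ 'd \<Rightarrow> complex"
  assumes fin: "finite (supp \<phi>)" and norm: "\<phi> \<in> H_class_normalized"
  shows "norm (exp_poly \<phi> \<xi> 0) \<le> 1"
    and "Omega \<phi> \<noteq> {}"
proof -
  have S: "(SUP \<xi>\<in>torus. norm (exp_poly \<phi> \<xi> 0)) = 1"
    using norm unfolding H_class_normalized_def by (simp add: exp_poly_zero_shift[OF fin])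
  have b: "norm (exp_poly \<phi> \<xi> 0) \<le> (\<Sum>x\<in>supp \<phi>. norm (\<phi> x))" for \<xi>
    unfolding exp_poly_def by (rule order_trans[OF norm_sum]) (simp add: norm_mult norm_lattice_char)
  then have bdd: "bdd_above ((\<lambda>\<xi>. norm (exp_poly \<phi> \<xi> 0)) ` torus)" by (intro bdd_aboveI2)
  have le: "norm (exp_poly \<phi> \<xi> 0) \<le> 1" for \<xi>
  proof -
    obtain \<omega> where w: "\<omega> \<in> torus" "lattice_equiv \<xi> \<omega>" using lattice_equiv_torus by blast
    have "exp_poly \<phi> \<xi> 0 = exp_poly \<phi> \<omega> 0"
      using trig_poly_lattice_equiv[OF trig_poly_exp_poly w(2), of \<phi> 0 0] by simp
    then show ?thesis using cSUP_upper[OF w(1) bdd] S by simp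
  qed
  show "norm (exp_poly \<phi> \<xi> 0) \<le> 1" by (rule le)
  have t0: "0 \<in> (torus :: (real ^ 'd) set)" by (simp add: torus_def)
  have sub: "torus \<subseteq> (cube :: (real ^ 'd) set)"
    by (rule torus_subset_cube)
  have "continuous_on cube (\<lambda>\<xi>. norm (exp_poly \<phi> \<xi> 0))"
    by (intro continuous_on_norm trig_poly_continuous_fst trig_poly_exp_poly)
  moreover have "(cube :: (real ^ 'd) set) \<noteq> {}" using t0 sub by blast
  ultimately obtain p where p: "\<And>\<xi>. \<xi> \<in> cube \<Longrightarrow> norm (exp_poly \<phi> \<xi> 0) \<le> norm (exp_poly \<phi> p 0)"
    using continuous_attains_sup[OF compact_cube] by blast
  have "(SUP \<xi>\<in>torus. norm (exp_poly \<phi> \<xi> 0)) \<le> norm (exp_poly \<phi> p 0)"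
    using t0 sub p by (intro cSUP_least) auto
  then have p1: "norm (exp_poly \<phi> p 0) = 1" using S le[of p] by linarith
  obtain \<omega> where w: "\<omega> \<in> torus" "lattice_equiv p \<omega>" using lattice_equiv_torus by blast
  have "exp_poly \<phi> p 0 = exp_poly \<phi> \<omega> 0"
    using trig_poly_lattice_equiv[OF trig_poly_exp_poly w(2), of \<phi> 0 0] by simp
  then have "\<omega> \<in> Omega \<phi>" using p1 w(1) by (simp add: Omega_def exp_poly_zero_shift[OF fin])
  then show "Omega \<phi> \<noteq> {}" by blast
qed

lemma norm_one_imp_lattice_equiv_Omega:
  assumes fin: "finite (supp \<phi>)" and "norm (exp_poly \<phi> p 0) = 1"
  shows "\<exists>\<omega>\<in>Omega \<phi>. lattice_equiv p \<omega>"
proof -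
  obtain \<omega> where w: "\<omega> \<in> torus" "lattice_equiv p \<omega>" using lattice_equiv_torus by blast
  have "exp_poly \<phi> p 0 = exp_poly \<phi> \<omega> 0"
    using trig_poly_lattice_equiv[OF trig_poly_exp_poly w(2), of \<phi> 0 0] by simp
  then have "\<omega> \<in> Omega \<phi>" using assms(2) w(1) by (simp add: Omega_def exp_poly_zero_shift[OF fin])
  then show ?thesis using w(2) by blast
qed

text \<open>
  By the local bound with \<open>\<nu> = 0\<close>, the modulus is strictly less than 1 in a punctured neighbourhood of
  every translate of a point of \<open>Omega \<phi>\<close>; hence \<open>Omega \<phi>\<close> has no limit point, and it is bounded.
\<close>
lemma finite_Omega:
  fixes \<phi> :: "int ^ 'd \<Rightarrow> complex"
  assumes fin: "finite (supp \<phi>)"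
    and type: "\<And>\<omega>. \<omega> \<in> Omega \<phi> \<Longrightarrow> pos_hom_type_with (fourier \<phi>) \<omega> (\<alpha> \<omega>) (P \<omega>)"
  shows "finite (Omega \<phi>)"
proof -
  have "\<not> p islimpt (Omega \<phi>)" for p
  proof
    assume lim: "p islimpt Omega \<phi>"
    have "closed {\<xi>. norm (exp_poly \<phi> \<xi> 0) = 1}"
      by (intro closed_Collect_eq continuous_on_norm trig_poly_continuous_fst trig_poly_exp_poly continuous_intros)
    moreover have "Omega \<phi> \<subseteq> {\<xi>. norm (exp_poly \<phi> \<xi> 0) = 1}"
      by (auto simp: Omega_def exp_poly_zero_shift[OF fin])
    ultimately have "norm (exp_poly \<phi> p 0) = 1"
      using lim closed_limpt islimpt_subset by blast
    then obtain \<omega> where w: "\<omega> \<in> Omega \<phi>" "lattice_equiv p \<omega>"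
      using norm_one_imp_lattice_equiv_Omega[OF fin] by blast
    have php: "pos_hom_polynomial (P \<omega>)" using type[OF w(1)] by (simp add: pos_hom_type_with_def)
    have "norm (fourier \<phi> \<omega>) = 1" using w(1) by (simp add: Omega_def)
    then obtain r \<epsilon> M where rem: "r > 0" "\<epsilon> > 0" "M > 0"
      "\<And>\<xi> \<nu>. norm \<xi> < r \<Longrightarrow> norm \<nu> < r \<Longrightarrow>
        norm (exp_poly \<phi> (\<omega> + \<xi>) \<nu>) \<le> exp (\<alpha> \<omega> \<bullet> \<nu> - \<epsilon> * Re (P \<omega> \<xi>) + M * Re (P \<omega> \<nu>))"
      using exp_poly_pos_hom_type_shift_bound[OF fin type[OF w(1)]] by blast
    obtain T where "homogeneous_symbol_volume (P \<omega>) T (hom_order (P \<omega>))"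
      using pos_hom_polynomial_homogeneous_symbol[OF php] by blast
    then interpret homogeneous_symbol_volume "P \<omega>" T "hom_order (P \<omega>)" .
    obtain p' where p': "p' \<in> Omega \<phi>" "p' \<noteq> p" "dist p' p < r"
      using lim rem(1) unfolding islimpt_approachable by blast
    have "exp_poly \<phi> p' 0 = exp_poly \<phi> (\<omega> + (p' - p)) 0"
      using trig_poly_lattice_equiv[OF trig_poly_exp_poly w(2), of \<phi> "p' - p" 0] by simp
    also have "norm \<dots> \<le> exp (- \<epsilon> * Re (P \<omega> (p' - p)))"
      using rem(4)[of "p' - p" 0] p'(3) rem(1) by (simp add: dist_norm)
    also have "\<dots> < 1" using R_pos[of "p' - p"] p'(2) rem(2) by simp
    finally show False using p'(1) by (simp add: Omega_def exp_poly_zero_shift[OF fin])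
  qed
  moreover have "Omega \<phi> \<subseteq> cube"
    using torus_subset_cube by (auto simp: Omega_def)
  ultimately show ?thesis
    using finite_not_islimpt_in_compact[OF compact_cube, of "Omega \<phi>"] by (simp add: Int_absorb1)
qed

section \<open>Assembling the estimate\<close>

text \<open>
  The contribution of one maximum point. Shifting by \<open>\<nu>\<close> bounds the coefficient by \<open>exp (- x \<bullet> \<nu>)\<close> times
  an integral consisting of the peak \<open>n powr - \<mu> * exp (n * (\<alpha> \<bullet> \<nu> + M * R \<nu>))\<close> and an exponentially
  small error. The exponents of the peak combine to \<open>- n * (y \<bullet> \<nu> - M * R \<nu>)\<close>, for which \<open>\<nu>\<close> is chosen by
  the Legendre-Fenchel transform. Since \<open>norm x \<le> n * B\<close>, a small \<open>\<nu>\<close> leaves the error exponentially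
  small, and a small \<open>c\<close> lets it be absorbed into the main term.
\<close>
lemma localized_coefficient_bound:
  fixes \<phi> :: "int ^ 'd \<Rightarrow> complex"
  assumes fin: "finite (supp \<phi>)" and le1: "\<And>\<xi>. norm (exp_poly \<phi> \<xi> 0) \<le> 1"
    and w: "\<omega> \<in> Omega \<phi>"
    and type: "pos_hom_type_with (fourier \<phi>) \<omega> \<alpha> P"
    and loc: "localizes (Omega \<phi>) \<omega> q"
    and B: "B \<ge> 0" and \<eta>\<^sub>0: "\<eta>\<^sub>0 > 0"
  shows "\<exists>c>0. \<exists>C>0. \<forall>n\<ge>1. \<forall>x. norm (real_vec x) \<le> real n * B \<longrightarrow>
    (let y = (real_vec x - real n *\<^sub>R \<alpha>) /\<^sub>R real n;
         l = legendre_fenchel (\<lambda>\<eta>. Re (P \<eta>)) y in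
     c * l \<le> \<eta>\<^sub>0 \<and>
     norm (torus_coefficient (\<lambda>\<xi> \<nu>. upper_binomial_tail n (q \<xi> \<nu>) * exp_poly \<phi> \<xi> \<nu> ^ n) x)
       \<le> C / real n powr hom_order P * exp (- real n * c * l))"
proof -
  have php: "pos_hom_polynomial P" using type by (simp add: pos_hom_type_with_def)
  obtain T where "homogeneous_symbol_volume P T (hom_order P)"
    using pos_hom_polynomial_homogeneous_symbol[OF php] by blast
  then interpret homogeneous_symbol_volume P T "hom_order P" .
  have q: "trig_poly q" "\<And>\<xi>. \<exists>u\<in>{0..1}. q \<xi> 0 = of_real u"
      "\<And>p. lattice_equiv p \<omega> \<Longrightarrow> q p 0 = 1"
      "\<And>\<omega>' p. \<omega>' \<in> Omega \<phi> \<Longrightarrow> \<omega>' \<noteq> \<omega> \<Longrightarrow> lattice_equiv p \<omega>' \<Longrightarrow> norm (q p 0) \<le> 1 / 32"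
    using loc unfolding localizes_def by blast+
  define F where "F = exp_poly \<phi>"
  have F: "trig_poly F" unfolding F_def by (rule trig_poly_exp_poly)
  have "norm (fourier \<phi> \<omega>) = 1" using w by (simp add: Omega_def)
  then obtain r\<^sub>0 \<epsilon> M where rem: "r\<^sub>0 > 0" "\<epsilon> > 0" "M > 0"
    "\<And>\<xi> \<nu>. norm \<xi> < r\<^sub>0 \<Longrightarrow> norm \<nu> < r\<^sub>0 \<Longrightarrow> norm (F (\<omega> + \<xi>) \<nu>) \<le> exp (\<alpha> \<bullet> \<nu> - \<epsilon> * R \<xi> + M * R \<nu>)"
    unfolding F_def using exp_poly_pos_hom_type_shift_bound[OF fin type] by blast
  define f where "f n = (\<lambda>\<xi> \<nu>. upper_binomial_tail n (q \<xi> \<nu>) * F \<xi> \<nu> ^ n)" for n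
  have f: "trig_poly (f n)" for n
    unfolding f_def by (intro trig_poly_mult trig_poly_upper_binomial_tail q(1) trig_poly_power F)
  define e where "e n \<nu> = exp (real n * (\<alpha> \<bullet> \<nu> + M * R \<nu>)) / real n powr hom_order P" for n \<nu>
  have e0: "e n \<nu> \<ge> 0" for n \<nu> by (simp add: e_def)
  have "\<exists>r>0. \<exists>C>0. \<exists>\<rho>. 0 < \<rho> \<and> \<rho> < 1 \<and> (\<forall>n\<ge>1. \<forall>\<nu>. norm \<nu> < r \<longrightarrow>
      (\<integral>\<^sup>+\<xi>\<in>cube. ennreal (norm (f n \<xi> \<nu>)) \<partial>lborel) \<le> ennreal (C * (\<rho> ^ n + e n \<nu>)))"
  proof (rule compact_patching[OF compact_cube])
    show "(\<lambda>\<xi>. ennreal (norm (f n \<xi> \<nu>))) \<in> borel_measurable borel" for n \<nu>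
      using borel_measurable_continuous_onI[OF trig_poly_continuous_fst[OF f]] by measurable
    show "e n \<nu> \<ge> 0" for n \<nu> by (rule e0)
    fix p :: "real ^ 'd"
    show "\<exists>r>0. \<exists>C>0. \<exists>\<rho>. 0 < \<rho> \<and> \<rho> < 1 \<and> (\<forall>n\<ge>1. \<forall>\<nu>. norm \<nu> < r \<longrightarrow>
      (\<integral>\<^sup>+\<xi>\<in>ball p r. ennreal (norm (f n \<xi> \<nu>)) \<partial>lborel) \<le> ennreal (C * (\<rho> ^ n + e n \<nu>)))"
    proof (cases "lattice_equiv p \<omega>")
      case True
      obtain C where C: "C > 0" "\<And>n u A p r. n \<ge> 1 \<Longrightarrow>
        (\<And>\<xi>. norm (\<xi> - p) < r \<Longrightarrow> u \<xi> \<le> ennreal (2 * exp (real n * (A - \<epsilon> * R (\<xi> - p))))) \<Longrightarrow>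
        (\<integral>\<^sup>+\<xi>\<in>ball p r. u \<xi> \<partial>lborel) \<le> ennreal (C * (exp (real n * A) / real n powr hom_order P))"
        using local_integral_at_peak[OF rem(2)] by blast
      have "continuous_on UNIV (\<lambda>z. norm (1 - q (fst z) (snd z)))"
        by (intro continuous_intros trig_poly_continuous q)
      then obtain r\<^sub>1 where r1: "r\<^sub>1 > 0" "\<And>\<xi> \<nu>. norm (\<xi> - p) < r\<^sub>1 \<Longrightarrow> norm \<nu> < r\<^sub>1 \<Longrightarrow> norm (1 - q \<xi> \<nu>) < 1 / 16"
        using continuous_pair_less[of "\<lambda>\<xi> \<nu>. norm (1 - q \<xi> \<nu>)" p "1/16"] q(3)[OF True] by auto
      define r where "r = min r\<^sub>0 r\<^sub>1"
      have "(\<integral>\<^sup>+\<xi>\<in>ball p r. ennreal (norm (f n \<xi> \<nu>)) \<partial>lborel) \<le> ennreal (C * ((1/2) ^ n + e n \<nu>))"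
        if n: "n \<ge> 1" and nu: "norm \<nu> < r" for n \<nu>
      proof -
        have "(\<integral>\<^sup>+\<xi>\<in>ball p r. ennreal (norm (f n \<xi> \<nu>)) \<partial>lborel)
          \<le> ennreal (C * (exp (real n * (\<alpha> \<bullet> \<nu> + M * R \<nu>)) / real n powr hom_order P))"
        proof (rule C(2)[OF n])
          fix \<xi> assume xi: "norm (\<xi> - p) < r"
          have "F \<xi> \<nu> = F (\<omega> + (\<xi> - p)) \<nu>"
            using trig_poly_lattice_equiv[OF F True, of "\<xi> - p" \<nu>] by simp
          then have "norm (F \<xi> \<nu>) \<le> exp (\<alpha> \<bullet> \<nu> - \<epsilon> * R (\<xi> - p) + M * R \<nu>)"
            using rem(4)[of "\<xi> - p" \<nu>] xi nu by (simp add: r_def)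
          then have "norm (F \<xi> \<nu>) ^ n \<le> exp (\<alpha> \<bullet> \<nu> - \<epsilon> * R (\<xi> - p) + M * R \<nu>) ^ n"
            by (intro power_mono) auto
          also have "\<dots> = exp (real n * (\<alpha> \<bullet> \<nu> + M * R \<nu> - \<epsilon> * R (\<xi> - p)))"
            by (simp add: algebra_simps flip: exp_of_nat_mult)
          finally have "norm (f n \<xi> \<nu>) \<le> 2 * exp (real n * (\<alpha> \<bullet> \<nu> + M * R \<nu> - \<epsilon> * R (\<xi> - p)))"
            unfolding f_def norm_mult norm_power using r1(2)[of \<xi> \<nu>] xi nu
            by (intro mult_mono norm_upper_binomial_tail_near_1_le) (auto simp: r_def)
          then show "ennreal (norm (f n \<xi> \<nu>)) \<le> ennreal (2 * exp (real n * (\<alpha> \<bullet> \<nu> + M * R \<nu> - \<epsilon> * R (\<xi> - p))))"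
            by (rule ennreal_leI)
        qed
        also have "\<dots> \<le> ennreal (C * ((1/2) ^ n + e n \<nu>))"
          using C(1) by (intro ennreal_leI mult_left_mono) (auto simp: e_def)
        finally show ?thesis .
      qed
      then show ?thesis using rem(1) r1(1) C(1)
        by (intro exI[of _ r] conjI exI[of _ C] exI[of _ "1/2 :: real"]) (auto simp: r_def)
    next
      case False
      have "(\<exists>u\<in>{0..1}. q p 0 = of_real u) \<and> norm (F p 0) < 1 \<or> norm (q p 0) \<le> 1 / 32 \<and> norm (F p 0) \<le> 1"
      proof (cases "norm (F p 0) < 1")
        case False
        then have p1: "norm (F p 0) = 1" using le1[of p] by (simp add: F_def)
        then obtain \<omega>' where "\<omega>' \<in> Omega \<phi>" "lattice_equiv p \<omega>'"
          using norm_one_imp_lattice_equiv_Omega[OF fin, of p] by (auto simp: F_def)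
        then show ?thesis using q(4)[of \<omega>' p] p1 \<open>\<not> lattice_equiv p \<omega>\<close> by auto
      qed (use q(2) in blast)
      then obtain r \<rho> where r: "r > 0" "0 < \<rho>" "\<rho> < 1"
        "\<And>n \<xi> \<nu>. norm (\<xi> - p) < r \<Longrightarrow> norm \<nu> < r \<Longrightarrow> norm (f n \<xi> \<nu>) \<le> \<rho> ^ n"
        using localized_power_off_peak[OF F q(1), of p] unfolding f_def by blast
      define C where "C = measure lborel (ball p r) + 1"
      have C: "C > 0" by (simp add: C_def add_nonneg_pos)
      have "(\<integral>\<^sup>+\<xi>\<in>ball p r. ennreal (norm (f n \<xi> \<nu>)) \<partial>lborel) \<le> ennreal (C * (\<rho> ^ n + e n \<nu>))"
        if "norm \<nu> < r" for n \<nu>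
      proof -
        have "(\<integral>\<^sup>+\<xi>\<in>ball p r. ennreal (norm (f n \<xi> \<nu>)) \<partial>lborel) \<le> ennreal (C * \<rho> ^ n)"
          unfolding C_def using r that by (intro nn_integral_ball_const_le ennreal_leI) auto
        also have "\<dots> \<le> ennreal (C * (\<rho> ^ n + e n \<nu>))"
          using C e0 by (intro ennreal_leI mult_left_mono) auto
        finally show ?thesis .
      qed
      then show ?thesis using r C by blast
    qed
  qed
  then obtain r C \<rho> where rC: "r > 0" "C > 0" "0 < \<rho>" "\<rho> < 1" "\<And>n \<nu>. n \<ge> 1 \<Longrightarrow> norm \<nu> < r \<Longrightarrow>
      (\<integral>\<^sup>+\<xi>\<in>cube. ennreal (norm (f n \<xi> \<nu>)) \<partial>lborel) \<le> ennreal (C * (\<rho> ^ n + e n \<nu>))"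
    by blast
  define \<delta> where "\<delta> = - ln \<rho>"
  have l0: "\<delta> > 0" using rC by (simp add: \<delta>_def)
  have \<rho>: "\<rho> ^ n = exp (- (\<delta> * real n))" for n
    using rC(3) by (simp add: \<delta>_def exp_of_nat2_mult)
  \<comment> \<open>The error decays like \<open>exp (- \<delta> * n)\<close>. Half of the rate is spent on \<open>exp (- x \<bullet> \<nu>)\<close>, a quarter on
    the Legendre-Fenchel factor, and a quarter on the power of \<open>n\<close>.\<close>
  define \<eta> where "\<eta> = min \<eta>\<^sub>0 (\<delta> / 4)"
  define \<nu>\<^sub>0 where "\<nu>\<^sub>0 = min r (\<delta> / (2 * (B + 1)))"
  have pos: "\<eta> > 0" "\<nu>\<^sub>0 > 0" "B + norm \<alpha> \<ge> 0" using l0 \<eta>\<^sub>0 rC(1) B by (auto simp: \<eta>_def \<nu>\<^sub>0_def)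
  have diff: "R differentiable (at 0)"
    using php by (intro Re_differentiable_of_polynomial_function) (simp add: pos_hom_polynomial_def)
  obtain c where c: "c > 0" "\<And>y. norm y \<le> B + norm \<alpha> \<Longrightarrow> c * legendre_fenchel R y \<le> \<eta>"
    "\<And>y. norm y \<le> B + norm \<alpha> \<Longrightarrow> \<exists>\<nu>. norm \<nu> < \<nu>\<^sub>0 \<and> c * legendre_fenchel R y \<le> y \<bullet> \<nu> - M * R \<nu>"
    using legendre_shift[OF diff rem(3) pos(2,1,3)] unfolding legendre_fenchel_def by blast
  have "\<delta> / 4 > 0" using l0 by simp
  then obtain C' where C': "C' > 0" "\<And>n. n \<ge> 1 \<Longrightarrow> exp (- (\<delta> / 4 * real n)) \<le> C' / real n powr hom_order P"
    using exp_decay_le_powr[of "\<delta> / 4" "hom_order P"] by blast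
  have "c * legendre_fenchel R ((real_vec x - real n *\<^sub>R \<alpha>) /\<^sub>R real n) \<le> \<eta>\<^sub>0 \<and>
     norm (torus_coefficient (f n) x)
       \<le> (C * (C' + 1)) / real n powr hom_order P * exp (- real n * c * legendre_fenchel R ((real_vec x - real n *\<^sub>R \<alpha>) /\<^sub>R real n))"
    if n: "n \<ge> 1" and x: "norm (real_vec x) \<le> real n * B" for n x
  proof -
    define y where "y = (real_vec x - real n *\<^sub>R \<alpha>) /\<^sub>R real n"
    define l where "l = legendre_fenchel R y"
    have n0: "real n > 0" using n by simp
    have "norm y \<le> (real n * B + real n * norm \<alpha>) / real n"
    proof -
      have "norm (real_vec x - real n *\<^sub>R \<alpha>) \<le> real n * B + real n * norm \<alpha>"
        using x norm_triangle_ineq4[of "real_vec x" "real n *\<^sub>R \<alpha>"] by simp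
      then show ?thesis unfolding y_def using n0 by (simp add: divide_right_mono divide_inverse_commute)
    qed
    also have "\<dots> = B + norm \<alpha>" using n0 by (simp add: add_divide_distrib)
    finally have y: "norm y \<le> B + norm \<alpha>" .
    obtain \<nu> where nu: "norm \<nu> < \<nu>\<^sub>0" "c * l \<le> y \<bullet> \<nu> - M * R \<nu>"
      using c(3)[OF y] unfolding l_def by blast
    have cl: "c * l \<le> \<eta>" unfolding l_def by (rule c(2)[OF y])
    have "ennreal (norm (torus_coefficient (f n) x))
      \<le> ennreal (exp (- (real_vec x \<bullet> \<nu>))) * (\<integral>\<^sup>+\<xi>\<in>cube. ennreal (norm (f n \<xi> \<nu>)) \<partial>lborel)"
      by (rule torus_coefficient_bound[OF f])
    also have "\<dots> \<le> ennreal (exp (- (real_vec x \<bullet> \<nu>))) * ennreal (C * (\<rho> ^ n + e n \<nu>))"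
      using nu(1) n by (intro mult_left_mono rC(5)) (auto simp: \<nu>\<^sub>0_def)
    also have "\<dots> = ennreal (exp (- (real_vec x \<bullet> \<nu>)) * (C * (\<rho> ^ n + e n \<nu>)))"
      by (rule ennreal_mult'[symmetric]) simp
    finally have I: "norm (torus_coefficient (f n) x)
      \<le> exp (- (real_vec x \<bullet> \<nu>)) * (C * (\<rho> ^ n + e n \<nu>))"
      using rC(2,3) e0[of n \<nu>] by (subst (asm) ennreal_le_iff) auto
    have t1: "exp (- (real_vec x \<bullet> \<nu>)) * \<rho> ^ n \<le> C' / real n powr hom_order P * exp (- real n * c * l)"
    proof -
      have "- (real_vec x \<bullet> \<nu>) \<le> norm (real_vec x) * norm \<nu>"
        using Cauchy_Schwarz_ineq2[of "real_vec x" \<nu>] by linarith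
      also have "\<dots> \<le> (real n * B) * (\<delta> / (2 * (B + 1)))"
        using x nu(1) B by (intro mult_mono) (auto simp: \<nu>\<^sub>0_def)
      also have "\<dots> = real n * \<delta> / 2 * (B / (B + 1))" by simp
      also have "\<dots> \<le> real n * \<delta> / 2 * 1" using B l0 by (intro mult_left_mono) auto
      finally have "- (real_vec x \<bullet> \<nu>) \<le> real n * \<delta> / 2" by simp
      moreover have "real n * (c * l) \<le> real n * (\<delta> / 4)" using cl by (intro mult_left_mono) (auto simp: \<eta>_def)
      ultimately have "- (real_vec x \<bullet> \<nu>) + - (\<delta> * real n) \<le> - (\<delta> / 4 * real n) + (- real n * c * l)"
        by (simp add: algebra_simps)
      then have "exp (- (real_vec x \<bullet> \<nu>)) * \<rho> ^ n \<le> exp (- (\<delta> / 4 * real n)) * exp (- real n * c * l)"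
        unfolding \<rho> by (simp flip: exp_add)
      also have "\<dots> \<le> C' / real n powr hom_order P * exp (- real n * c * l)"
        by (intro mult_right_mono C'(2) n) auto
      finally show ?thesis .
    qed
    have t2: "exp (- (real_vec x \<bullet> \<nu>)) * e n \<nu> \<le> 1 / real n powr hom_order P * exp (- real n * c * l)"
    proof -
      have "real n *\<^sub>R y = real_vec x - real n *\<^sub>R \<alpha>" using n0 by (simp add: y_def)
      then have "real_vec x = real n *\<^sub>R (y + \<alpha>)" by (simp add: scaleR_add_right)
      then have "- (real_vec x \<bullet> \<nu>) + real n * (\<alpha> \<bullet> \<nu> + M * R \<nu>) = - (real n * (y \<bullet> \<nu> - M * R \<nu>))"
        by (simp add: inner_add_left algebra_simps)
      also have "\<dots> \<le> - (real n * (c * l))" using nu(2) by (intro le_imp_neg_le mult_left_mono) auto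
      finally have "exp (- (real_vec x \<bullet> \<nu>) + real n * (\<alpha> \<bullet> \<nu> + M * R \<nu>)) \<le> exp (- real n * c * l)" by simp
      then show ?thesis
        unfolding e_def exp_add times_divide_eq_right times_divide_eq_left mult_1
        by (rule divide_right_mono) simp
    qed
    have "exp (- (real_vec x \<bullet> \<nu>)) * (C * (\<rho> ^ n + e n \<nu>))
      = C * (exp (- (real_vec x \<bullet> \<nu>)) * \<rho> ^ n + exp (- (real_vec x \<bullet> \<nu>)) * e n \<nu>)" by (simp add: algebra_simps)
    also have "\<dots> \<le> C * (C' / real n powr hom_order P * exp (- real n * c * l) + 1 / real n powr hom_order P * exp (- real n * c * l))"
      using rC(2) by (intro mult_left_mono add_mono t1 t2) auto
    also have "\<dots> = (C * (C' + 1)) / real n powr hom_order P * exp (- real n * c * l)"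
      by (simp add: add_divide_distrib algebra_simps)
    finally have "norm (torus_coefficient (f n) x)
      \<le> (C * (C' + 1)) / real n powr hom_order P * exp (- real n * c * l)" using I by linarith
    moreover have "c * l \<le> \<eta>\<^sub>0" using cl by (simp add: \<eta>_def)
    ultimately show ?thesis unfolding l_def y_def by blast
  qed
  moreover have "C * (C' + 1) > 0" using rC(2) C'(1) by simp
  ultimately show ?thesis using c(1) unfolding f_def F_def Let_def by blast
qed

text \<open>
  The cutoffs sum to 1 up to an exponentially small error near every maximum point, and elsewhere the
  power itself is exponentially small; so the part that the cutoffs miss decays exponentially.
\<close>
lemma remainder_coefficient_bound:
  fixes \<phi> :: "int ^ 'd \<Rightarrow> complex"
  assumes fin: "finite (supp \<phi>)" and le1: "\<And>\<xi>. norm (exp_poly \<phi> \<xi> 0) \<le> 1"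
    and finO: "finite (Omega \<phi>)"
    and loc: "\<And>\<omega>. \<omega> \<in> Omega \<phi> \<Longrightarrow> localizes (Omega \<phi>) \<omega> (q \<omega>)"
  shows "\<exists>C>0. \<exists>\<delta>>0. \<forall>n\<ge>1. \<forall>x.
    norm (torus_coefficient (\<lambda>\<xi> \<nu>. (1 - (\<Sum>\<omega>\<in>Omega \<phi>. upper_binomial_tail n (q \<omega> \<xi> \<nu>))) * exp_poly \<phi> \<xi> \<nu> ^ n) x)
      \<le> C * exp (- (\<delta> * real n))"
proof -
  have q: "\<And>\<omega>. \<omega> \<in> Omega \<phi> \<Longrightarrow> trig_poly (q \<omega>)" "\<And>\<omega> \<xi>. \<omega> \<in> Omega \<phi> \<Longrightarrow> \<exists>u\<in>{0..1}. q \<omega> \<xi> 0 = of_real u"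
      "\<And>\<omega> p. \<omega> \<in> Omega \<phi> \<Longrightarrow> lattice_equiv p \<omega> \<Longrightarrow> q \<omega> p 0 = 1"
      "\<And>\<omega> \<omega>' p. \<omega> \<in> Omega \<phi> \<Longrightarrow> \<omega>' \<in> Omega \<phi> \<Longrightarrow> \<omega>' \<noteq> \<omega> \<Longrightarrow> lattice_equiv p \<omega>' \<Longrightarrow> norm (q \<omega> p 0) \<le> 1 / 32"
    using loc unfolding localizes_def by blast+
  define F where "F = exp_poly \<phi>"
  have F: "trig_poly F" unfolding F_def by (rule trig_poly_exp_poly)
  define N where "N = 1 + real (card (Omega \<phi>))"
  have N0: "N > 0" by (simp add: N_def)
  define f where "f n = (\<lambda>\<xi> \<nu>. (1 - (\<Sum>\<omega>\<in>Omega \<phi>. upper_binomial_tail n (q \<omega> \<xi> \<nu>))) * F \<xi> \<nu> ^ n)" for n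
  have f: "trig_poly (f n)" for n
    unfolding f_def
    by (intro trig_poly_mult trig_poly_diff trig_poly_const trig_poly_sum trig_poly_upper_binomial_tail q(1) trig_poly_power F)
  have nhds: "\<exists>\<rho>. 0 < \<rho> \<and> \<rho> < 1 \<and> (\<forall>\<^sub>F \<xi> in nhds p. \<forall>n. norm (f n \<xi> 0) \<le> N * \<rho> ^ n)" for p
  proof (cases "norm (F p 0) < 1")
    case True
    obtain \<rho> where \<rho>: "norm (F p 0) < \<rho>" "\<rho> < 1" using dense[OF True] by blast
    have "isCont (\<lambda>\<xi>. norm (F \<xi> 0)) p"
      using continuous_on_norm[OF trig_poly_continuous_fst[OF F, of UNIV 0]]
      by (simp add: continuous_on_eq_continuous_at)
    then have "((\<lambda>\<xi>. norm (F \<xi> 0)) \<longlongrightarrow> norm (F p 0)) (nhds p)"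
      unfolding isCont_def by (rule tendsto_at_iff_tendsto_nhds[THEN iffD1])
    then have "\<forall>\<^sub>F \<xi> in nhds p. norm (F \<xi> 0) < \<rho>" using \<rho>(1) by (rule order_tendstoD(2))
    then have "\<forall>\<^sub>F \<xi> in nhds p. \<forall>n. norm (f n \<xi> 0) \<le> N * \<rho> ^ n"
    proof eventually_elim
      case (elim \<xi>)
      have W: "norm (upper_binomial_tail n (q \<omega> \<xi> 0)) \<le> 1" if w: "\<omega> \<in> Omega \<phi>" for n \<omega>
      proof -
        obtain u where u: "u \<in> {0..1}" "q \<omega> \<xi> 0 = of_real u" using q(2)[OF w] by blast
        have "1 - q \<omega> \<xi> 0 = of_real (1 - u)" using u(2) by simp
        then have "norm (1 - q \<omega> \<xi> 0) = 1 - u" using u(1) by (metis abs_of_nonneg atLeastAtMost_iff diff_ge_0_iff_ge norm_of_real)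
        then have "norm (q \<omega> \<xi> 0) + norm (1 - q \<omega> \<xi> 0) = 1" using u by simp
        then show ?thesis using norm_upper_binomial_tail_le[of n "q \<omega> \<xi> 0"] by simp
      qed
      have "norm (f n \<xi> 0) \<le> N * \<rho> ^ n" for n
      proof -
        have "norm (\<Sum>\<omega>\<in>Omega \<phi>. upper_binomial_tail n (q \<omega> \<xi> 0)) \<le> real (card (Omega \<phi>))"
          using sum_norm_le[of "Omega \<phi>" "\<lambda>\<omega>. upper_binomial_tail n (q \<omega> \<xi> 0)" "\<lambda>_. 1"] W by simp
        then have "norm (1 - (\<Sum>\<omega>\<in>Omega \<phi>. upper_binomial_tail n (q \<omega> \<xi> 0))) \<le> N"
          using norm_triangle_ineq4[of 1 "\<Sum>\<omega>\<in>Omega \<phi>. upper_binomial_tail n (q \<omega> \<xi> 0)"] by (simp add: N_def)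
        then show ?thesis unfolding f_def norm_mult norm_power using elim N0
          by (intro mult_mono power_mono) auto
      qed
      then show ?case by blast
    qed
    moreover have "0 < \<rho>" using \<rho>(1) norm_ge_zero[of "F p 0"] by linarith
    ultimately show ?thesis using \<rho>(2) by blast
  next
    case False
    then have "norm (F p 0) = 1" using le1[of p] by (simp add: F_def)
    then obtain \<omega>' where w': "\<omega>' \<in> Omega \<phi>" "lattice_equiv p \<omega>'"
      using norm_one_imp_lattice_equiv_Omega[OF fin, of p] by (auto simp: F_def)
    define g where "g \<omega> \<xi> = (if \<omega> = \<omega>' then norm (1 - q \<omega> \<xi> 0) else norm (q \<omega> \<xi> 0))" for \<omega> \<xi>
    have "\<forall>\<^sub>F \<xi> in nhds p. \<forall>\<omega>\<in>Omega \<phi>. g \<omega> \<xi> < 1 / 16"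
    proof (rule eventually_ball_finite[OF finO], rule ballI)
      fix \<omega> assume w: "\<omega> \<in> Omega \<phi>"
      have "continuous_on UNIV (g \<omega>)"
        using trig_poly_continuous_fst[OF q(1)[OF w], of UNIV 0] unfolding g_def
        by (cases "\<omega> = \<omega>'") (auto intro!: continuous_intros)
      then have "isCont (g \<omega>) p" by (simp add: continuous_on_eq_continuous_at)
      then have "((g \<omega>) \<longlongrightarrow> g \<omega> p) (nhds p)"
        unfolding isCont_def by (rule tendsto_at_iff_tendsto_nhds[THEN iffD1])
      moreover have "g \<omega> p < 1 / 16"
        using q(3)[OF w'] q(4)[OF w w'(1) _ w'(2)] by (auto simp: g_def)
      ultimately show "\<forall>\<^sub>F \<xi> in nhds p. g \<omega> \<xi> < 1 / 16" by (rule order_tendstoD(2))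
    qed
    then have "\<forall>\<^sub>F \<xi> in nhds p. \<forall>n. norm (f n \<xi> 0) \<le> N * (1/2) ^ n"
    proof eventually_elim
      case (elim \<xi>)
      have "norm (f n \<xi> 0) \<le> N * (1/2) ^ n" for n
      proof -
        let ?W = "\<lambda>\<omega>. upper_binomial_tail n (q \<omega> \<xi> 0)"
        have "1 - (\<Sum>\<omega>\<in>Omega \<phi>. ?W \<omega>) = (1 - ?W \<omega>') - (\<Sum>\<omega>\<in>Omega \<phi> - {\<omega>'}. ?W \<omega>)"
          using finO w'(1) by (simp add: sum.remove[of _ \<omega>'])
        also have "norm \<dots> \<le> norm (1 - ?W \<omega>') + norm (\<Sum>\<omega>\<in>Omega \<phi> - {\<omega>'}. ?W \<omega>)"
          by (rule norm_triangle_ineq4)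
        also have "\<dots> \<le> (1/2) ^ n + (\<Sum>\<omega>\<in>Omega \<phi> - {\<omega>'}. (1/2) ^ n)"
        proof (intro add_mono sum_norm_le)
          show "norm (1 - ?W \<omega>') \<le> (1/2) ^ n"
          proof (rule upper_binomial_tail_near_1)
            have "g \<omega>' \<xi> < 1 / 16" using elim w'(1) by blast
            then show "norm (1 - q \<omega>' \<xi> 0) \<le> 1 / 16" by (simp add: g_def)
          qed
          show "norm (?W \<omega>) \<le> (1/2) ^ n" if "\<omega> \<in> Omega \<phi> - {\<omega>'}" for \<omega>
          proof (rule upper_binomial_tail_near_0)
            have "g \<omega> \<xi> < 1 / 16" using elim that by blast
            then show "norm (q \<omega> \<xi> 0) \<le> 1 / 16" using that by (simp add: g_def)
          qed
        qed
        also have "\<dots> \<le> (1/2) ^ n + (\<Sum>\<omega>\<in>Omega \<phi>. (1/2) ^ n)"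
          using finO by (intro add_left_mono sum_mono2) auto
        also have "\<dots> = N * (1/2) ^ n" by (simp add: N_def algebra_simps)
        finally have 1: "norm (1 - (\<Sum>\<omega>\<in>Omega \<phi>. ?W \<omega>)) \<le> N * (1/2) ^ n" .
        have "norm (F \<xi> 0) ^ n \<le> 1" using le1[of \<xi>] by (intro power_le_one) (auto simp: F_def)
        then have "norm (f n \<xi> 0) \<le> (N * (1/2) ^ n) * 1"
          unfolding f_def norm_mult norm_power using 1 N0 by (intro mult_mono) auto
        then show ?thesis by simp
      qed
      then show ?case by blast
    qed
    then show ?thesis by (intro exI[of _ "1/2 :: real"]) auto
  qed
  have "\<exists>r>0. \<exists>C>0. \<exists>\<rho>. 0 < \<rho> \<and> \<rho> < 1 \<and> (\<forall>n\<ge>1. \<forall>\<nu>::real. norm \<nu> < r \<longrightarrow>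
      (\<integral>\<^sup>+\<xi>\<in>cube. ennreal (norm (f n \<xi> 0)) \<partial>lborel) \<le> ennreal (C * (\<rho> ^ n + 0)))"
  proof (rule compact_patching[OF compact_cube])
    show "(\<lambda>\<xi>. ennreal (norm (f n \<xi> 0))) \<in> borel_measurable borel" for n
      using borel_measurable_continuous_onI[OF trig_poly_continuous_fst[OF f]] by measurable
    fix p :: "real ^ 'd"
    obtain \<rho> where \<rho>: "0 < \<rho>" "\<rho> < 1" "\<forall>\<^sub>F \<xi> in nhds p. \<forall>n. norm (f n \<xi> 0) \<le> N * \<rho> ^ n"
      using nhds[of p] by blast
    obtain r where r: "r > 0" "\<And>\<xi> n. dist \<xi> p < r \<Longrightarrow> norm (f n \<xi> 0) \<le> N * \<rho> ^ n"
      using \<rho>(3) unfolding eventually_nhds_metric by blast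
    define C where "C = (measure lborel (ball p r) + 1) * N"
    have C: "C > 0" using N0 by (simp add: C_def add_nonneg_pos)
    have "(\<integral>\<^sup>+\<xi>\<in>ball p r. ennreal (norm (f n \<xi> 0)) \<partial>lborel) \<le> ennreal (C * (\<rho> ^ n + 0))" for n
    proof -
      have "(\<integral>\<^sup>+\<xi>\<in>ball p r. ennreal (norm (f n \<xi> 0)) \<partial>lborel) \<le> ennreal ((measure lborel (ball p r) + 1) * (N * \<rho> ^ n))"
        using r \<rho>(1) N0 by (intro nn_integral_ball_const_le ennreal_leI) (auto simp: dist_norm)
      then show ?thesis by (simp add: C_def mult.assoc)
    qed
    then show "\<exists>r>0. \<exists>C>0. \<exists>\<rho>. 0 < \<rho> \<and> \<rho> < 1 \<and> (\<forall>n\<ge>1. \<forall>\<nu>::real. norm \<nu> < r \<longrightarrow>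
      (\<integral>\<^sup>+\<xi>\<in>ball p r. ennreal (norm (f n \<xi> 0)) \<partial>lborel) \<le> ennreal (C * (\<rho> ^ n + 0)))"
      using r(1) C \<rho>(1,2) by blast
  qed simp
  then obtain r C \<rho> where C: "C > 0" "0 < \<rho>" "\<rho> < 1" and r: "r > 0" and
    bound: "\<And>n \<nu>. n \<ge> 1 \<Longrightarrow> norm (\<nu> :: real) < r \<Longrightarrow>
      (\<integral>\<^sup>+\<xi>\<in>cube. ennreal (norm (f n \<xi> 0)) \<partial>lborel) \<le> ennreal (C * (\<rho> ^ n + 0))"
    by blast
  define \<delta> where "\<delta> = - ln \<rho>"
  have l0: "\<delta> > 0" using C by (simp add: \<delta>_def)
  have \<rho>: "\<rho> ^ n = exp (- (\<delta> * real n))" for n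
    using C(2) by (simp add: \<delta>_def exp_of_nat2_mult)
  have "norm (torus_coefficient (f n) x) \<le> C * exp (- (\<delta> * real n))" if n: "n \<ge> 1" for n x
  proof -
    have "ennreal (norm (torus_coefficient (f n) x))
      \<le> ennreal (exp (- (real_vec x \<bullet> 0))) * (\<integral>\<^sup>+\<xi>\<in>cube. ennreal (norm (f n \<xi> 0)) \<partial>lborel)"
      by (rule torus_coefficient_bound[OF f])
    also have "\<dots> \<le> ennreal (C * \<rho> ^ n)" using bound[OF n, of 0] r by simp
    finally show ?thesis unfolding \<rho> using C(1) by (subst (asm) ennreal_le_iff) auto
  qed
  then show ?thesis using C(1) l0 unfolding f_def F_def by blast
qed

theorem theorem1p9:
  fixes \<phi> :: "int ^ 'd \<Rightarrow> complex"
    and \<alpha> :: "real ^ 'd \<Rightarrow> real ^ 'd"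
    and P :: "real ^ 'd \<Rightarrow> real ^ 'd \<Rightarrow> complex"
  assumes "finite {x. \<phi> x \<noteq> 0}"
    and "\<phi> \<in> H_class_normalized"
    and "\<And>\<xi>. \<xi> \<in> Omega \<phi> \<Longrightarrow> pos_hom_type_with (fourier \<phi>) \<xi> (\<alpha> \<xi>) (P \<xi>)"
  shows "\<exists>M C :: real ^ 'd \<Rightarrow> real.
    (\<forall>\<xi>\<in>Omega \<phi>. M \<xi> > 0 \<and> C \<xi> > 0) \<and>
    (\<forall>n\<ge>1. \<forall>x. cmod (conv_power \<phi> n x) \<le>
      (\<Sum>\<xi>\<in>Omega \<phi>. C \<xi> / real n powr hom_order (P \<xi>) *
        exp (- real n * M \<xi> *
          legendre_fenchel (\<lambda>\<eta>. Re (P \<xi> \<eta>))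
            ((real_vec x - real n *\<^sub>R \<alpha> \<xi>) /\<^sub>R real n))))"
proof -
  have fin: "finite (supp \<phi>)" using assms(1) by (simp add: supp_def)
  have le1: "norm (exp_poly \<phi> \<xi> 0) \<le> 1" for \<xi> by (rule normalized_exp_poly(1)[OF fin assms(2)])
  have finO: "finite (Omega \<phi>)" by (rule finite_Omega[OF fin assms(3)])
  obtain \<omega>\<^sub>0 where w0: "\<omega>\<^sub>0 \<in> Omega \<phi>" using normalized_exp_poly(2)[OF fin assms(2)] by blast
  have sub: "Omega \<phi> \<subseteq> torus" by (auto simp: Omega_def)
  have "\<forall>\<omega>\<in>Omega \<phi>. \<exists>q. localizes (Omega \<phi>) \<omega> q"
    using localizing_trig_poly[OF finO sub] by blast
  then obtain q where loc: "\<And>\<omega>. \<omega> \<in> Omega \<phi> \<Longrightarrow> localizes (Omega \<phi>) \<omega> (q \<omega>)" by metis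
  have q: "trig_poly (q \<omega>)" if "\<omega> \<in> Omega \<phi>" for \<omega>
    using loc[OF that] unfolding localizes_def by blast
  define B where "B = (\<Sum>x\<in>supp \<phi>. norm (real_vec x))"
  have B0: "B \<ge> 0" unfolding B_def by (intro sum_nonneg) auto
  have B: "norm (real_vec x) \<le> B" if "x \<in> supp \<phi>" for x
    unfolding B_def using member_le_sum[OF that, of "\<lambda>x. norm (real_vec x)"] fin by simp
  define f where "f \<omega> n = (\<lambda>\<xi> \<nu>. upper_binomial_tail n (q \<omega> \<xi> \<nu>) * exp_poly \<phi> \<xi> \<nu> ^ n)" for \<omega> n
  define g where "g n = (\<lambda>\<xi> \<nu>. (1 - (\<Sum>\<omega>\<in>Omega \<phi>. upper_binomial_tail n (q \<omega> \<xi> \<nu>))) * exp_poly \<phi> \<xi> \<nu> ^ n)" for n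
  have f: "trig_poly (f \<omega> n)" if "\<omega> \<in> Omega \<phi>" for \<omega> n
    unfolding f_def
    by (intro trig_poly_mult trig_poly_upper_binomial_tail q[OF that] trig_poly_power trig_poly_exp_poly)
  have g: "trig_poly (g n)" for n
    unfolding g_def
    by (intro trig_poly_mult trig_poly_diff trig_poly_const trig_poly_sum trig_poly_upper_binomial_tail q
        trig_poly_power trig_poly_exp_poly)
  obtain C\<^sub>r \<delta> where Cr: "C\<^sub>r > 0" "\<delta> > 0"
    "\<And>n x. n \<ge> 1 \<Longrightarrow> norm (torus_coefficient (g n) x) \<le> C\<^sub>r * exp (- (\<delta> * real n))"
    unfolding g_def
    using remainder_coefficient_bound[OF fin le1 finO loc] by blast
  define l where "l \<omega> n x = legendre_fenchel (\<lambda>\<eta>. Re (P \<omega> \<eta>)) ((real_vec x - real n *\<^sub>R \<alpha> \<omega>) /\<^sub>R real n)" for \<omega> n x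
  define I where "I \<omega> n x = torus_coefficient (f \<omega> n) x" for \<omega> n x
  have l2: "\<delta> / 2 > 0" using Cr(2) by simp
  define ok where "ok \<omega> c C \<longleftrightarrow> c > 0 \<and> C > 0 \<and> (\<forall>n\<ge>1. \<forall>x. norm (real_vec x) \<le> real n * B \<longrightarrow>
     c * l \<omega> n x \<le> \<delta> / 2 \<and> norm (I \<omega> n x) \<le> C / real n powr hom_order (P \<omega>) * exp (- real n * c * l \<omega> n x))" for \<omega> c C
  have "\<exists>c C. ok \<omega> c C" if w: "\<omega> \<in> Omega \<phi>" for \<omega>
    using localized_coefficient_bound[OF fin le1 w assms(3)[OF w] loc[OF w] B0 l2]
    unfolding ok_def l_def I_def f_def Let_def by blast
  then obtain M C where ok: "\<And>\<omega>. \<omega> \<in> Omega \<phi> \<Longrightarrow> ok \<omega> (M \<omega>) (C \<omega>)" by metis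
  have MC: "M \<omega> > 0" "C \<omega> > 0" if "\<omega> \<in> Omega \<phi>" for \<omega>
    using ok[OF that] by (auto simp: ok_def)
  obtain C\<^sub>0 where C0: "C\<^sub>0 > 0" "\<And>n. n \<ge> 1 \<Longrightarrow> exp (- (\<delta> / 2 * real n)) \<le> C\<^sub>0 / real n powr hom_order (P \<omega>\<^sub>0)"
    using exp_decay_le_powr[OF l2] by blast
  \<comment> \<open>The remainder is absorbed by the summand of \<open>\<omega>\<^sub>0\<close>; for uniformity the extra constant is added to
    all of them.\<close>
  define D where "D \<omega> = C \<omega> + C\<^sub>r * C\<^sub>0" for \<omega>
  have D: "D \<omega> > 0" if "\<omega> \<in> Omega \<phi>" for \<omega> using MC[OF that] Cr(1) C0(1) by (simp add: D_def add_pos_pos)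
  have "cmod (conv_power \<phi> n x) \<le> (\<Sum>\<omega>\<in>Omega \<phi>. D \<omega> / real n powr hom_order (P \<omega>) * exp (- real n * M \<omega> * l \<omega> n x))"
    if n: "n \<ge> 1" for n x
  proof (cases "x \<in> supp (conv_power \<phi> n)")
    case False
    then have "conv_power \<phi> n x = 0" by (simp add: supp_def)
    moreover have "0 \<le> (\<Sum>\<omega>\<in>Omega \<phi>. D \<omega> / real n powr hom_order (P \<omega>) * exp (- real n * M \<omega> * l \<omega> n x))"
      by (intro sum_nonneg mult_nonneg_nonneg divide_nonneg_nonneg) (auto intro: less_imp_le D)
    ultimately show ?thesis by simp
  next
    case True
    \<comment> \<open>Finite propagation bounds the arguments of the Legendre-Fenchel transforms.\<close>
    have x: "norm (real_vec x) \<le> real n * B" by (rule exp_poly_conv_power(2)[OF fin B n True])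
    define J where "J = torus_coefficient (g n) x"
    have "exp_poly (conv_power \<phi> n) = (\<lambda>\<xi> \<nu>. (\<Sum>\<omega>\<in>Omega \<phi>. f \<omega> n \<xi> \<nu>) + g n \<xi> \<nu>)"
      unfolding f_def g_def
      by (simp add: fun_eq_iff exp_poly_conv_power(3)[OF fin B n] sum_distrib_right[symmetric] left_diff_distrib)
    then have "torus_coefficient (exp_poly (conv_power \<phi> n)) x = (\<Sum>\<omega>\<in>Omega \<phi>. I \<omega> n x) + J"
      unfolding I_def J_def
      by (simp only: torus_coefficient_add torus_coefficient_sum trig_poly_sum f g)
    then have eq: "of_real ((2 * pi) ^ CARD('d)) * conv_power \<phi> n x = (\<Sum>\<omega>\<in>Omega \<phi>. I \<omega> n x) + J"
      by (simp only: fourier_inversion[OF exp_poly_conv_power(1)[OF fin B n]])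
    have "1 \<le> (2 * pi) ^ CARD('d)" using pi_gt3 by (intro one_le_power) simp
    then have "cmod (conv_power \<phi> n x) \<le> (2 * pi) ^ CARD('d) * cmod (conv_power \<phi> n x)"
      using mult_right_mono[of 1 "(2 * pi) ^ CARD('d)" "cmod (conv_power \<phi> n x)"] by simp
    also have "\<dots> = norm ((\<Sum>\<omega>\<in>Omega \<phi>. I \<omega> n x) + J)"
      unfolding eq[symmetric] by (simp add: norm_mult norm_power)
    also have "\<dots> \<le> norm (\<Sum>\<omega>\<in>Omega \<phi>. I \<omega> n x) + norm J" by (rule norm_triangle_ineq)
    also have "\<dots> \<le> (\<Sum>\<omega>\<in>Omega \<phi>. C \<omega> / real n powr hom_order (P \<omega>) * exp (- real n * M \<omega> * l \<omega> n x))
        + (\<Sum>\<omega>\<in>Omega \<phi>. C\<^sub>r * C\<^sub>0 / real n powr hom_order (P \<omega>) * exp (- real n * M \<omega> * l \<omega> n x))"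
    proof (intro add_mono sum_norm_le)
      show "norm (I \<omega> n x) \<le> C \<omega> / real n powr hom_order (P \<omega>) * exp (- real n * M \<omega> * l \<omega> n x)" if "\<omega> \<in> Omega \<phi>" for \<omega>
        using ok[OF that] n x unfolding ok_def by blast
      have "M \<omega>\<^sub>0 * l \<omega>\<^sub>0 n x \<le> \<delta> / 2" using ok[OF w0] n x unfolding ok_def by blast
      then have "real n * (M \<omega>\<^sub>0 * l \<omega>\<^sub>0 n x) \<le> real n * (\<delta> / 2)" by (intro mult_left_mono) auto
      then have "exp (- (\<delta> * real n)) \<le> exp (- (\<delta> / 2 * real n)) * exp (- real n * M \<omega>\<^sub>0 * l \<omega>\<^sub>0 n x)"
        by (simp add: algebra_simps flip: exp_add)
      also have "\<dots> \<le> C\<^sub>0 / real n powr hom_order (P \<omega>\<^sub>0) * exp (- real n * M \<omega>\<^sub>0 * l \<omega>\<^sub>0 n x)"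
        by (intro mult_right_mono C0(2) n) auto
      finally have "C\<^sub>r * exp (- (\<delta> * real n)) \<le> C\<^sub>r * (C\<^sub>0 / real n powr hom_order (P \<omega>\<^sub>0) * exp (- real n * M \<omega>\<^sub>0 * l \<omega>\<^sub>0 n x))"
        using Cr(1) by (intro mult_left_mono) auto
      then have "norm J \<le> C\<^sub>r * C\<^sub>0 / real n powr hom_order (P \<omega>\<^sub>0) * exp (- real n * M \<omega>\<^sub>0 * l \<omega>\<^sub>0 n x)"
        using Cr(3)[OF n, of x] unfolding J_def by (simp add: mult.assoc)
      also have "\<dots> \<le> (\<Sum>\<omega>\<in>Omega \<phi>. C\<^sub>r * C\<^sub>0 / real n powr hom_order (P \<omega>) * exp (- real n * M \<omega> * l \<omega> n x))"
        using finO Cr(1) C0(1)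
        by (intro member_le_sum[OF w0, of "\<lambda>\<omega>. C\<^sub>r * C\<^sub>0 / real n powr hom_order (P \<omega>) * exp (- real n * M \<omega> * l \<omega> n x)"]) auto
      finally show "norm J \<le> (\<Sum>\<omega>\<in>Omega \<phi>. C\<^sub>r * C\<^sub>0 / real n powr hom_order (P \<omega>) * exp (- real n * M \<omega> * l \<omega> n x))" .
    qed
    also have "\<dots> = (\<Sum>\<omega>\<in>Omega \<phi>. D \<omega> / real n powr hom_order (P \<omega>) * exp (- real n * M \<omega> * l \<omega> n x))"
      by (simp add: D_def add_divide_distrib distrib_right sum.distrib)
    finally show ?thesis .
  qed
  then show ?thesis using MC D unfolding l_def by blast
qed

end
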